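(* Fix $\alpha$ with $0<\alpha<0.2$ and consider first passage percolation with law $\nu_\alpha$. In every direction not parallel to the coordinate axes the variance exponent is $\chi=0$ and the wandering exponent is $\xi=1$; that is, for every $0<\lambda\le1$, $\chi(\lambda)=0$ and $\xi_\lambda=1$. Parallel to the coordinate axes the two exponents are equal: $$\chi(0)=\xi_0=\frac{\log 5}{\log 5-\log\alpha}.$$ In no direction do the exponents satisfy the relation $\chi=2\xi-1$.
   Context: Model. $\mathbb Z^2$ is the nearest-neighbour square lattice, with edge set $\mathcal E$; $\mathsf e_1,\mathsf e_2$ are the canonical basis vectors. Fix $0<\alpha<0.2$. Let $\mathbb N=\{0,1,2,\dots\}$ and $\Omega=\{0,1,2,3,4\}^{\mathbb N}$ with the uniform (product) probability measure. Let $\sigma:\Omega\to\Omega$ be the 5-adic adding machine: add one (mod 5) to the first coordinate; as long as the result is $0$, carry and add one (mod 5) to the next coordinate; all later coordinates are unchanged; $\sigma(444\dots)=000\dots$. The map $\sigma$ is a bijection. Put $L(\omega)=\min\{i:\omega(i)>0\}$ (defined off a null set). Let $\omega_1,\omega_2$ be independent and uniform on $\Omega$. For a vertex $v=(x,y)$ set $k(v,v+\mathsf e_1)=L(\sigma^{y}(\omega_1))$ and $k(v,v+\mathsf e_2)=L(\sigma^{x}(\omega_2))$. Let $\{X_{j,e}\}_{j\in\mathbb N,e\in\mathcal E}$ be independent, independent of $(\omega_1,\omega_2)$, with $X_{j,e}$ uniform on $[0,\alpha^j(1-\alpha)/1000]$. The passage time of the edge $e$ is $t_e=1+\alpha^{k(e)}+X_{k(e),e}$,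 and $\nu_\alpha$ is the law of $(t_e)_{e\in\mathcal E}$. The length of a finite path is $\Gamma(\pi)=\sum_{e\in\pi}t_e$, and $T(u,v)=\inf\Gamma(\pi)$ over paths $\pi$ from $u$ to $v$. A geodesic between $u$ and $v$ is a path attaining this infimum; almost surely it exists and is unique and is denoted $\gamma(u,v)$. For points of $\mathbb R^2$, $T$ and $\gamma$ are understood after applying the floor function to each coordinate. Exponents. For $0\le\lambda\le1$ let $x_n^\lambda=(n,\lambda n)$. The variance exponent $\chi(\lambda)$ is the number such that $\mathrm{Var}(T(\mathbf 0,x_n^\lambda))=n^{2\chi(\lambda)+o(1)}$ as $n\to\infty$. Let $\mathrm{Cyl}(x_n^\lambda,N)$ be the set of points within Euclidean distance $N$ of the line through $\mathbf 0$ and $x_n^\lambda$. The wandering exponent is $$\xi_\lambda=\inf\{a>0:\ \liminf_{n}\ \mathbb P(\gamma(\mathbf 0,x_n^\lambda)\subset \mathrm{Cyl}(x_n^\lambda,n^{a}))>0\}.$$ All other directions reduce to $0\le\lambda\le1$ via the symmetries of $\mathbb Z^2$, under which $\nu_\alpha$ is invariant; $\lambda=0$ is the coordinate direction. *)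

theory Defs
  imports "HOL-Probability.Probability"
begin

definition digit_seqs :: "(nat \<Rightarrow> nat) set" where
  "digit_seqs = (UNIV \<rightarrow>\<^sub>E {..<5})"

definition digit_measure :: "(nat \<Rightarrow> nat) measure" where
  "digit_measure = (\<Pi>\<^sub>M i\<in>UNIV. uniform_count_measure {..<5})"

text \<open>The 5-adic adding machine: the carry reaches coordinate \<open>i\<close> iff all earlier digits are 4.\<close>

definition adding_machine :: "(nat \<Rightarrow> nat) \<Rightarrow> nat \<Rightarrow> nat" where
  "adding_machine \<omega> = (\<lambda>i. if \<forall>j<i. \<omega> j = 4 then (\<omega> i + 1) mod 5 else \<omega> i)"

text \<open>Integer iterates; negative powers use the inverse of the bijection of \<open>digit_seqs\<close>.\<close>

definition adding_machine_pow :: "int \<Rightarrow> (nat \<Rightarrow> nat) \<Rightarrow> nat \<Rightarrow> nat" where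
  "adding_machine_pow m =
     (if 0 \<le> m then adding_machine ^^ nat m
      else inv_into digit_seqs adding_machine ^^ nat (- m))"

definition first_nonzero :: "(nat \<Rightarrow> nat) \<Rightarrow> nat" where
  "first_nonzero \<omega> = (LEAST i. \<omega> i > 0)"

type_synonym vertex = "int \<times> int"

text \<open>Each undirected edge of the square lattice is represented once, by its axis and its
  lower or left endpoint.\<close>

datatype edge = Hor vertex | Ver vertex

fun endpoints :: "edge \<Rightarrow> vertex set" where
  "endpoints (Hor v) = {v, v + (1, 0)}"
| "endpoints (Ver v) = {v, v + (0, 1)}"

definition adjacent :: "vertex \<Rightarrow> vertex \<Rightarrow> bool" where
  "adjacent u v \<longleftrightarrow> (\<exists>e. endpoints e = {u, v})"

definition edge_between :: "vertex \<Rightarrow> vertex \<Rightarrow> edge" where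
  "edge_between u v = (THE e. endpoints e = {u, v})"

fun level :: "(nat \<Rightarrow> nat) \<Rightarrow> (nat \<Rightarrow> nat) \<Rightarrow> edge \<Rightarrow> nat" where
  "level \<omega>1 \<omega>2 (Hor (x, y)) = first_nonzero (adding_machine_pow y \<omega>1)"
| "level \<omega>1 \<omega>2 (Ver (x, y)) = first_nonzero (adding_machine_pow x \<omega>2)"

definition noise_measure :: "real \<Rightarrow> (nat \<times> edge \<Rightarrow> real) measure" where
  "noise_measure \<alpha> =
     (\<Pi>\<^sub>M p\<in>UNIV. uniform_measure lborel {0 .. \<alpha> ^ fst p * (1 - \<alpha>) / 1000})"

definition passage_time ::
    "real \<Rightarrow> (nat \<Rightarrow> nat) \<times> (nat \<Rightarrow> nat) \<times> (nat \<times> edge \<Rightarrow> real) \<Rightarrow> edge \<Rightarrow> real" where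
  "passage_time \<alpha> = (\<lambda>(\<omega>1, \<omega>2, X) e.
     1 + \<alpha> ^ level \<omega>1 \<omega>2 e + X (level \<omega>1 \<omega>2 e, e))"

definition \<nu> :: "real \<Rightarrow> (edge \<Rightarrow> real) measure" where
  "\<nu> \<alpha> = distr (digit_measure \<Otimes>\<^sub>M digit_measure \<Otimes>\<^sub>M noise_measure \<alpha>)
     (\<Pi>\<^sub>M e\<in>UNIV. borel) (passage_time \<alpha>)"

text \<open>Paths are vertex lists and need not be self-avoiding; a repeated edge counts with
  multiplicity. Since passage times are almost surely at least 1, restricting to self-avoiding
  paths would change neither distances nor geodesics, up to a null set.\<close>

definition is_path :: "vertex \<Rightarrow> vertex \<Rightarrow> vertex list \<Rightarrow> bool" where
  "is_path u v p \<longleftrightarrow> p \<noteq> [] \<and> hd p = u \<and> last p = v \<and> successively adjacent p"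

definition path_edges :: "vertex list \<Rightarrow> edge list" where
  "path_edges p = map2 edge_between p (tl p)"

definition path_length :: "(edge \<Rightarrow> real) \<Rightarrow> vertex list \<Rightarrow> real" where
  "path_length t p = (\<Sum>e\<leftarrow>path_edges p. t e)"

definition distance :: "(edge \<Rightarrow> real) \<Rightarrow> vertex \<Rightarrow> vertex \<Rightarrow> real" where
  "distance t u v = (INF p\<in>Collect (is_path u v). path_length t p)"

definition is_geodesic :: "(edge \<Rightarrow> real) \<Rightarrow> vertex \<Rightarrow> vertex \<Rightarrow> vertex list \<Rightarrow> bool" where
  "is_geodesic t u v p \<longleftrightarrow> is_path u v p \<and> path_length t p = distance t u v"

text \<open>The default value \<open>[]\<close> is taken only on a null set; fixing it (rather than leaving
  \<open>THE\<close> unspecified) keeps events about the geodesic measurable.\<close>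

definition geodesic :: "(edge \<Rightarrow> real) \<Rightarrow> vertex \<Rightarrow> vertex \<Rightarrow> vertex list" where
  "geodesic t u v =
     (if \<exists>!p. is_geodesic t u v p then THE p. is_geodesic t u v p else [])"

fun floor_point :: "real \<times> real \<Rightarrow> vertex" where
  "floor_point (x, y) = (\<lfloor>x\<rfloor>, \<lfloor>y\<rfloor>)"

fun plane_point :: "vertex \<Rightarrow> real \<times> real" where
  "plane_point (x, y) = (of_int x, of_int y)"

definition target :: "real \<Rightarrow> nat \<Rightarrow> real \<times> real" where
  "target s n = (real n, s * real n)"

definition variance_T :: "real \<Rightarrow> real \<Rightarrow> nat \<Rightarrow> real" where
  "variance_T \<alpha> s n =
     prob_space.variance (\<nu> \<alpha>) (\<lambda>t. distance t (floor_point 0) (floor_point (target s n)))"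

definition has_variance_exponent :: "real \<Rightarrow> real \<Rightarrow> real \<Rightarrow> bool" where
  "has_variance_exponent \<alpha> s c \<longleftrightarrow>
     (\<exists>\<epsilon>. \<epsilon> \<longlonglongrightarrow> 0 \<and>
       (\<forall>\<^sub>F n in sequentially. variance_T \<alpha> s n = real n powr (2 * c + \<epsilon> n)))"

definition variance_exponent :: "real \<Rightarrow> real \<Rightarrow> real" where
  "variance_exponent \<alpha> s = (THE c. has_variance_exponent \<alpha> s c)"

definition cyl :: "real \<times> real \<Rightarrow> real \<Rightarrow> (real \<times> real) set" where
  "cyl x N = {z. infdist z (affine hull {0, x}) \<le> N}"

text \<open>Since \<open>cyl\<close> is convex, a path lies in it iff its vertices do.\<close>

definition prob_geodesic_in_cyl :: "real \<Rightarrow> real \<Rightarrow> real \<Rightarrow> nat \<Rightarrow> real" where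
  "prob_geodesic_in_cyl \<alpha> s a n =
     measure (\<nu> \<alpha>) {t \<in> space (\<nu> \<alpha>).
       plane_point ` set (geodesic t (floor_point 0) (floor_point (target s n)))
         \<subseteq> cyl (target s n) (real n powr a)}"

definition wandering_exponent :: "real \<Rightarrow> real \<Rightarrow> real" where
  "wandering_exponent \<alpha> s =
     Inf {a. 0 < a \<and> liminf (\<lambda>n. ereal (prob_geodesic_in_cyl \<alpha> s a n)) > 0}"

end

theory Submission
  imports Defs "HOL-Real_Asymp.Real_Asymp"
begin

text \<open>The rows of level at least \<open>k\<close> form an arithmetic progression of step \<open>5 ^ k\<close>, and likewise
  the columns. Off the axes a path can climb through lines of increasing level from both endpoints
  without ever leaving the monotone direction, at the price of a convergent geometric series
  in \<open>5 * \<alpha>\<close>; hence the distance differs from the \<open>\<ell>\<^sup>1\<close> distance by a bounded amount, while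
  reflecting the noise of the four edges at the origin shows that its variance does not vanish. A path
  confined to a strip of sublinear width meets lines of high level only on a small part of its
  length and is beaten by a detour along such lines. On the axis a path must return to
  its starting height, so it minimises \<open>2 * 5 ^ k + n * \<alpha> ^ k\<close>, which happens for
  \<open>(5 / \<alpha>) ^ k\<close> of order \<open>n\<close>, that is, for \<open>5 ^ k\<close> of order \<open>n\<close> to the power
  \<open>ln 5 / (ln 5 - ln \<alpha>)\<close>; the distance to the nearest row of that level fluctuates
  on the same scale.\<close>

text \<open>Randomness and geometry are kept apart: path estimates are proved for fixed weights
  satisfying the locale \<open>environment\<close>, and almost every sample satisfies it. The bound
  1/5 enters twice: it makes the climbing series converge, and it makes the excess cost on lines of
  level \<open>k + 1\<close> less than about a fifth of that on level \<open>k\<close>, which lets a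
  detour beat a path confined to a strip. Off the axes the fluctuations are bounded, so no growing
  scale supplies a lower bound for the variance; reflecting the noise preserves its law and, on an
  event of positive probability, lengthens the first edge of every path, so the geodesic need not be
  known. On the axis two events on a bounded number of digits, near the level where the two costs
  balance, force distances separated by a fixed fraction of the scale. Confinement to a narrow strip
  about the axis cannot be excluded for every sample, since a fast row may pass close to height 0;
  such samples are covered by events of probability at most \<open>2 * (1 / 5) ^ j\<close>, and
  \<open>j\<close> tends to infinity only after \<open>n\<close>.\<close>

subsection \<open>The adding machine\<close>

text \<open>The residue mod \<open>5 ^ k\<close> of the 5-adic integer with digits
  \<open>\<omega>\<close>. Modulo \<open>5 ^ k\<close> the adding machine is addition of 1, so
  carries disappear.\<close>

definition digit_val :: "nat \<Rightarrow> (nat \<Rightarrow> nat) \<Rightarrow> int" where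
  "digit_val k \<omega> = (\<Sum>i<k. int (\<omega> i) * 5 ^ i)"

lemma digit_val_0 [simp]: "digit_val 0 \<omega> = 0"
  and digit_val_Suc: "digit_val (Suc k) \<omega> = digit_val k \<omega> + int (\<omega> k) * 5 ^ k"
  by (simp_all add: digit_val_def)

lemma digit_seqs_iff: "\<omega> \<in> digit_seqs \<longleftrightarrow> (\<forall>i. \<omega> i < 5)"
  by (auto simp: digit_seqs_def)

lemma digit_val_bounds:
  assumes "\<omega> \<in> digit_seqs"
  shows "0 \<le> digit_val k \<omega>" and "digit_val k \<omega> < 5 ^ k"
proof -
  have "0 \<le> digit_val k \<omega> \<and> digit_val k \<omega> < 5 ^ k"
  proof (induction k)
    case (Suc k)
    have "int (\<omega> k) \<le> 4" using assms by (auto simp: digit_seqs_iff less_Suc_eq_le numeral_eq_Suc)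
    then have "int (\<omega> k) * 5 ^ k \<le> 4 * 5 ^ k" by (intro mult_right_mono) auto
    moreover have "0 \<le> int (\<omega> k) * 5 ^ k" by simp
    ultimately show ?case using Suc unfolding digit_val_Suc power_Suc by (intro conjI; linarith)
  qed simp
  then show "0 \<le> digit_val k \<omega>" and "digit_val k \<omega> < 5 ^ k" by auto
qed

lemma digit_eq_div:
  assumes "\<omega> \<in> digit_seqs"
  shows "int (\<omega> i) = digit_val (Suc i) \<omega> div 5 ^ i"
  using digit_val_bounds[OF assms, of i] by (simp add: digit_val_Suc)

lemma adding_machine_closed:
  assumes "\<omega> \<in> digit_seqs"
  shows "adding_machine \<omega> \<in> digit_seqs"
  using assms by (auto simp: digit_seqs_iff adding_machine_def)

lemma digit_val_adding_machine:
  assumes "\<omega> \<in> digit_seqs"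
  shows "digit_val k (adding_machine \<omega>) =
    digit_val k \<omega> + 1 - (if \<forall>j<k. \<omega> j = 4 then 5 ^ k else 0)"
proof (induction k)
  case (Suc k)
  show ?case
  proof (cases "\<forall>j<k. \<omega> j = 4")
    case True
    show ?thesis
    proof (cases "\<omega> k = 4")
      case True
      then have "\<forall>j<Suc k. \<omega> j = 4" using \<open>\<forall>j<k. \<omega> j = 4\<close> by (auto simp: less_Suc_eq)
      then show ?thesis using Suc True \<open>\<forall>j<k. \<omega> j = 4\<close>
        by (simp add: digit_val_Suc adding_machine_def)
    next
      case False
      then have "\<omega> k < 4" using assms by (metis digit_seqs_iff less_Suc_eq numeral_eq_Suc pred_numeral_simps(3)
            eval_nat_numeral(3) semiring_norm(26) semiring_norm(27))
      then have "int (adding_machine \<omega> k) = int (\<omega> k) + 1" using True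
        by (simp add: adding_machine_def)
      moreover have "(\<forall>j<Suc k. \<omega> j = 4) \<longleftrightarrow> False" using False by auto
      ultimately show ?thesis using Suc True
        by (simp only: digit_val_Suc if_True if_False ring_distribs) simp
    qed
  next
    case False
    then have "\<not> (\<forall>j<Suc k. \<omega> j = 4)" by (meson less_SucI)
    then show ?thesis using Suc False by (auto simp: digit_val_Suc adding_machine_def)
  qed
qed (simp add: )

text \<open>Subtracting 1 borrows through the initial zeros, which gives the preimage. Surjectivity
  makes \<open>inv_into\<close> a right inverse, and this is how negative powers are
  evaluated.\<close>

lemma adding_machine_surj:
  assumes "\<omega> \<in> digit_seqs"
  shows "\<omega> \<in> adding_machine ` digit_seqs"
proof
  define \<eta> where "\<eta> = (\<lambda>i. if \<forall>j<i. \<omega> j = 0 then (\<omega> i + 4) mod 5 else \<omega> i)"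
  have lt: "\<omega> i < 5" for i using assms by (simp add: digit_seqs_iff)
  have eq: "(\<forall>j<i. \<eta> j = 4) \<longleftrightarrow> (\<forall>j<i. \<omega> j = 0)" for i
  proof (induction i)
    case (Suc i)
    have "\<eta> i = 4 \<longleftrightarrow> \<omega> i = 0" if "\<forall>j<i. \<omega> j = 0"
      using that lt[of i] by (auto simp: \<eta>_def) presburger
    then show ?case using Suc by (auto simp: less_Suc_eq)
  qed simp
  show "\<omega> = adding_machine \<eta>"
  proof
    fix i
    show "\<omega> i = adding_machine \<eta> i"
      using lt[of i] unfolding adding_machine_def eq by (auto simp: \<eta>_def mod_simps)
  qed
  show "\<eta> \<in> digit_seqs" using lt by (auto simp: \<eta>_def digit_seqs_iff)
qed

lemma adding_machine_pow_spec:
  assumes "\<omega> \<in> digit_seqs"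
  shows "adding_machine_pow y \<omega> \<in> digit_seqs \<and>
    digit_val k (adding_machine_pow y \<omega>) mod 5 ^ k = (digit_val k \<omega> + y) mod 5 ^ k"
proof -
  have step: "digit_val k (adding_machine \<eta>) mod 5 ^ k = (digit_val k \<eta> + 1) mod 5 ^ k"
    if "\<eta> \<in> digit_seqs" for \<eta>
    using digit_val_adding_machine[OF that, of k] by (auto simp: mod_simps minus_mod_self2)
  let ?inv = "inv_into digit_seqs adding_machine"
  have inv: "?inv \<eta> \<in> digit_seqs" "digit_val k (?inv \<eta>) mod 5 ^ k = (digit_val k \<eta> - 1) mod 5 ^ k"
    if "\<eta> \<in> digit_seqs" for \<eta>
  proof -
    show *: "?inv \<eta> \<in> digit_seqs" using adding_machine_surj[OF that] by (rule inv_into_into)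
    have "adding_machine (?inv \<eta>) = \<eta>" using adding_machine_surj[OF that] by (rule f_inv_into_f)
    then show "digit_val k (?inv \<eta>) mod 5 ^ k = (digit_val k \<eta> - 1) mod 5 ^ k"
      using step[OF *] by (metis add_diff_cancel_right' mod_diff_left_eq)
  qed
  have pos: "(adding_machine ^^ m) \<omega> \<in> digit_seqs \<and>
      digit_val k ((adding_machine ^^ m) \<omega>) mod 5 ^ k = (digit_val k \<omega> + int m) mod 5 ^ k" for m
  proof (induction m)
    case (Suc m)
    then show ?case using step[of "(adding_machine ^^ m) \<omega>"]
      by (simp add: adding_machine_closed) (metis ab_semigroup_add_class.add_ac(1) add.commute mod_add_left_eq)
  qed (simp add: assms)
  have neg: "(?inv ^^ m) \<omega> \<in> digit_seqs \<and>
      digit_val k ((?inv ^^ m) \<omega>) mod 5 ^ k = (digit_val k \<omega> - int m) mod 5 ^ k" for m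
  proof (induction m)
    case (Suc m)
    then show ?case using inv[of "(?inv ^^ m) \<omega>"]
      by simp (metis (no_types, opaque_lifting) diff_diff_eq add.commute mod_diff_left_eq)
  qed (simp add: assms)
  show ?thesis
    using pos[of "nat y"] neg[of "nat (- y)"] by (auto simp: adding_machine_pow_def)
qed

lemma adding_machine_pow_closed:
  "\<omega> \<in> digit_seqs \<Longrightarrow> adding_machine_pow y \<omega> \<in> digit_seqs"
  using adding_machine_pow_spec by blast

lemma digit_val_pow:
  assumes "\<omega> \<in> digit_seqs"
  shows "digit_val k (adding_machine_pow y \<omega>) = (digit_val k \<omega> + y) mod 5 ^ k"
  using adding_machine_pow_spec[OF assms, of y k]
    digit_val_bounds[OF adding_machine_pow_closed[OF assms], of k y] by simp

lemma adding_machine_pow_digit: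
  assumes "\<omega> \<in> digit_seqs"
  shows "int (adding_machine_pow y \<omega> i) = (digit_val (Suc i) \<omega> + y) mod 5 ^ Suc i div 5 ^ i"
  using digit_eq_div[OF adding_machine_pow_closed[OF assms], of y i] digit_val_pow[OF assms, of "Suc i" y]
  by simp

lemma digit_val_eq_0_iff: "digit_val k \<omega> = 0 \<longleftrightarrow> (\<forall>i<k. \<omega> i = 0)"
  by (auto simp: digit_val_def sum_nonneg_eq_0_iff)

lemma le_first_nonzero_iff:
  assumes "\<exists>i. \<omega> i > 0"
  shows "k \<le> first_nonzero \<omega> \<longleftrightarrow> (\<forall>i<k. \<omega> i = 0)"
proof
  assume "k \<le> first_nonzero \<omega>"
  then show "\<forall>i<k. \<omega> i = 0"
    unfolding first_nonzero_def by (metis bot_nat_0.not_eq_extremum leD less_le_trans not_less_Least)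
next
  have "\<omega> (first_nonzero \<omega>) > 0" unfolding first_nonzero_def using assms by (metis LeastI)
  then show "\<forall>i<k. \<omega> i = 0 \<Longrightarrow> k \<le> first_nonzero \<omega>" by (metis leI less_irrefl)
qed

text \<open>The first \<open>k\<close> digits vanish iff the residue mod \<open>5 ^ k\<close> does.
  The second hypothesis excludes the null set where \<open>LEAST\<close> has no witness.\<close>

lemma le_first_nonzero_pow_iff:
  assumes "\<omega> \<in> digit_seqs" and "\<exists>i. adding_machine_pow y \<omega> i > 0"
  shows "k \<le> first_nonzero (adding_machine_pow y \<omega>) \<longleftrightarrow> 5 ^ k dvd y + digit_val k \<omega>"
  by (simp add: le_first_nonzero_iff[OF assms(2)] digit_val_eq_0_iff[symmetric]
      digit_val_pow[OF assms(1)] dvd_eq_mod_eq_0 add.commute)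

subsection \<open>Lattice paths\<close>

lemma adjacent_iff:
  "adjacent (x, y) w \<longleftrightarrow> w = (x + 1, y) \<or> w = (x - 1, y) \<or> w = (x, y + 1) \<or> w = (x, y - 1)"
proof
  assume "adjacent (x, y) w"
  then obtain e where e: "endpoints e = {(x, y), w}" by (auto simp: adjacent_def)
  show "w = (x + 1, y) \<or> w = (x - 1, y) \<or> w = (x, y + 1) \<or> w = (x, y - 1)"
  proof (cases e)
    case (Hor v)
    then show ?thesis using e by (cases v) (auto simp: doubleton_eq_iff)
  next
    case (Ver v)
    then show ?thesis using e by (cases v) (auto simp: doubleton_eq_iff)
  qed
next
  assume "w = (x + 1, y) \<or> w = (x - 1, y) \<or> w = (x, y + 1) \<or> w = (x, y - 1)"
  moreover have "endpoints (Hor (x, y)) = {(x, y), (x + 1, y)}"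
    "endpoints (Hor (x - 1, y)) = {(x, y), (x - 1, y)}"
    "endpoints (Ver (x, y)) = {(x, y), (x, y + 1)}"
    "endpoints (Ver (x, y - 1)) = {(x, y), (x, y - 1)}"
    by auto
  ultimately show "adjacent (x, y) w" unfolding adjacent_def by metis
qed

lemma inj_endpoints: "inj endpoints"
proof (rule injI)
  fix e f assume "endpoints e = endpoints f"
  then show "e = f"
    by (cases e; cases f; cases "case e of Hor v \<Rightarrow> v | Ver v \<Rightarrow> v"; cases "case f of Hor v \<Rightarrow> v | Ver v \<Rightarrow> v")
      (auto simp: doubleton_eq_iff)
qed

lemma edge_between_eqI: "endpoints e = {u, v} \<Longrightarrow> edge_between u v = e"
  unfolding edge_between_def using inj_endpoints by (intro the_equality) (auto dest: injD)

lemma endpoints_edge_between: "adjacent u v \<Longrightarrow> endpoints (edge_between u v) = {u, v}"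
  unfolding adjacent_def using edge_between_eqI by metis

lemma edge_between_simps [simp]:
  "edge_between (x, y) (x + 1, y) = Hor (x, y)"
  "edge_between (x, y) (x - 1, y) = Hor (x - 1, y)"
  "edge_between (x, y) (x, y + 1) = Ver (x, y)"
  "edge_between (x, y) (x, y - 1) = Ver (x, y - 1)"
  by (auto intro!: edge_between_eqI)

lemma edge_between_commute: "edge_between u v = edge_between v u"
  by (simp add: edge_between_def insert_commute)

lemma adjacent_commute: "adjacent u v \<longleftrightarrow> adjacent v u"
  by (simp add: adjacent_def insert_commute)

lemma path_edges_simps [simp]:
  "path_edges [] = []" "path_edges [u] = []"
  "path_edges (u # v # p) = edge_between u v # path_edges (v # p)"
  by (simp_all add: path_edges_def)

lemma path_length_simps [simp]:
  "path_length t [] = 0" "path_length t [u] = 0"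
  "path_length t (u # v # p) = t (edge_between u v) + path_length t (v # p)"
  by (simp_all add: path_length_def)

text \<open>Paths are cut at a vertex \<open>w\<close> that is kept in both pieces, so that no edge
  is lost.\<close>

lemma path_edges_append:
  "path_edges (p @ w # q) = path_edges (p @ [w]) @ path_edges (w # q)"
  by (induction p rule: induct_list012) (auto simp: path_edges_def)

lemma path_length_append:
  "path_length t (p @ w # q) = path_length t (p @ [w]) + path_length t (w # q)"
  by (simp add: path_length_def path_edges_append[of p w q])

lemma path_edges_rev: "path_edges (rev p) = rev (path_edges p)"
proof (induction p rule: induct_list012)
  case (3 u v p)
  then show ?case using path_edges_append[of "rev p" v "[u]"] by (simp add: edge_between_commute)
qed auto

lemma path_length_rev: "path_length t (rev p) = path_length t p"
  by (simp add: path_length_def path_edges_rev rev_map[symmetric])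

lemma is_path_split:
  assumes "is_path u v (p @ w # q)"
  shows "is_path u w (p @ [w])" and "is_path w v (w # q)"
  using assms by (auto simp: is_path_def successively_append_iff hd_append)

lemma is_path_append:
  assumes "is_path u w (p @ [w])" and "is_path w v (w # q)"
  shows "is_path u v (p @ w # q)"
  using assms by (auto simp: is_path_def successively_append_iff hd_append)

lemma is_path_snocE:
  assumes "is_path u v p"
  obtains p' where "p = p' @ [v]"
  using assms by (metis is_path_def append_butlast_last_id)

lemma is_path_consE:
  assumes "is_path u v p"
  obtains p' where "p = u # p'"
  using assms by (metis is_path_def list.collapse)

lemma is_path_rev: "is_path u v p \<Longrightarrow> is_path v u (rev p)"
  by (auto simp: is_path_def hd_rev last_rev successively_rev adjacent_commute)

lemma ex_path: "\<exists>p. is_path u v p"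
proof -
  have step: "\<exists>p. is_path u (x', y') p" if "is_path u (x, y) q" "adjacent (x, y) (x', y')" for x y x' y' q
  proof -
    have "is_path u (x', y') (q @ [(x', y')])"
      using that by (auto simp: is_path_def successively_append_iff hd_append)
    then show ?thesis by blast
  qed
  obtain a b where u: "u = (a, b)" by (cases u)
  obtain c d where v: "v = (c, d)" by (cases v)
  have hor: "\<exists>p. is_path u (x, b) p" for x
  proof (induction x rule: int_induct[where k = a])
    case base
    have "is_path u (a, b) [u]" by (simp add: is_path_def u)
    then show ?case by blast
  next
    case (step1 i)
    then show ?case using step[of i b] by (auto simp: adjacent_iff)
  next
    case (step2 i)
    then show ?case using step[of i b] by (auto simp: adjacent_iff)
  qed
  have "\<exists>p. is_path u (c, y) p" for y
  proof (induction y rule: int_induct[where k = b])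
    case base
    then show ?case by (rule hor)
  next
    case (step1 i)
    then show ?case using step[of c i] by (auto simp: adjacent_iff)
  next
    case (step2 i)
    then show ?case using step[of c i] by (auto simp: adjacent_iff)
  qed
  then show ?thesis using v by blast
qed

lemma path_crosses_row:
  assumes "is_path u v p" and "snd u \<le> y" and "y \<le> snd v"
  obtains q x r where "p = q @ (x, y) # r"
proof -
  have "\<exists>x. (x, y) \<in> set p"
    using assms(1,2)
  proof (induction p arbitrary: u rule: induct_list012)
    case (2 w)
    then have "snd w = y" using assms(3) by (auto simp: is_path_def)
    then show ?case by (metis list.set_intros(1) prod.collapse)
  next
    case (3 w w' p)
    then have adj: "adjacent w w'" and [simp]: "u = w" and "is_path w' v (w' # p)"
      by (auto simp: is_path_def)
    show ?case
    proof (cases "snd w = y")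
      case True
      then show ?thesis by (metis list.set_intros(1) prod.collapse)
    next
      case False
      have "snd w' \<le> snd w + 1" using adj by (cases w) (auto simp: adjacent_iff)
      then have "snd w' \<le> y" using False 3(4) by auto
      then have "\<exists>x. (x, y) \<in> set (w' # p)" using 3(2) \<open>is_path w' v (w' # p)\<close> by blast
      then show ?thesis by auto
    qed
  qed (auto simp: is_path_def)
  then show ?thesis using that by (metis split_list)
qed

text \<open>Telescoping. The l1 bound, the bound for slow rows and the strip estimate each choose
  their own \<open>\<phi>\<close>; \<open>S\<close> restricts the edge inequality to the region
  where the path is known to stay.\<close>

lemma path_length_ge_potential:
  fixes \<phi> :: "vertex \<Rightarrow> real"
  assumes "is_path u v p" and "set p \<subseteq> S"
    and "\<And>w w'. w \<in> S \<Longrightarrow> w' \<in> S \<Longrightarrow> adjacent w w' \<Longrightarrow> \<phi> w' - \<phi> w \<le> t (edge_between w w')"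
  shows "\<phi> v - \<phi> u \<le> path_length t p"
  using assms(1,2)
proof (induction p arbitrary: u rule: induct_list012)
  case (3 w w' p)
  then have "adjacent w w'" and [simp]: "u = w" and "is_path w' v (w' # p)"
    by (auto simp: is_path_def)
  then show ?case using 3 assms(3)[of w w'] by fastforce
qed (auto simp: is_path_def)

text \<open>A path with at most \<open>m\<close> vertices stays in the box of radius
  \<open>m\<close> about its start.\<close>

lemma finite_paths_length: "finite {p. is_path u v p \<and> length p \<le> m}"
proof -
  obtain a b where u: "u = (a, b)" by (cases u)
  have "\<bar>fst z - a\<bar> \<le> int (length p) \<and> \<bar>snd z - b\<bar> \<le> int (length p)"
    if "successively adjacent p" "hd p = (a, b)" "z \<in> set p" for p a b z
    using that
  proof (induction p arbitrary: a b rule: induct_list012)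
    case (3 w w' p)
    obtain a' b' where w': "w' = (a', b')" by (cases w')
    have *: "\<bar>a' - a\<bar> \<le> 1 \<and> \<bar>b' - b\<bar> \<le> 1"
      using 3 w' by (auto simp: adjacent_iff)
    show ?case
    proof (cases "z \<in> set (w' # p)")
      case True
      then have "\<bar>fst z - a'\<bar> \<le> int (length (w' # p)) \<and> \<bar>snd z - b'\<bar> \<le> int (length (w' # p))"
        using 3 w' by (intro 3(2)) auto
      then show ?thesis using * by auto
    qed (use 3 in auto)
  qed auto
  note bound = this
  have "{p. is_path u v p \<and> length p \<le> m} \<subseteq>
    {p. set p \<subseteq> {a - int m..a + int m} \<times> {b - int m..b + int m} \<and> length p \<le> m}"
  proof safe
    fix p x y assume "is_path u v p" "length p \<le> m" "(x, y) \<in> set p"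
    then show "x \<in> {a - int m..a + int m}" "y \<in> {b - int m..b + int m}"
      using bound[of p a b "(x, y)"] by (auto simp: is_path_def u)
  qed
  then show ?thesis
    by (rule finite_subset) (intro finite_lists_length_le finite_cartesian_product finite_atLeastAtMost_int)
qed

text \<open>At the first vertex where the two paths diverge, the edge taken by one of them is not used by
  the other, because a self-avoiding path visits that vertex only once.\<close>

lemma distinct_paths_differ:
  assumes "is_path u v p" and "is_path u v q" and "distinct p" and "distinct q" and "p \<noteq> q"
  shows "\<exists>e. count_list (path_edges p) e \<noteq> count_list (path_edges q) e"
  using assms
proof (induction p arbitrary: u q)
  case (Cons w p)
  then have [simp]: "u = w" by (simp add: is_path_def)
  obtain q' where q: "q = w # q'" using Cons(3) by (auto elim: is_path_consE)
  have other: "e \<notin> set (path_edges r)" if "w \<notin> set r" "w \<in> endpoints e" "successively adjacent r" for e r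
    using that
    by (induction r rule: induct_list012) (auto simp: endpoints_edge_between)
  show ?case
  proof (cases "p = [] \<or> q' = []")
    case True
    then have "v = w" using Cons(2,3) by (auto simp: is_path_def q)
    then have "p = []" "q' = []" using Cons(2-5) q by (auto simp: is_path_def split: if_splits)
    then show ?thesis using Cons(6) q by simp
  next
    case False
    then obtain w1 p1 w2 q1 where p1: "p = w1 # p1" and q1: "q' = w2 # q1" by (meson neq_Nil_conv)
    have adj: "adjacent w w1" "adjacent w w2" and path: "is_path w1 v p" "is_path w2 v q'"
      using Cons(2,3) by (auto simp: p1 q q1 is_path_def)
    show ?thesis
    proof (cases "w1 = w2")
      case True
      then have "\<exists>e. count_list (path_edges p) e \<noteq> count_list (path_edges q') e"
        using Cons path q by (intro Cons(1)[of w1]) auto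
      then show ?thesis using True by (auto simp: p1 q q1)
    next
      case False
      then have ne: "edge_between w w1 \<noteq> edge_between w w2"
        using adj endpoints_edge_between by (metis doubleton_eq_iff)
      have "edge_between w w1 \<notin> set (path_edges q')"
        using Cons(5) adj path by (intro other) (auto simp: q endpoints_edge_between is_path_def)
      then have "count_list (path_edges q) (edge_between w w1) = 0"
        using ne by (auto simp: q q1)
      moreover have "count_list (path_edges (w # p)) (edge_between w w1) > 0"
        by (simp add: p1)
      ultimately show ?thesis by (metis less_irrefl)
    qed
  qed
qed (auto simp: is_path_def)

lemma distance_commute: "distance t u v = distance t v u"
proof -
  have "path_length t ` Collect (is_path v u) \<subseteq> path_length t ` Collect (is_path u v)" for u v
    by (metis (mono_tags, lifting) image_subsetI is_path_rev mem_Collect_eq path_length_rev rev_image_eqI)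
  then show ?thesis unfolding distance_def by (metis subset_antisym)
qed

lemma distance_greatest:
  assumes "\<And>p. is_path u v p \<Longrightarrow> c \<le> path_length t p"
  shows "c \<le> distance t u v"
  unfolding distance_def using assms ex_path by (intro cINF_greatest) auto

subsection \<open>Deterministic environments\<close>

text \<open>What almost every sample provides. The offsets \<open>a k\<close> and \<open>b k\<close>
  will be residues of two 5-adic integers; the factor 1.001 absorbs the noise, which on level
  \<open>k\<close> is at most a thousandth of \<open>\<alpha> ^ k\<close>.\<close>

locale environment =
  fixes \<alpha> :: real and t :: "edge \<Rightarrow> real" and r c :: "int \<Rightarrow> nat" and a b :: "nat \<Rightarrow> int"
  assumes alpha_pos: "0 < \<alpha>" and alpha_less: "\<alpha> < 0.2"
    and row_ge_iff: "k \<le> r y \<longleftrightarrow> 5 ^ k dvd y + a k"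
    and col_ge_iff: "k \<le> c x \<longleftrightarrow> 5 ^ k dvd x + b k"
    and Hor_ge: "1 + \<alpha> ^ r y \<le> t (Hor (x, y))"
    and Hor_le: "t (Hor (x, y)) \<le> 1 + 1.001 * \<alpha> ^ r y"
    and Ver_ge: "1 + \<alpha> ^ c x \<le> t (Ver (x, y))"
    and Ver_le: "t (Ver (x, y)) \<le> 1 + 1.001 * \<alpha> ^ c x"
begin

lemma alpha_power_mono: "i \<le> j \<Longrightarrow> \<alpha> ^ j \<le> \<alpha> ^ i"
  using alpha_pos alpha_less by (intro power_decreasing) auto

lemma alpha_power_pos: "0 < \<alpha> ^ i"
  using alpha_pos by simp

lemma t_ge_1: "1 \<le> t e"
proof (cases e)
  case (Hor v)
  then show ?thesis using Hor_ge[of "snd v" "fst v"] alpha_power_pos[of "r (snd v)"] by simp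
next
  case (Ver v)
  then show ?thesis using Ver_ge[of "fst v" "snd v"] alpha_power_pos[of "c (fst v)"] by simp
qed

lemma path_length_ge_edges: "real (length p - 1) \<le> path_length t p"
proof (induction p rule: induct_list012)
  case (3 u v p)
  then show ?case using t_ge_1[of "edge_between u v"] by auto
qed auto

lemma path_length_nonneg: "0 \<le> path_length t p"
  using path_length_ge_edges[of p] by linarith

lemma distance_le: "is_path u v p \<Longrightarrow> distance t u v \<le> path_length t p"
  unfolding distance_def
  by (intro cINF_lower bdd_belowI2[where m = 0] path_length_nonneg) auto

lemma distance_less_iff: "distance t u v < B \<longleftrightarrow> (\<exists>p. is_path u v p \<and> path_length t p < B)"
  unfolding distance_def
  using ex_path by (subst cINF_less_iff) (auto intro!: bdd_belowI2[where m = 0] path_length_nonneg)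

lemma distance_triangle: "distance t u v \<le> distance t u w + distance t w v"
proof (rule field_le_epsilon)
  fix \<epsilon> :: real assume "\<epsilon> > 0"
  then obtain p q where p: "is_path u w p" "path_length t p < distance t u w + \<epsilon> / 2"
    and q: "is_path w v q" "path_length t q < distance t w v + \<epsilon> / 2"
    using distance_less_iff[of u w "distance t u w + \<epsilon> / 2"] distance_less_iff[of w v "distance t w v + \<epsilon> / 2"]
    by auto
  obtain p' q' where p': "p = p' @ [w]" and q': "q = w # q'"
    using is_path_snocE[OF p(1)] is_path_consE[OF q(1)] by metis
  have "distance t u v \<le> path_length t (p' @ w # q')"
    using distance_le[OF is_path_append] p(1) q(1) unfolding p' q' by metis
  also have "\<dots> = path_length t p + path_length t q"
    unfolding p' q' by (rule path_length_append)
  finally show "distance t u v \<le> distance t u w + distance t w v + \<epsilon>"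
    using p(2) q(2) by simp
qed

lemma distance_adjacent: "adjacent u v \<Longrightarrow> distance t u v \<le> t (edge_between u v)"
  using distance_le[of u v "[u, v]"] by (simp add: is_path_def)

lemma distance_self: "distance t u u \<le> 0"
  using distance_le[of u u "[u]"] by (simp add: is_path_def)

lemma distance_row:
  assumes "k \<le> r y"
  shows "distance t (x, y) (x', y) \<le> \<bar>x' - x\<bar> * (1 + 1.001 * \<alpha> ^ k)"
proof -
  have right: "distance t (x, y) (x + int d, y) \<le> real d * (1 + 1.001 * \<alpha> ^ k)" for x d
  proof (induction d)
    case (Suc d)
    have Suc_d: "real (Suc d) * (1 + 1.001 * \<alpha> ^ k) = real d * (1 + 1.001 * \<alpha> ^ k) + (1 + 1.001 * \<alpha> ^ k)"
      by (simp add: algebra_simps)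
    have "distance t (x + int d, y) (x + int d + 1, y) \<le> 1 + 1.001 * \<alpha> ^ r y"
      using distance_adjacent[of "(x + int d, y)" "(x + int d + 1, y)"] Hor_le[of "x + int d" y]
      by (simp add: adjacent_iff)
    also have "\<dots> \<le> 1 + 1.001 * \<alpha> ^ k" using alpha_power_mono[OF assms] by simp
    finally have "distance t (x, y) (x + int d + 1, y) \<le> real (Suc d) * (1 + 1.001 * \<alpha> ^ k)"
      using Suc distance_triangle[of "(x, y)" "(x + int d + 1, y)" "(x + int d, y)"] unfolding Suc_d by linarith
    then show ?case by (simp add: ac_simps)
  qed (simp add: distance_self)
  show ?thesis
  proof (cases "x \<le> x'")
    case True
    then show ?thesis using right[of x "nat (x' - x)"] by simp
  next
    case False
    then show ?thesis using right[of x' "nat (x - x')"] distance_commute[of t "(x, y)" "(x', y)"] by simp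
  qed
qed

lemma distance_col:
  assumes "k \<le> c x"
  shows "distance t (x, y) (x, y') \<le> \<bar>y' - y\<bar> * (1 + 1.001 * \<alpha> ^ k)"
proof -
  have up: "distance t (x, y) (x, y + int d) \<le> real d * (1 + 1.001 * \<alpha> ^ k)" for y d
  proof (induction d)
    case (Suc d)
    have Suc_d: "real (Suc d) * (1 + 1.001 * \<alpha> ^ k) = real d * (1 + 1.001 * \<alpha> ^ k) + (1 + 1.001 * \<alpha> ^ k)"
      by (simp add: algebra_simps)
    have "distance t (x, y + int d) (x, y + int d + 1) \<le> 1 + 1.001 * \<alpha> ^ c x"
      using distance_adjacent[of "(x, y + int d)" "(x, y + int d + 1)"] Ver_le[of x "y + int d"]
      by (simp add: adjacent_iff)
    also have "\<dots> \<le> 1 + 1.001 * \<alpha> ^ k" using alpha_power_mono[OF assms] by simp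
    finally have "distance t (x, y) (x, y + int d + 1) \<le> real (Suc d) * (1 + 1.001 * \<alpha> ^ k)"
      using Suc distance_triangle[of "(x, y)" "(x, y + int d + 1)" "(x, y + int d)"] unfolding Suc_d by linarith
    then show ?case by (simp add: ac_simps)
  qed (simp add: distance_self)
  show ?thesis
  proof (cases "y \<le> y'")
    case True
    then show ?thesis using up[of y "nat (y' - y)"] by simp
  next
    case False
    then show ?thesis using up[of y' "nat (y - y')"] distance_commute[of t "(x, y)" "(x, y')"] by simp
  qed
qed

lemma path_length_ge_l1:
  assumes "is_path (x, y) (x', y') p"
  shows "\<bar>x' - x\<bar> + \<bar>y' - y\<bar> \<le> path_length t p"
proof -
  \<comment> \<open>A linear functional that grows by at most 1 along any edge and by the full l1
    distance from start to end; \<open>sgn\<close> treats all orientations at once.\<close>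
  define \<phi> where "\<phi> = (\<lambda>z. real_of_int (sgn (x' - x) * fst z + sgn (y' - y) * snd z))"
  have "\<phi> (x', y') - \<phi> (x, y) \<le> path_length t p"
  proof (rule path_length_ge_potential[OF assms subset_UNIV])
    fix w w' :: vertex assume "adjacent w w'"
    then have "\<phi> w' - \<phi> w \<le> 1"
      by (cases w) (auto simp: adjacent_iff \<phi>_def sgn_if)
    then show "\<phi> w' - \<phi> w \<le> t (edge_between w w')"
      using t_ge_1[of "edge_between w w'"] by linarith
  qed
  then show ?thesis by (auto simp: \<phi>_def sgn_if abs_if split: if_splits)
qed

text \<open>This confines short paths: visiting a distant vertex already costs the l1 length of the
  detour.\<close>

lemma path_length_through_ge_l1:
  fixes x y x' y' x'' y'' :: int
  assumes "is_path (x, y) (x', y') p" and "(x'', y'') \<in> set p"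
  shows "\<bar>x'' - x\<bar> + \<bar>y'' - y\<bar> + (\<bar>x' - x''\<bar> + \<bar>y' - y''\<bar>) \<le> path_length t p"
proof -
  obtain p1 p2 where p: "p = p1 @ (x'', y'') # p2" using assms(2) by (metis split_list)
  have path: "is_path (x, y) (x', y') (p1 @ (x'', y'') # p2)" using assms(1) unfolding p .
  show ?thesis
    using path_length_ge_l1[OF is_path_split(1)[OF path]] path_length_ge_l1[OF is_path_split(2)[OF path]]
    unfolding p path_length_append[of t p1 "(x'', y'')" p2] by simp
qed

lemma distance_ge_l1: "\<bar>x' - x\<bar> + \<bar>y' - y\<bar> \<le> distance t (x, y) (x', y')"
  using path_length_ge_l1 by (intro distance_greatest)

section \<open>Existence and uniqueness of geodesics\<close>

lemma ex_geodesic: "\<exists>p. is_geodesic t u v p"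
proof -
  obtain p0 where p0: "is_path u v p0" using ex_path by blast
  \<comment> \<open>Weights are at least 1, so a competitor of \<open>p0\<close> has at most
    \<open>path_length t p0\<close> edges; the added 1 passes from edges to vertices.\<close>
  define m where "m = nat \<lceil>path_length t p0\<rceil> + 1"
  let ?P = "{p. is_path u v p \<and> length p \<le> m}"
  have le_m: "length p \<le> m" if "path_length t p \<le> path_length t p0" for p
    using that path_length_ge_edges[of p] unfolding m_def by linarith
  have "finite ?P" by (rule finite_paths_length)
  moreover have "p0 \<in> ?P" using p0 le_m by auto
  ultimately have "finite ?P" "?P \<noteq> {}" by auto
  note min = arg_min_if_finite[OF this, of "path_length t"]
  define p where "p = arg_min_on (path_length t) ?P"
  have p: "p \<in> ?P" "\<And>q. q \<in> ?P \<Longrightarrow> path_length t p \<le> path_length t q"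
    using min by (auto simp: p_def not_less)
  have "path_length t p \<le> path_length t q" if "is_path u v q" for q
    using that p(2)[of q] p(2)[OF \<open>p0 \<in> ?P\<close>] le_m[of q] by fastforce
  then have "path_length t p = distance t u v"
    using p(1) by (intro antisym distance_greatest distance_le) auto
  then show ?thesis using p(1) by (auto simp: is_geodesic_def)
qed

lemma geodesic_distinct:
  assumes "is_geodesic t u v p"
  shows "distinct p"
proof (rule ccontr)
  assume "\<not> distinct p"
  then obtain xs ys zs w where p: "p = xs @ w # (ys @ w # zs)"
    using not_distinct_decomp[of p] by auto
  have path: "is_path u v p" using assms by (simp add: is_geodesic_def)
  note s1 = is_path_split[OF path[unfolded p]]
  have "is_path w v ((w # ys) @ w # zs)" using s1(2) by simp
  note s2 = is_path_split[OF this]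
  have "distance t u v \<le> path_length t (xs @ w # zs)"
    by (rule distance_le[OF is_path_append[OF s1(1) s2(2)]])
  also have "\<dots> = path_length t (xs @ [w]) + path_length t (w # zs)" by (rule path_length_append)
  also have "\<dots> < path_length t (xs @ [w]) + path_length t ((w # ys) @ [w]) + path_length t (w # zs)"
    using path_length_ge_edges[of "(w # ys) @ [w]"] by simp
  also have "\<dots> = path_length t p"
    using path_length_append[of t xs w "ys @ w # zs"] path_length_append[of t "w # ys" w zs]
    by (simp add: p)
  finally show False using assms by (simp add: is_geodesic_def)
qed

text \<open>Geodesics are self-avoiding, so two of them differ in the multiplicity of some edge. The
  hypothesis ranges over edge lists, a countable family, so that it can hold almost surely for all
  endpoints at once.\<close>

lemma ex1_geodesic:
  assumes "\<And>A B e. count_list A e \<noteq> count_list B e \<Longrightarrow> sum_list (map t A) \<noteq> sum_list (map t B)"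
  shows "\<exists>!p. is_geodesic t u v p"
proof (rule ex_ex1I[OF ex_geodesic], rule ccontr)
  fix p q assume pq: "is_geodesic t u v p" "is_geodesic t u v q" "p \<noteq> q"
  then obtain e where "count_list (path_edges p) e \<noteq> count_list (path_edges q) e"
    using distinct_paths_differ[of u v p q] geodesic_distinct[OF pq(1)] geodesic_distinct[OF pq(2)]
    by (auto simp: is_geodesic_def)
  then show False using assms pq by (metis is_geodesic_def path_length_def)
qed

lemma geodesic_subpath:
  assumes "is_geodesic t u v (p @ w # q)"
  shows "is_geodesic t u w (p @ [w])" and "is_geodesic t w v (w # q)"
proof -
  have path: "is_path u v (p @ w # q)" and len: "path_length t (p @ w # q) = distance t u v"
    using assms by (auto simp: is_geodesic_def)
  note s = is_path_split[OF path]
  show "is_geodesic t u w (p @ [w])" and "is_geodesic t w v (w # q)"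
    using s distance_le[OF s(1)] distance_le[OF s(2)] distance_triangle[of u v w] len
    unfolding path_length_append[of t p w q] is_geodesic_def by auto
qed

section \<open>Bounds for paths along the axis\<close>

lemma axis_distance_le:
  assumes "k \<le> r h" and "0 \<le> h" and "0 \<le> n"
  shows "distance t (0, 0) (n, 0) \<le> n * (1 + 1.001 * \<alpha> ^ k) + 4.002 * h"
proof -
  \<comment> \<open>Up a column to height \<open>h\<close>, along the fast row and down again;
    vertical edges cost at most 2.001, whence 4.002.\<close>
  have "distance t (0, 0) (n, 0) \<le> distance t (0, 0) (0, h) + distance t (0, h) (n, h) + distance t (n, h) (n, 0)"
    using distance_triangle[of "(0, 0)" "(n, 0)" "(n, h)"] distance_triangle[of "(0, 0)" "(n, h)" "(0, h)"]
    by linarith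
  also have "distance t (0, 0) (0, h) \<le> 2.001 * h" using distance_col[of 0 0 0 h] assms by simp
  also have "distance t (n, h) (n, 0) \<le> 2.001 * h" using distance_col[of 0 n h 0] assms by simp
  also have "distance t (0, h) (n, h) \<le> n * (1 + 1.001 * \<alpha> ^ k)" using distance_row[OF assms(1), of 0 n] assms by simp
  finally show ?thesis by simp
qed

text \<open>The potential ignores height: vertical steps leave it unchanged, while a step to the
  right runs in a row of level at most \<open>k\<close> and costs at least its increment.\<close>

lemma axis_path_slow:
  assumes "is_path (0, 0) (n, 0) p" and "\<And>x y. (x, y) \<in> set p \<Longrightarrow> r y \<le> k"
  shows "n * (1 + \<alpha> ^ k) \<le> path_length t p"
proof -
  let ?\<phi> = "\<lambda>z::vertex. real_of_int (fst z) * (1 + \<alpha> ^ k)"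
  have "?\<phi> (n, 0) - ?\<phi> (0, 0) \<le> path_length t p"
  proof (rule path_length_ge_potential[OF assms(1) order_refl])
    fix w w' assume "w \<in> set p" "adjacent w w'"
    moreover obtain x y where w: "w = (x, y)" by (cases w)
    ultimately have "\<alpha> ^ k \<le> \<alpha> ^ r y" and adj: "adjacent (x, y) w'"
      using assms(2) alpha_power_mono by auto
    have "?\<phi> w' - ?\<phi> w = (fst w' - fst w) * (1 + \<alpha> ^ k)" by (simp add: algebra_simps)
    then show "?\<phi> w' - ?\<phi> w \<le> t (edge_between w w')"
      using Hor_ge[of y x] t_ge_1[of "edge_between w w'"] alpha_power_pos[of k] adj \<open>\<alpha> ^ k \<le> \<alpha> ^ r y\<close>
      by (auto simp: w adjacent_iff)
  qed
  then show ?thesis by simp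
qed

section \<open>Nearby fast lines and routes built from them\<close>

lemma next_fast_row:
  assumes "\<sigma> = 1 \<or> \<sigma> = -1"
  obtains d where "0 \<le> d" and "d < 5 ^ k" and "k \<le> r (y + \<sigma> * d)"
proof -
  define d where "d = (- \<sigma> * (y + a k)) mod 5 ^ k"
  have "5 ^ k dvd - \<sigma> * (y + a k) - d" unfolding d_def by simp
  then have "5 ^ k dvd \<sigma> * (- \<sigma> * (y + a k) - d)" by (rule dvd_mult)
  also have "\<sigma> * (- \<sigma> * (y + a k) - d) = - (y + \<sigma> * d + a k)"
    using assms by (auto simp: algebra_simps)
  finally have "k \<le> r (y + \<sigma> * d)" unfolding row_ge_iff by (simp only: dvd_minus_iff)
  then show ?thesis using that[of d] by (simp add: d_def)
qed

lemma next_fast_col: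
  assumes "\<sigma> = 1 \<or> \<sigma> = -1"
  obtains d where "0 \<le> d" and "d < 5 ^ k" and "k \<le> c (x + \<sigma> * d)"
proof -
  define d where "d = (- \<sigma> * (x + b k)) mod 5 ^ k"
  have "5 ^ k dvd - \<sigma> * (x + b k) - d" unfolding d_def by simp
  then have "5 ^ k dvd \<sigma> * (- \<sigma> * (x + b k) - d)" by (rule dvd_mult)
  also have "\<sigma> * (- \<sigma> * (x + b k) - d) = - (x + \<sigma> * d + b k)"
    using assms by (auto simp: algebra_simps)
  finally have "k \<le> c (x + \<sigma> * d)" unfolding col_ge_iff by (simp only: dvd_minus_iff)
  then show ?thesis using that[of d] by (simp add: d_def)
qed

text \<open>Accumulated excess over the l1 length: passing from level \<open>i\<close> to
  \<open>i + 1\<close> uses fewer than \<open>5 ^ (i + 1)\<close> edges, each of excess at most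
  \<open>1.001 * \<alpha> ^ i\<close>, and 5.005 is \<open>5 * 1.001\<close>.\<close>

definition climb_cost :: "nat \<Rightarrow> real" where
  "climb_cost k = 5.005 * (\<Sum>i<k. (5 * \<alpha>) ^ i)"

lemma climb_cost_le: "climb_cost k \<le> 5.005 / (1 - 5 * \<alpha>)"
proof -
  have "(\<Sum>i<k. (5 * \<alpha>) ^ i) = (1 - (5 * \<alpha>) ^ k) / (1 - 5 * \<alpha>)"
    using alpha_less by (subst sum_gp_strict) (auto simp: field_simps)
  also have "\<dots> \<le> 1 / (1 - 5 * \<alpha>)"
    using alpha_less alpha_pos by (intro divide_right_mono) auto
  finally have "5.005 * (\<Sum>i<k. (5 * \<alpha>) ^ i) \<le> 5.005 * (1 / (1 - 5 * \<alpha>))"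
    by (intro mult_left_mono) auto
  then show ?thesis unfolding climb_cost_def by simp
qed

lemma climb_cost_Suc: "climb_cost (Suc k) = climb_cost k + 5 ^ Suc k * (1.001 * \<alpha> ^ k)"
  unfolding climb_cost_def sum.lessThan_Suc power_mult_distrib power_Suc by (simp add: field_simps)

text \<open>Alternating between rows and columns, each time following the current line up to the next
  line of higher level, costs only a geometric series because \<open>5 * \<alpha> < 1\<close>.\<close>

lemma climb:
  assumes \<sigma>: "\<sigma> = 1 \<or> \<sigma> = -1"
  shows "(\<exists>d e. 0 \<le> d \<and> d \<le> 2 * 5 ^ k \<and> 0 \<le> e \<and> e \<le> 2 * 5 ^ k \<and> k \<le> r (y + \<sigma> * e) \<and>
        distance t (x, y) (x + \<sigma> * d, y + \<sigma> * e) \<le> d + e + climb_cost k) \<and>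
    (\<exists>d e. 0 \<le> d \<and> d \<le> 2 * 5 ^ k \<and> 0 \<le> e \<and> e \<le> 2 * 5 ^ k \<and> k \<le> c (x + \<sigma> * d) \<and>
        distance t (x, y) (x + \<sigma> * d, y + \<sigma> * e) \<le> d + e + climb_cost k)"
proof (induction k)
  case 0
  have "distance t (x, y) (x + \<sigma> * 0, y + \<sigma> * 0) \<le> (0::int) + (0::int) + climb_cost 0"
    using distance_self by (simp add: climb_cost_def)
  then show ?case by (auto intro!: exI[of _ "0::int"])
next
  case (Suc k)
  obtain d e where row: "0 \<le> d" "d \<le> 2 * 5 ^ k" "0 \<le> e" "e \<le> 2 * 5 ^ k" "k \<le> r (y + \<sigma> * e)"
    "distance t (x, y) (x + \<sigma> * d, y + \<sigma> * e) \<le> d + e + climb_cost k" using Suc by blast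
  obtain d' e' where col: "0 \<le> d'" "d' \<le> 2 * 5 ^ k" "0 \<le> e'" "e' \<le> 2 * 5 ^ k" "k \<le> c (x + \<sigma> * d')"
    "distance t (x, y) (x + \<sigma> * d', y + \<sigma> * e') \<le> d' + e' + climb_cost k" using Suc by blast
  \<comment> \<open>Rows and columns swap roles: a row of level \<open>k\<close> is followed to a
    column of level \<open>k + 1\<close>, and conversely, so both halves must be proved
    together.\<close>
  obtain f where f: "0 \<le> f" "f < 5 ^ Suc k" "Suc k \<le> c (x + \<sigma> * d + \<sigma> * f)"
    using next_fast_col[OF \<sigma>] by metis
  obtain g where g: "0 \<le> g" "g < 5 ^ Suc k" "Suc k \<le> r (y + \<sigma> * e' + \<sigma> * g)"
    using next_fast_row[OF \<sigma>] by metis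
  have cost: "h * (1 + 1.001 * \<alpha> ^ k) + climb_cost k \<le> h + climb_cost (Suc k)"
    if "h < 5 ^ Suc k" for h :: int
  proof -
    have "real_of_int h \<le> 5 ^ Suc k" using that by (metis less_imp_le of_int_le_iff of_int_numeral of_int_power)
    then have "h * (1.001 * \<alpha> ^ k) \<le> 5 ^ Suc k * (1.001 * \<alpha> ^ k)"
      using alpha_power_pos[of k] by (intro mult_right_mono) auto
    then show ?thesis unfolding climb_cost_Suc by (simp only: distrib_left mult_1_right)
  qed
  have "distance t (x, y) (x + \<sigma> * (d + f), y + \<sigma> * e) \<le> d + e + climb_cost k + f * (1 + 1.001 * \<alpha> ^ k)"
    using distance_triangle[of "(x, y)" "(x + \<sigma> * (d + f), y + \<sigma> * e)" "(x + \<sigma> * d, y + \<sigma> * e)"] row(6)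
      distance_row[OF row(5), of "x + \<sigma> * d" "x + \<sigma> * (d + f)"] f(1) \<sigma>
    by (auto simp: algebra_simps)
  then have 1: "distance t (x, y) (x + \<sigma> * (d + f), y + \<sigma> * e) \<le> (d + f) + e + climb_cost (Suc k)"
    using cost[OF f(2)] by simp
  have "distance t (x, y) (x + \<sigma> * d', y + \<sigma> * (e' + g)) \<le> d' + e' + climb_cost k + g * (1 + 1.001 * \<alpha> ^ k)"
    using distance_triangle[of "(x, y)" "(x + \<sigma> * d', y + \<sigma> * (e' + g))" "(x + \<sigma> * d', y + \<sigma> * e')"] col(6)
      distance_col[OF col(5), of "y + \<sigma> * e'" "y + \<sigma> * (e' + g)"] g(1) \<sigma>
    by (auto simp: algebra_simps)
  then have 2: "distance t (x, y) (x + \<sigma> * d', y + \<sigma> * (e' + g)) \<le> d' + (e' + g) + climb_cost (Suc k)"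
    using cost[OF g(2)] by simp
  have "(0::int) < 5 ^ k" by simp
  \<comment> \<open>The extent bound propagates because \<open>2 * 5 ^ k + 5 ^ (k + 1)\<close> is at
    most \<open>2 * 5 ^ (k + 1)\<close>.\<close>
  then have bounds: "d + f \<le> 2 * 5 ^ Suc k" "e' + g \<le> 2 * 5 ^ Suc k" "e \<le> 2 * 5 ^ Suc k" "d' \<le> 2 * 5 ^ Suc k"
    using row(2,4) col(2,4) f(2) g(2) unfolding power_Suc by linarith+
  show ?case
  proof (intro conjI)
    show "\<exists>d e. 0 \<le> d \<and> d \<le> 2 * 5 ^ Suc k \<and> 0 \<le> e \<and> e \<le> 2 * 5 ^ Suc k \<and> Suc k \<le> r (y + \<sigma> * e) \<and>
        distance t (x, y) (x + \<sigma> * d, y + \<sigma> * e) \<le> d + e + climb_cost (Suc k)"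
      using 2 bounds(2,4) col(1,3) g(1,3)
      by (intro exI[of _ d'] exI[of _ "e' + g"]) (simp add: distrib_left add.assoc)
    show "\<exists>d e. 0 \<le> d \<and> d \<le> 2 * 5 ^ Suc k \<and> 0 \<le> e \<and> e \<le> 2 * 5 ^ Suc k \<and> Suc k \<le> c (x + \<sigma> * d) \<and>
        distance t (x, y) (x + \<sigma> * d, y + \<sigma> * e) \<le> d + e + climb_cost (Suc k)"
      using 1 bounds(1,3) row(1,3) f(1,3)
      by (intro exI[of _ "d + f"] exI[of _ e]) (simp add: distrib_left add.assoc)
  qed
qed

text \<open>Climbing inwards from both ends yields a row of level at least \<open>k\<close> near the
  start and a column of level at least \<open>k\<close> near the end, which meet at
  \<open>(n - d', e)\<close>. Each climb extends at most \<open>2 * 5 ^ k\<close>, so the first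
  hypothesis makes both connecting pieces run forwards.\<close>

lemma diagonal_distance_le:
  assumes "4 * 5 ^ k \<le> m" and "m \<le> n"
  shows "distance t (0, 0) (n, m) \<le> n + m + 2 * (5.005 / (1 - 5 * \<alpha>)) + 1.001 * \<alpha> ^ k * (n + m)"
proof -
  obtain d e where row: "0 \<le> d" "d \<le> 2 * 5 ^ k" "0 \<le> e" "e \<le> 2 * 5 ^ k" "k \<le> r e"
    "distance t (0, 0) (d, e) \<le> d + e + climb_cost k" using climb[of 1 k 0 0] by auto
  obtain d' e' where col: "0 \<le> d'" "d' \<le> 2 * 5 ^ k" "0 \<le> e'" "e' \<le> 2 * 5 ^ k" "k \<le> c (n - d')"
    "distance t (n, m) (n - d', m - e') \<le> d' + e' + climb_cost k" using climb[of "-1" k m n] by auto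
  have le: "d \<le> n - d'" "e \<le> m - e'" using assms row col by auto
  define q where "q = 1.001 * \<alpha> ^ k"
  have q: "0 \<le> q" using alpha_power_pos[of k] by (simp add: q_def)
  have "distance t (0, 0) (n, m) \<le> distance t (0, 0) (d, e) + distance t (d, e) (n - d', e)
      + distance t (n - d', e) (n - d', m - e') + distance t (n, m) (n - d', m - e')"
    using distance_triangle[of "(0, 0)" "(n - d', e)" "(d, e)"]
      distance_triangle[of "(0, 0)" "(n - d', m - e')" "(n - d', e)"]
      distance_triangle[of "(0, 0)" "(n, m)" "(n - d', m - e')"]
      distance_commute[of t "(n, m)" "(n - d', m - e')"] by linarith
  also have "\<dots> \<le> (d + e + climb_cost k) + (n - d' - d) * (1 + q) + (m - e' - e) * (1 + q)
      + (d' + e' + climb_cost k)"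
    using row(6) col(6) distance_row[OF row(5), of d "n - d'"] distance_col[OF col(5), of e "m - e'"] le
    unfolding q_def[symmetric]
    by (intro add_mono) auto
  also have "\<dots> = n + m + 2 * climb_cost k + q * ((n - d' - d) + (m - e' - e))"
    by (simp add: algebra_simps)
  also have "\<dots> \<le> n + m + 2 * (5.005 / (1 - 5 * \<alpha>)) + q * (n + m)"
    using climb_cost_le[of k] row(1,3) col(1,3) q
    by (intro add_mono mult_left_mono) auto
  finally show ?thesis unfolding q_def of_int_add .
qed

end

context environment
begin

text \<open>Between two consecutive crossings of rows of level at least \<open>k\<close> a path near the line of slope
  \<open>s\<close> has to use slow horizontal edges, which the potential \<open>\<phi>\<close> below detects; following the
  grid of lines of level at least \<open>k\<close> is cheaper.\<close>

lemma geodesic_leaves_strip: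
  fixes s N :: real and n m :: int
  assumes s: "0 < s" "s \<le> 1" and N: "0 \<le> N"
    and k: "25 * N + 25 \<le> 5 ^ Suc k" and m: "3 * 5 ^ Suc k \<le> m"
    and geo: "is_geodesic t (0, 0) (n, m) p"
  shows "\<exists>x y. (x, y) \<in> set p \<and> 2 * N < \<bar>real_of_int y - s * real_of_int x\<bar>"
proof (rule ccontr)
  assume "\<not> ?thesis"
  then have strip: "\<bar>y - s * x\<bar> \<le> 2 * N" if "(x, y) \<in> set p" for x y :: int
    using that by force
  define M :: int where "M = 5 ^ Suc k"
  have M: "25 * N + 25 \<le> M" "3 * M \<le> m" using k m by (auto simp: M_def)
  \<comment> \<open>Rows of level at least \<open>k + 1\<close> recur with period \<open>M\<close>;
    \<open>R\<close> is the first at height 0 or above, and \<open>3 * M \<le> m\<close> ensures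
    that the path also meets row \<open>R + 2 * M\<close>.\<close>
  obtain R where R: "0 \<le> R" "R < M" "Suc k \<le> r R"
    using next_fast_row[of 1 "Suc k" 0] by (auto simp: M_def)
  have path: "is_path (0, 0) (n, m) p" using geo by (simp add: is_geodesic_def)
  obtain p1 u1 p2 where p': "p = p1 @ (u1, R) # p2"
    using path_crosses_row[OF path, of R] R M by auto
  define u where "u = (u1, R)"
  note p = p'[folded u_def]
  have geo2: "is_geodesic t u (n, m) (u # p2)" using geodesic_subpath(2)[OF geo[unfolded p]] .
  then have path2: "is_path u (n, m) (u # p2)" by (simp add: is_geodesic_def)
  obtain q1 v1 q2 where q': "u # p2 = q1 @ (v1, R + 2 * M) # q2"
    using path_crosses_row[OF path2, of "R + 2 * M"] R M by (auto simp: u_def)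
  define v where "v = (v1, R + 2 * M)"
  note q = q'[folded v_def]
  have geo3: "is_geodesic t u v (q1 @ [v])" using geodesic_subpath(1)[OF geo2[unfolded q]] .
  then have path3: "is_path u v (q1 @ [v])" and len3: "path_length t (q1 @ [v]) = distance t u v"
    by (auto simp: is_geodesic_def)
  have sub: "set (q1 @ [v]) \<subseteq> set p"
  proof -
    have "set (u # p2) \<subseteq> set p" by (auto simp: p)
    then show ?thesis by (auto simp: q)
  qed
  have u_strip: "\<bar>R - s * u1\<bar> \<le> 2 * N" using strip[of u1 R] by (auto simp: p u_def)
  have v_strip: "\<bar>R + 2 * M - s * v1\<bar> \<le> 2 * N" using strip[of v1 "R + 2 * M"] sub by (auto simp: v_def)
  define W where "W = real_of_int v1 - real_of_int u1"
  have width: "2 * M - 4 * N \<le> s * W" "s * W \<le> 2 * M + 4 * N"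
    using u_strip v_strip by (auto simp: W_def algebra_simps abs_le_iff)
  have wide: "2 * M - 4 * N \<le> W"
  proof -
    have "0 < s * W" using width(1) M(1) N by linarith
    then have "0 < W" using s(1) by (simp add: zero_less_mult_iff)
    then have "s * W \<le> 1 * W" using s(2) by (intro mult_right_mono) auto
    then show ?thesis using width(1) by linarith
  qed
  \<comment> \<open>Two periods are used so that a fast column fits: \<open>d < M\<close>, while the
    width \<open>W\<close> is at least \<open>2 * M - 4 * N\<close>, which exceeds
    \<open>M\<close>.\<close>
  obtain d where d: "0 \<le> d" "d < M" "Suc k \<le> c (u1 + d)"
    using next_fast_col[of 1 "Suc k" u1] by (auto simp: M_def)
  have "u1 + d \<le> v1" using wide d(2) M(1) N unfolding W_def by linarith
  define \<delta> where "\<delta> = 1.001 * \<alpha> ^ Suc k"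
  have upper: "distance t u v \<le> (W + 2 * M) * (1 + \<delta>)"
  proof -
    have R': "Suc k \<le> r (R + 2 * M)"
    proof -
      have "M dvd (R + a (Suc k)) + M * 2" using R(3) unfolding row_ge_iff M_def by (rule dvd_add[OF _ dvd_triv_left])
      then show ?thesis unfolding row_ge_iff M_def by (simp only: ac_simps)
    qed
    have "distance t u v \<le> distance t u (u1 + d, R) + distance t (u1 + d, R) (u1 + d, R + 2 * M)
        + distance t (u1 + d, R + 2 * M) v"
      using distance_triangle[of u v "(u1 + d, R + 2 * M)"]
        distance_triangle[of u "(u1 + d, R + 2 * M)" "(u1 + d, R)"] by linarith
    also have "\<dots> \<le> d * (1 + \<delta>) + (2 * M) * (1 + \<delta>) + (v1 - (u1 + d)) * (1 + \<delta>)"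
      using distance_row[OF R(3), of u1 "u1 + d"] distance_row[OF R', of "u1 + d" v1]
        distance_col[OF d(3), of R "R + 2 * M"] d \<open>u1 + d \<le> v1\<close> R unfolding u_def v_def \<delta>_def
      by (intro add_mono) auto
    finally show ?thesis by (simp add: W_def algebra_simps)
  qed
  \<comment> \<open>For abscissae from \<open>x0\<close> to \<open>x1\<close> the strip lies
    strictly between the consecutive fast rows \<open>R\<close> and \<open>R + M\<close>, so the
    path meets only rows of level at most \<open>k\<close> there.\<close>
  define x0 where "x0 = \<lceil>(R + 2 * N + 1) / s\<rceil>"
  define x1 where "x1 = \<lfloor>(R + M - 2 * N - 1) / s\<rfloor>"
  define X where "X = real_of_int x1 - real_of_int x0"
  \<comment> \<open>Clamping makes \<open>\<phi>\<close> charge the surplus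
    \<open>\<alpha> ^ k\<close> only to horizontal steps inside the slow window.\<close>
  define \<psi> where "\<psi> = (\<lambda>x::int. max x0 (min x x1))"
  define \<phi> where "\<phi> = (\<lambda>z::vertex. real_of_int (fst z + snd z) + \<alpha> ^ k * real_of_int (\<psi> (fst z)))"
  have slow: "r y \<le> k" if "(x, y) \<in> set p" "x0 \<le> x" "x \<le> x1" for x y
  proof (rule ccontr)
    assume "\<not> r y \<le> k"
    then have "M dvd y + a (Suc k)" using row_ge_iff[of "Suc k" y] by (simp add: M_def)
    moreover have "M dvd R + a (Suc k)" using row_ge_iff[of "Suc k" R] R(3) by (simp add: M_def)
    ultimately have "M dvd y - R" by (metis add_diff_cancel_right dvd_diff)
    moreover have "R + 2 * N + 1 \<le> s * x"
      using that(2) s(1) unfolding x0_def by (simp add: ceiling_le_iff divide_le_eq mult.commute)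
    moreover have "s * x \<le> R + M - 2 * N - 1"
      using that(3) s(1) unfolding x1_def by (simp add: le_floor_iff le_divide_eq mult.commute)
    ultimately have "M dvd y - R" "real_of_int R < y" "y < real_of_int (R + M)"
      using strip[OF that(1)] by auto
    then have "M dvd y - R" "0 < y - R" "y - R < M" by linarith+
    then show False by (meson not_le zdvd_imp_le)
  qed
  have "\<phi> v - \<phi> u \<le> path_length t (q1 @ [v])"
  proof (rule path_length_ge_potential[OF path3 sub])
    fix w w' assume ww': "w \<in> set p" "w' \<in> set p" "adjacent w w'"
    obtain x y where w: "w = (x, y)" by (cases w)
    note pow = alpha_power_pos[of k]
    have \<psi>1: "\<psi> (x + 1) - \<psi> x \<le> (if x0 \<le> x \<and> x \<le> x1 then 1 else 0)"
      "\<psi> (x - 1) - \<psi> x \<le> 0" by (auto simp: \<psi>_def)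
    show "\<phi> w' - \<phi> w \<le> t (edge_between w w')"
    proof (cases "w' = (x + 1, y)")
      case True
      have "\<phi> w' - \<phi> w = 1 + \<alpha> ^ k * (\<psi> (x + 1) - \<psi> x)"
        by (simp add: True w \<phi>_def algebra_simps)
      also have "\<dots> \<le> t (Hor (x, y))"
      proof (cases "x0 \<le> x \<and> x \<le> x1")
        case True
        then have "\<alpha> ^ k \<le> \<alpha> ^ r y" using slow[of x y] ww'(1) w by (intro alpha_power_mono) auto
        moreover have "\<alpha> ^ k * (\<psi> (x + 1) - \<psi> x) \<le> \<alpha> ^ k * 1"
          using True \<psi>1(1) pow by (intro mult_left_mono) auto
        ultimately show ?thesis using Hor_ge[of y x] by linarith
      next
        case False
        then have "\<alpha> ^ k * (\<psi> (x + 1) - \<psi> x) \<le> 0"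
          using \<psi>1(1) pow by (simp only: if_False mult_le_0_iff) auto
        then show ?thesis using t_ge_1[of "Hor (x, y)"] by linarith
      qed
      finally show ?thesis by (simp add: True w)
    next
      case False
      have "\<alpha> ^ k * (\<psi> (x - 1) - \<psi> x) \<le> 0" using \<psi>1(2) pow by (auto simp: mult_le_0_iff)
      then have "\<phi> w' - \<phi> w \<le> 1"
        using ww'(3) False by (auto simp: w \<phi>_def adjacent_iff algebra_simps)
      then show ?thesis using t_ge_1[of "edge_between w w'"] by linarith
    qed
  qed
  \<comment> \<open>Each of the two roundings costs at most 1 in \<open>x\<close>, hence at most
    \<open>s \<le> 1\<close> after scaling.\<close>
  moreover have X: "M - 4 * N - 4 \<le> s * X"
  proof -
    have "x0 \<le> (R + 2 * N + 1) / s + 1" "(R + M - 2 * N - 1) / s - 1 \<le> x1" unfolding x0_def x1_def by linarith+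
    then have "s * x0 \<le> R + 2 * N + 1 + s" "R + M - 2 * N - 1 - s \<le> s * x1"
      using s(1) by (auto simp: field_simps)
    then show ?thesis using s(2) by (simp add: X_def algebra_simps)
  qed
  moreover have "x0 \<le> x1"
  proof -
    have "0 < s * X" using X M(1) N by linarith
    then show ?thesis using s(1) by (simp add: X_def zero_less_mult_iff)
  qed
  moreover have "u1 \<le> x0"
  proof -
    have "s * u1 \<le> R + 2 * N + 1" using u_strip by linarith
    then have "u1 \<le> (R + 2 * N + 1) / s" using s(1) by (simp add: field_simps)
    then show ?thesis unfolding x0_def by linarith
  qed
  moreover have "x1 \<le> v1"
  proof -
    have "R + M - 2 * N - 1 \<le> s * v1" using v_strip M(1) N by linarith
    then have "(R + M - 2 * N - 1) / s \<le> v1" using s(1) by (simp add: field_simps)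
    then show ?thesis unfolding x1_def by linarith
  qed
  ultimately have "(W + 2 * M) + \<alpha> ^ k * X \<le> path_length t (q1 @ [v])"
    by (simp add: \<phi>_def \<psi>_def u_def v_def W_def X_def algebra_simps)
  then have "(W + 2 * M) + \<alpha> ^ k * X \<le> distance t u v" by (simp only: len3)
  then have "\<alpha> ^ k * X \<le> (W + 2 * M) * \<delta>" using upper by (simp add: algebra_simps)
  also have "\<dots> = \<alpha> ^ k * (1.001 * \<alpha> * (W + 2 * M))" by (simp add: \<delta>_def algebra_simps)
  finally have "X \<le> 1.001 * \<alpha> * (W + 2 * M)" using alpha_power_pos[of k] by simp
  \<comment> \<open>Here \<open>\<alpha> < 1 / 5\<close> enters: 1001/5000 is
    \<open>1.001 / 5\<close>.\<close>
  also have "\<dots> \<le> 1001 / 5000 * (W + 2 * M)"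
    using alpha_less wide M(1) N by (intro mult_right_mono) auto
  finally have "s * X \<le> s * (1001 / 5000 * (W + 2 * M))" using s(1) by (intro mult_left_mono) auto
  also have "\<dots> = 1001 / 5000 * (s * W + s * (2 * real_of_int M))" by (simp add: algebra_simps)
  finally have "s * X \<le> 1001 / 5000 * (s * W + s * (2 * real_of_int M))" .
  moreover have "s * (2 * real_of_int M) \<le> 1 * (2 * real_of_int M)" using s M(1) N by (intro mult_right_mono) auto
  \<comment> \<open>The upper bound for \<open>A\<close> is at most \<open>0.8008 * (m + N)\<close>,
    which leaves \<open>0.1992 * m \<le> 4.8008 * N + 4\<close>; the factor 25 is just large enough
    to refute this.\<close>
  moreover have arith: False if "A \<le> 1001 / 5000 * (B + C)" "C \<le> 2 * m" "m - 4 * N - 4 \<le> A" "B \<le> 2 * m + 4 * N"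
    "25 * N + 25 \<le> m" for A B C m :: real
    using that N by (simp add: field_simps)
  ultimately show False
    using X width(2) M(1) arith[of "s * X" "s * W" "s * (2 * real_of_int M)" M] by simp
qed

end

subsection \<open>Measurability and null sets\<close>

instance edge :: countable
  by countable_datatype

section \<open>Digits: cylinders, measurability and null sets\<close>

interpretation digit: product_prob_space "\<lambda>_::nat. uniform_count_measure {..<5::nat}" UNIV
proof -
  interpret prob_space "uniform_count_measure {..<5::nat}"
    by (rule prob_space_uniform_count_measure) (simp_all add: lessThan_empty_iff)
  show "product_prob_space (\<lambda>_::nat. uniform_count_measure {..<5::nat})"
    by unfold_locales
qed

lemma prob_space_digit_measure: "prob_space digit_measure"
  unfolding digit_measure_def by (rule digit.prob_space_axioms)

lemma space_digit_measure: "space digit_measure = digit_seqs"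
  by (simp add: digit_measure_def digit_seqs_def space_PiM space_uniform_count_measure)

lemma emeasure_digit_cylinder:
  assumes "finite J" and "\<And>i. i \<in> J \<Longrightarrow> f i < 5"
  shows "emeasure digit_measure {\<omega> \<in> space digit_measure. \<forall>i\<in>J. \<omega> i = f i} = ennreal ((1 / 5) ^ card J)"
proof -
  have "emeasure digit_measure {\<omega> \<in> space digit_measure. \<forall>i\<in>J. \<omega> i \<in> {f i}} =
      (\<Prod>i\<in>J. emeasure (uniform_count_measure {..<5}) {f i})"
    unfolding digit_measure_def using assms
    by (intro digit.emeasure_PiM_Collect) (auto simp: sets_uniform_count_measure)
  also have "\<dots> = (\<Prod>i\<in>J. ennreal (1 / 5))"
    using assms by (intro prod.cong) (auto simp: emeasure_uniform_count_measure divide_ennreal[symmetric])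
  finally show ?thesis by (simp add: ennreal_power)
qed

lemma measure_digit_cylinder:
  assumes "finite J" and "\<And>i. i \<in> J \<Longrightarrow> f i < 5"
  shows "measure digit_measure {\<omega> \<in> space digit_measure. \<forall>i\<in>J. \<omega> i = f i} = (1 / 5) ^ card J"
  using emeasure_digit_cylinder[OF assms] by (simp add: measure_def)

lemma measurable_digit [measurable]: "(\<lambda>\<omega>. \<omega> i) \<in> measurable digit_measure (count_space UNIV)"
proof -
  have "(\<lambda>\<omega>. \<omega> i) \<in> measurable digit_measure (uniform_count_measure {..<5::nat})"
    unfolding digit_measure_def by (rule measurable_component_singleton) simp
  moreover have "(\<lambda>x. x) \<in> measurable (uniform_count_measure {..<5::nat}) (count_space UNIV)"
    by (auto simp: measurable_def sets_uniform_count_measure space_uniform_count_measure)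
  ultimately show ?thesis by (rule measurable_compose)
qed

lemma measurable_count_space_fun2:
  fixes f :: "_ \<Rightarrow> 'a::countable"
  assumes "f \<in> measurable M (count_space UNIV)" and "g \<in> measurable M (count_space UNIV)"
  shows "(\<lambda>x. h (f x) (g x)) \<in> measurable M (count_space UNIV)"
  by (rule measurable_compose_countable[OF _ assms(1)])
    (rule measurable_compose[OF assms(2)], simp)

lemma measurable_digit_val: "digit_val k \<in> measurable digit_measure (count_space UNIV)"
proof (induction k)
  case (Suc k)
  show ?case
    using measurable_count_space_fun2[OF Suc measurable_digit[of k], of "\<lambda>v d. v + int d * 5 ^ k"]
    by (simp add: digit_val_Suc[abs_def])
qed (simp add: digit_val_def[abs_def])

text \<open>Measurability of \<open>inv_into\<close> is not evident, but on the sample space each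
  digit of a power is an arithmetic function of finitely many digits of
  \<open>\<omega>\<close>.\<close>

lemma measurable_pow_digit:
  "(\<lambda>\<omega>. adding_machine_pow y \<omega> i) \<in> measurable digit_measure (count_space UNIV)"
proof -
  have "(\<lambda>\<omega>. nat ((digit_val (Suc i) \<omega> + y) mod 5 ^ Suc i div 5 ^ i)) \<in> measurable digit_measure (count_space UNIV)"
    by (rule measurable_compose[OF measurable_digit_val]) simp
  then show ?thesis
    by (rule measurable_cong[THEN iffD1, rotated])
      (simp add: space_digit_measure adding_machine_pow_digit[symmetric] del: power_Suc)
qed

lemma measurable_first_nonzero_pow [measurable]:
  "(\<lambda>\<omega>. first_nonzero (adding_machine_pow y \<omega>)) \<in> measurable digit_measure (count_space UNIV)"
proof -
  have [measurable]: "Measurable.pred digit_measure (\<lambda>\<omega>. adding_machine_pow y \<omega> i > 0)" for i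
    by (rule measurable_compose[OF measurable_pow_digit]) simp
  show ?thesis unfolding first_nonzero_def by measurable
qed

lemma singleton_digit_null:
  assumes "\<eta> \<in> digit_seqs"
  shows "AE \<omega> in digit_measure. \<omega> \<noteq> \<eta>"
proof -
  interpret prob_space digit_measure by (rule prob_space_digit_measure)
  have meas: "{\<omega> \<in> space digit_measure. \<forall>i. \<omega> i = \<eta> i} \<in> sets digit_measure" by measurable
  have "prob {\<omega> \<in> space digit_measure. \<forall>i. \<omega> i = \<eta> i} \<le> (1 / 5) ^ k" for k
  proof -
    have "prob {\<omega> \<in> space digit_measure. \<forall>i. \<omega> i = \<eta> i} \<le>
        prob {\<omega> \<in> space digit_measure. \<forall>i\<in>{..<k}. \<omega> i = \<eta> i}"
      by (intro finite_measure_mono) auto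
    also have "\<dots> = (1 / 5) ^ card {..<k}"
      using assms by (intro measure_digit_cylinder) (auto simp: digit_seqs_iff)
    finally show ?thesis by simp
  qed
  moreover have "(\<lambda>k. (1 / 5 :: real) ^ k) \<longlonglongrightarrow> 0" by (rule LIMSEQ_power_zero) simp
  ultimately have "prob {\<omega> \<in> space digit_measure. \<forall>i. \<omega> i = \<eta> i} \<le> 0"
    by (intro LIMSEQ_le_const) auto
  then have "prob {\<omega> \<in> space digit_measure. \<forall>i. \<omega> i = \<eta> i} = 0"
    using measure_nonneg by (metis antisym)
  then have "AE \<omega> in digit_measure. \<omega> \<notin> {\<omega> \<in> space digit_measure. \<forall>i. \<omega> i = \<eta> i}"
    using meas by (intro AE_not_in null_setsI) (auto simp: emeasure_eq_measure)
  then show ?thesis using AE_space[of digit_measure] by eventually_elim auto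
qed

text \<open>For each \<open>y\<close> at most one sequence is carried to zero, since all its
  residues are determined, and single sequences are null. Elsewhere \<open>first_nonzero\<close> is
  a genuine minimum.\<close>

lemma AE_pow_nonzero: "AE \<omega> in digit_measure. \<forall>y. \<exists>i. adding_machine_pow y \<omega> i > 0"
proof (unfold AE_all_countable, intro allI)
  fix y
  show "AE \<omega> in digit_measure. \<exists>i. adding_machine_pow y \<omega> i > 0"
  proof (cases "\<exists>\<eta>\<in>digit_seqs. \<forall>i. adding_machine_pow y \<eta> i = 0")
    case True
    then obtain \<eta> where \<eta>: "\<eta> \<in> digit_seqs" "\<And>i. adding_machine_pow y \<eta> i = 0" by blast
    have "\<omega> = \<eta>" if "\<omega> \<in> digit_seqs" "\<And>i. adding_machine_pow y \<omega> i = 0" for \<omega>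
    proof
      fix i
      have "(digit_val (Suc i) \<omega> + y) mod 5 ^ Suc i = 0" "(digit_val (Suc i) \<eta> + y) mod 5 ^ Suc i = 0"
        using that \<eta> by (simp_all only: digit_val_pow[symmetric] digit_val_eq_0_iff) auto
      then have "digit_val (Suc i) \<omega> mod 5 ^ Suc i = digit_val (Suc i) \<eta> mod 5 ^ Suc i"
        by (metis add_diff_cancel_right' mod_diff_left_eq)
      then have "digit_val (Suc i) \<omega> = digit_val (Suc i) \<eta>"
        using digit_val_bounds[OF that(1), of "Suc i"] digit_val_bounds[OF \<eta>(1), of "Suc i"]
        by (simp only: mod_pos_pos_trivial)
      then show "\<omega> i = \<eta> i" using digit_eq_div[OF that(1), of i] digit_eq_div[OF \<eta>(1), of i] by simp
    qed
    then have nonzero: "\<exists>i. adding_machine_pow y \<omega> i > 0" if "\<omega> \<in> space digit_measure" "\<omega> \<noteq> \<eta>" for \<omega>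
      using that by (auto simp: space_digit_measure)
    show ?thesis
      using singleton_digit_null[OF \<eta>(1)] AE_space[of digit_measure]
      by eventually_elim (rule nonzero)
  next
    case False
    then show ?thesis by (intro AE_I2) (auto simp: space_digit_measure)
  qed
qed

text \<open>Fubini in coordinate \<open>i\<close> alone: with the others fixed, \<open>f\<close>
  vanishes for at most one value of that coordinate, which an atomless law avoids. This will exclude
  ties between path lengths.\<close>

lemma AE_PiM_update_neq:
  fixes f :: "('i \<Rightarrow> real) \<Rightarrow> real" and M :: "'i \<Rightarrow> real measure"
  assumes prob: "\<And>i. prob_space (M i)"
    and meas: "f \<in> borel_measurable (PiM UNIV M)"
    and atom: "\<And>x. AE y in M i. y \<noteq> x"
    and inj: "\<And>X x y. f (X(i := x)) = 0 \<Longrightarrow> f (X(i := y)) = 0 \<Longrightarrow> x = y"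
  shows "AE X in PiM UNIV M. f X \<noteq> 0"
proof -
  let ?N = "PiM (UNIV - {i}) M"
  have ins: "insert i (UNIV - {i}) = UNIV" by auto
  interpret Mi: prob_space "M i" by (rule prob)
  interpret N: prob_space ?N by (intro prob_space_PiM prob)
  interpret pair_sigma_finite "M i" ?N ..
  let ?upd = "\<lambda>(x, X). X(i := x)"
  have upd: "?upd \<in> measurable (M i \<Otimes>\<^sub>M ?N) (PiM UNIV M)"
    unfolding case_prod_beta' by (rule measurable_fun_upd[of _ "UNIV - {i}"]) auto
  have eq: "distr (M i \<Otimes>\<^sub>M ?N) (PiM UNIV M) ?upd = PiM UNIV M"
    using distr_pair_PiM_eq_PiM[of "UNIV - {i}" M i] prob unfolding ins by simp
  have sets: "{X \<in> space (PiM UNIV M). f X \<noteq> 0} \<in> sets (PiM UNIV M)" using meas by measurable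
  have sets': "{z \<in> space (M i \<Otimes>\<^sub>M ?N). f (?upd z) \<noteq> 0} \<in> sets (M i \<Otimes>\<^sub>M ?N)"
    using measurable_compose[OF upd meas] by measurable
  have "AE X in ?N. AE x in M i. f (X(i := x)) \<noteq> 0"
  proof (rule AE_I2)
    fix X
    show "AE x in M i. f (X(i := x)) \<noteq> 0"
    proof (cases "\<exists>x0. f (X(i := x0)) = 0")
      case True
      then obtain x0 where "f (X(i := x0)) = 0" by blast
      then show ?thesis using atom[of x0] inj by (auto elim!: eventually_mono)
    qed auto
  qed
  then have "AE x in M i. AE X in ?N. f (X(i := x)) \<noteq> 0"
    using sets' by (subst AE_commute) (auto simp: case_prod_beta')
  then have "AE z in M i \<Otimes>\<^sub>M ?N. f (?upd z) \<noteq> 0"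
    using sets' by (intro AE_pair_measure) auto
  then have "AE X in distr (M i \<Otimes>\<^sub>M ?N) (PiM UNIV M) ?upd. f X \<noteq> 0"
    using sets by (subst AE_distr_iff[OF upd])
  then show ?thesis unfolding eq .
qed

section \<open>Measurability of distances and geodesics\<close>

abbreviation edge_weights :: "(edge \<Rightarrow> real) measure" where
  "edge_weights \<equiv> \<Pi>\<^sub>M e\<in>UNIV. borel"

lemma measurable_path_length [measurable]: "(\<lambda>t. path_length t p) \<in> borel_measurable edge_weights"
proof (induction p rule: induct_list012)
  case (3 u v p)
  have "(\<lambda>t. t (edge_between u v)) \<in> borel_measurable edge_weights"
    by (rule measurable_component_singleton) simp
  then show ?case using 3 by simp
qed simp_all

text \<open>On reals \<open>Sup\<close> is a \<open>LEAST\<close> over upper bounds and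
  \<open>Inf\<close> is defined from it; without bounds the predicate is constantly false, so both
  sides are the same default value.\<close>

lemma Inf_real_not_bdd_below:
  fixes X Y :: "real set"
  assumes "\<not> bdd_below X" and "\<not> bdd_below Y"
  shows "Inf X = Inf Y"
proof -
  have "Sup X = Sup Y" if "\<not> bdd_above X" "\<not> bdd_above Y" for X Y :: "real set"
  proof -
    have "(\<lambda>z. \<forall>x\<in>X. x \<le> z) = (\<lambda>z. \<forall>x\<in>Y. x \<le> z)"
      using that unfolding bdd_above_def by (intro ext) blast
    then show ?thesis unfolding Sup_real_def by simp
  qed
  then show ?thesis using assms unfolding Inf_real_def by (simp add: bdd_above_uminus)
qed

text \<open>For weights without a lower bound on path lengths, \<open>distance\<close> is the infimum of an unbounded
  set, which in type \<open>real\<close> is one fixed junk value.\<close>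

lemma measurable_distance [measurable]: "(\<lambda>t. distance t u v) \<in> borel_measurable edge_weights"
proof -
  have unbounded: "\<not> bdd_below (UNIV :: real set)"
    by (auto simp: bdd_below_def not_le intro: lt_ex)
  \<comment> \<open>Natural bounds and a countable type of paths keep this predicate
    measurable.\<close>
  define bdd where "bdd = (\<lambda>t. \<exists>m::nat. \<forall>p. is_path u v p \<longrightarrow> - real m \<le> path_length t p)"
  have bdd: "bdd t \<longleftrightarrow> bdd_below (path_length t ` Collect (is_path u v))" for t
  proof
    assume "bdd_below (path_length t ` Collect (is_path u v))"
    then obtain B where B: "\<And>p. is_path u v p \<Longrightarrow> B \<le> path_length t p" by (auto simp: bdd_below_def)
    obtain m :: nat where "- B \<le> m" using real_arch_simple by blast
    then show "bdd t" unfolding bdd_def using B by (intro exI[of _ m]) force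
  qed (auto simp: bdd_def bdd_below_def)
  have less: "distance t u v < a \<longleftrightarrow> (if bdd t then \<exists>p. is_path u v p \<and> path_length t p < a
      else Inf (UNIV::real set) < a)" for t a
  proof (cases "bdd t")
    case True
    then show ?thesis unfolding distance_def
      using ex_path by (subst cINF_less_iff) (auto simp: bdd)
  next
    case False
    have "distance t u v = Inf (UNIV::real set)"
      using False unfolding distance_def bdd by (intro Inf_real_not_bdd_below unbounded)
    then show ?thesis using False by simp
  qed
  have [measurable]: "Measurable.pred edge_weights bdd" unfolding bdd_def by measurable
  show ?thesis
    unfolding borel_measurable_iff_less less by measurable
qed

text \<open>Vertex lists form a countable type, so quantifiers over them, including the expanded
  unique existence, preserve measurability for arbitrary \<open>P\<close>.\<close>

lemma measurable_geodesic_pred: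
  "Measurable.pred edge_weights (\<lambda>t. P (geodesic t u v))"
proof -
  have [measurable]: "Measurable.pred edge_weights (\<lambda>t. is_geodesic t u v p)" for p
    unfolding is_geodesic_def
    by (intro pred_intros_logic(3)) (simp_all add: pred_def borel_measurable_eq)
  have eq: "P (geodesic t u v) \<longleftrightarrow>
      (if \<exists>p. is_geodesic t u v p \<and> (\<forall>q. is_geodesic t u v q \<longrightarrow> q = p)
       then \<exists>p. is_geodesic t u v p \<and> P p else P [])" for t
  proof (cases "\<exists>!p. is_geodesic t u v p")
    case True
    then obtain p where p: "\<And>q. is_geodesic t u v q \<longleftrightarrow> q = p" by blast
    then have "is_geodesic t u v = (\<lambda>q. q = p)" by blast
    then have "geodesic t u v = p" by (simp add: geodesic_def)
    then show ?thesis by (simp add: p)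
  next
    case False
    then show ?thesis unfolding geodesic_def Ex1_def by auto
  qed
  show ?thesis unfolding eq by measurable
qed

lemma (in pair_sigma_finite) AE_pair_fst:
  assumes "AE x in M1. P x"
  shows "AE z in M1 \<Otimes>\<^sub>M M2. P (fst z)"
proof -
  obtain N where N: "{x \<in> space M1. \<not> P x} \<subseteq> N" "N \<in> sets M1" "emeasure M1 N = 0"
    using AE_E[OF assms] by metis
  show ?thesis
    using N by (intro AE_I[of _ _ "N \<times> space M2"])
      (auto simp: M2.emeasure_pair_measure_Times space_pair_measure)
qed

lemma (in pair_sigma_finite) AE_pair_snd:
  assumes "AE x in M2. P x"
  shows "AE z in M1 \<Otimes>\<^sub>M M2. P (snd z)"
proof -
  obtain N where N: "{x \<in> space M2. \<not> P x} \<subseteq> N" "N \<in> sets M2" "emeasure M2 N = 0"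
    using AE_E[OF assms] by metis
  show ?thesis
    using N by (intro AE_I[of _ _ "space M1 \<times> N"])
      (auto simp: M2.emeasure_pair_measure_Times space_pair_measure)
qed

section \<open>The random environment: almost sure regularity and absence of ties\<close>

locale fpp =
  fixes \<alpha> :: real
  assumes alpha_pos: "0 < \<alpha>" and alpha_less: "\<alpha> < 0.2"
begin

definition noise_width :: "nat \<Rightarrow> real" where
  "noise_width j = \<alpha> ^ j * (1 - \<alpha>) / 1000"

definition noise_law :: "nat \<times> edge \<Rightarrow> real measure" where
  "noise_law p = uniform_measure lborel {0..noise_width (fst p)}"

text \<open>The samples whose image law is \<open>\<nu> \<alpha>\<close>; probabilities are moved
  here because digits and noise are directly accessible.\<close>

definition source :: "((nat \<Rightarrow> nat) \<times> (nat \<Rightarrow> nat) \<times> (nat \<times> edge \<Rightarrow> real)) measure" where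
  "source = digit_measure \<Otimes>\<^sub>M digit_measure \<Otimes>\<^sub>M noise_measure \<alpha>"

lemma noise_width_pos: "0 < noise_width j"
  using alpha_pos alpha_less by (simp add: noise_width_def)

lemma noise_measure_eq: "noise_measure \<alpha> = PiM UNIV noise_law"
  by (simp add: noise_measure_def noise_law_def[abs_def] noise_width_def)

lemma prob_space_noise_law: "prob_space (noise_law p)"
  unfolding noise_law_def using noise_width_pos[of "fst p"] by (intro prob_space_uniform_measure) auto

lemma sets_noise_law [measurable_cong]: "sets (noise_law p) = sets borel"
  by (simp add: noise_law_def)

sublocale noise: product_prob_space noise_law UNIV
proof -
  interpret prob_space "noise_law p" for p by (rule prob_space_noise_law)
  show "product_prob_space noise_law" by unfold_locales
qed

lemma prob_space_noise_measure: "prob_space (noise_measure \<alpha>)"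
  unfolding noise_measure_eq by (rule noise.prob_space_axioms)

sublocale digit_noise: pair_prob_space digit_measure "noise_measure \<alpha>"
  using prob_space_digit_measure prob_space_noise_measure
  by (simp add: pair_prob_space_def pair_sigma_finite_def prob_space_imp_sigma_finite)

sublocale source_pair: pair_prob_space digit_measure "digit_measure \<Otimes>\<^sub>M noise_measure \<alpha>"
  using prob_space_digit_measure digit_noise.prob_space_axioms
  by (simp add: pair_prob_space_def pair_sigma_finite_def prob_space_imp_sigma_finite)

sublocale source: prob_space source
  unfolding source_def by (rule source_pair.prob_space_axioms)

lemma measurable_noise [measurable]: "(\<lambda>X. X p) \<in> borel_measurable (noise_measure \<alpha>)"
proof -
  have "(\<lambda>X. X p) \<in> measurable (noise_measure \<alpha>) (noise_law p)"
    unfolding noise_measure_eq by (rule measurable_component_singleton) simp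
  then show ?thesis by (simp add: measurable_cong_sets[OF refl sets_noise_law])
qed

lemma measurable_passage_time_edge [measurable]:
  "(\<lambda>z. passage_time \<alpha> z e) \<in> borel_measurable source"
proof -
  have level: "(\<lambda>z. level (fst z) (fst (snd z)) e) \<in> measurable source (count_space UNIV)"
  proof (cases e)
    case (Hor v)
    then show ?thesis unfolding source_def by (cases v) simp
  next
    case (Ver v)
    then show ?thesis unfolding source_def by (cases v) simp
  qed
  have "(\<lambda>z. snd (snd z) (j, e)) \<in> borel_measurable source" for j
    unfolding source_def by measurable
  then have "(\<lambda>z. 1 + \<alpha> ^ j + snd (snd z) (j, e)) \<in> borel_measurable source" for j by measurable
  from measurable_compose_countable[OF this level]
  show ?thesis by (simp add: passage_time_def case_prod_beta')
qed

lemma measurable_passage_time [measurable]: "passage_time \<alpha> \<in> measurable source edge_weights"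
  using measurable_abs_UNIV[of "\<lambda>e z. passage_time \<alpha> z e" source "\<lambda>_. borel"] by simp

lemma \<nu>_eq: "\<nu> \<alpha> = distr source edge_weights (passage_time \<alpha>)"
  by (simp add: \<nu>_def source_def)

lemma AE_noise_bounds: "AE X in noise_measure \<alpha>. \<forall>p. 0 \<le> X p \<and> X p \<le> noise_width (fst p)"
proof (unfold AE_all_countable noise_measure_eq, intro allI)
  fix p
  have "AE x in noise_law p. 0 \<le> x \<and> x \<le> noise_width (fst p)"
    unfolding noise_law_def using noise_width_pos[of "fst p"] by (intro AE_uniform_measureI) auto
  then show "AE X in PiM UNIV noise_law. 0 \<le> X p \<and> X p \<le> noise_width (fst p)"
    by (intro noise.AE_component) auto
qed

definition row_level :: "(nat \<Rightarrow> nat) \<Rightarrow> int \<Rightarrow> nat" where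
  "row_level \<omega> y = first_nonzero (adding_machine_pow y \<omega>)"

lemma passage_time_simps:
  "passage_time \<alpha> (\<omega>1, \<omega>2, X) (Hor (x, y)) =
     1 + \<alpha> ^ row_level \<omega>1 y + X (row_level \<omega>1 y, Hor (x, y))"
  "passage_time \<alpha> (\<omega>1, \<omega>2, X) (Ver (x, y)) =
     1 + \<alpha> ^ row_level \<omega>2 x + X (row_level \<omega>2 x, Ver (x, y))"
  by (simp_all add: passage_time_def row_level_def)

text \<open>The bridge between probability and geometry: for regular samples every estimate of
  \<open>environment\<close> applies.\<close>

definition regular :: "(nat \<Rightarrow> nat) \<times> (nat \<Rightarrow> nat) \<times> (nat \<times> edge \<Rightarrow> real) \<Rightarrow> bool" where
  "regular z \<longleftrightarrow> environment \<alpha> (passage_time \<alpha> z) (row_level (fst z)) (row_level (fst (snd z)))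
     (\<lambda>k. digit_val k (fst z)) (\<lambda>k. digit_val k (fst (snd z)))"

lemma regularI:
  assumes "\<omega>1 \<in> digit_seqs" and "\<omega>2 \<in> digit_seqs"
    and "\<And>y. \<exists>i. adding_machine_pow y \<omega>1 i > 0" and "\<And>x. \<exists>i. adding_machine_pow x \<omega>2 i > 0"
    and "\<And>p. 0 \<le> X p \<and> X p \<le> noise_width (fst p)"
  shows "regular (\<omega>1, \<omega>2, X)"
proof -
  have width: "noise_width j \<le> \<alpha> ^ j / 1000" for j
    using alpha_pos by (auto simp: noise_width_def mult_le_cancel_left1 intro!: divide_right_mono)
  then have noise: "0 \<le> X (j, e)" "X (j, e) \<le> \<alpha> ^ j / 1000" for j e
    using assms(5)[of "(j, e)"] width[of j] unfolding fst_conv by linarith+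
  show ?thesis
    unfolding regular_def fst_conv snd_conv
  proof (unfold_locales, goal_cases)
    case (3 k y)
    then show ?case unfolding row_level_def by (rule le_first_nonzero_pow_iff[OF assms(1,3)])
  next
    case (4 k x)
    then show ?case unfolding row_level_def by (rule le_first_nonzero_pow_iff[OF assms(2,4)])
  next
    case (5 y x)
    then show ?case using noise[of "row_level \<omega>1 y" "Hor (x, y)"] by (simp add: passage_time_simps)
  next
    case (6 x y)
    then show ?case using noise[of "row_level \<omega>1 y" "Hor (x, y)"] by (simp add: passage_time_simps)
  next
    case (7 x y)
    then show ?case using noise[of "row_level \<omega>2 x" "Ver (x, y)"] by (simp add: passage_time_simps)
  next
    case (8 x y)
    then show ?case using noise[of "row_level \<omega>2 x" "Ver (x, y)"] by (simp add: passage_time_simps)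
  qed (use alpha_pos alpha_less in auto)
qed

lemma AE_regular: "AE z in source. regular z"
proof -
  have "AE z in source. \<forall>y. \<exists>i. adding_machine_pow y (fst z) i > 0"
    unfolding source_def by (rule source_pair.AE_pair_fst[OF AE_pow_nonzero])
  moreover have "AE z in source. \<forall>y. \<exists>i. adding_machine_pow y (fst (snd z)) i > 0"
    unfolding source_def
    by (rule source_pair.AE_pair_snd, rule digit_noise.AE_pair_fst[OF AE_pow_nonzero])
  moreover have "AE z in source. \<forall>p. 0 \<le> snd (snd z) p \<and> snd (snd z) p \<le> noise_width (fst p)"
    unfolding source_def
    by (rule source_pair.AE_pair_snd, rule digit_noise.AE_pair_snd[OF AE_noise_bounds])
  moreover have "AE z in source. z \<in> space source" by (rule AE_space)
  ultimately show ?thesis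
  proof eventually_elim
    case (elim z)
    then show ?case using regularI[of "fst z" "fst (snd z)" "snd (snd z)"]
      by (auto simp: source_def space_pair_measure space_digit_measure)
  qed
qed

text \<open>Of the noise variables of \<open>e\<close> only the one at its current level enters the
  weights, so the sum is affine in it, with slope the multiplicity of \<open>e\<close>.\<close>

lemma sum_list_passage_time_update:
  fixes X :: "nat \<times> edge \<Rightarrow> real" and t :: "real \<Rightarrow> edge \<Rightarrow> real" and \<omega>1 \<omega>2 e and x y :: real
  defines "t \<equiv> \<lambda>x. passage_time \<alpha> (\<omega>1, \<omega>2, X((level \<omega>1 \<omega>2 e, e) := x))"
  shows "sum_list (map (t x) A) = sum_list (map (t y) A) + count_list A e * (x - y)"
proof (induction A)
  case (Cons e' A)
  have "t x e' = t y e' + (if e' = e then x - y else 0)"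
    by (simp add: t_def passage_time_def)
  then show ?case using Cons by (simp add: algebra_simps)
qed simp

text \<open>With the digits frozen the level of \<open>e\<close> is fixed, and the difference of the
  sums is affine with nonzero slope in one noise variable; Fubini then restores the digit sequences
  one after the other.\<close>

lemma AE_no_ties:
  "AE z in source. \<forall>A B e. count_list A e \<noteq> count_list B e \<longrightarrow>
     sum_list (map (passage_time \<alpha> z) A) \<noteq> sum_list (map (passage_time \<alpha> z) B)"
proof (unfold AE_all_countable, intro allI)
  fix A B e
  let ?d = "\<lambda>z. sum_list (map (passage_time \<alpha> z) A) - sum_list (map (passage_time \<alpha> z) B)"
  have sum: "(\<lambda>z. sum_list (map (passage_time \<alpha> z) A)) \<in> borel_measurable source" for A
    by (induction A) auto
  then have d [measurable]: "?d \<in> borel_measurable (digit_measure \<Otimes>\<^sub>M digit_measure \<Otimes>\<^sub>M noise_measure \<alpha>)"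
    unfolding source_def[symmetric] by measurable
  show "AE z in source. count_list A e \<noteq> count_list B e \<longrightarrow>
     sum_list (map (passage_time \<alpha> z) A) \<noteq> sum_list (map (passage_time \<alpha> z) B)"
  proof (cases "count_list A e = count_list B e")
    case False
    have "AE X in noise_measure \<alpha>. ?d (\<omega>1, \<omega>2, X) \<noteq> 0"
      if \<omega>: "\<omega>1 \<in> space digit_measure" "\<omega>2 \<in> space digit_measure" for \<omega>1 \<omega>2
      unfolding noise_measure_eq
    proof (rule AE_PiM_update_neq)
      have "(\<lambda>X. (\<omega>1, \<omega>2, X)) \<in> measurable (noise_measure \<alpha>) (digit_measure \<Otimes>\<^sub>M digit_measure \<Otimes>\<^sub>M noise_measure \<alpha>)"
        using \<omega> by measurable
      from measurable_compose[OF this d]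
      show "(\<lambda>X. ?d (\<omega>1, \<omega>2, X)) \<in> borel_measurable (PiM UNIV noise_law)"
        by (simp add: noise_measure_eq)
      show "AE y in noise_law (level \<omega>1 \<omega>2 e, e). y \<noteq> x" for x
        unfolding noise_law_def by (intro AE_uniform_measureI) (auto intro: AE_mp[OF AE_lborel_singleton])
      fix X x y
      assume "?d (\<omega>1, \<omega>2, X((level \<omega>1 \<omega>2 e, e) := x)) = 0" "?d (\<omega>1, \<omega>2, X((level \<omega>1 \<omega>2 e, e) := y)) = 0"
      then have "(real (count_list A e) - real (count_list B e)) * (x - y) = 0"
        using sum_list_passage_time_update[of \<omega>1 \<omega>2 X e x A y] sum_list_passage_time_update[of \<omega>1 \<omega>2 X e x B y]
        by (simp add: algebra_simps)
      then show "x = y" using False by simp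
    qed (rule prob_space_noise_law)
    note inner = this
    define d where "d = ?d"
    have d_meas: "d \<in> borel_measurable (digit_measure \<Otimes>\<^sub>M digit_measure \<Otimes>\<^sub>M noise_measure \<alpha>)"
      unfolding d_def by (rule d)
    have "AE p in digit_measure \<Otimes>\<^sub>M noise_measure \<alpha>. d (\<omega>1, p) \<noteq> 0"
      if \<omega>1: "\<omega>1 \<in> space digit_measure" for \<omega>1
    proof (rule digit_noise.AE_pair_measure)
      have "(\<lambda>p. d (\<omega>1, p)) \<in> borel_measurable (digit_measure \<Otimes>\<^sub>M noise_measure \<alpha>)"
        using measurable_compose_Pair1[OF \<omega>1 d_meas] .
      then show "{p \<in> space (digit_measure \<Otimes>\<^sub>M noise_measure \<alpha>). d (\<omega>1, p) \<noteq> 0} \<in> sets (digit_measure \<Otimes>\<^sub>M noise_measure \<alpha>)"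
        by measurable
      show "AE \<omega>2 in digit_measure. AE X in noise_measure \<alpha>. d (\<omega>1, \<omega>2, X) \<noteq> 0"
        using inner[OF \<omega>1] unfolding d_def by (rule AE_I2)
    qed
    then have "AE \<omega>1 in digit_measure. AE p in digit_measure \<Otimes>\<^sub>M noise_measure \<alpha>. d (\<omega>1, p) \<noteq> 0"
      by (rule AE_I2)
    moreover have "{z \<in> space source. d z \<noteq> 0} \<in> sets source"
      using d_meas unfolding source_def by measurable
    ultimately have "AE z in source. d z \<noteq> 0"
      unfolding source_def by (intro source_pair.AE_pair_measure)
    then show ?thesis by (simp add: d_def)
  qed simp
qed

end

subsection \<open>Variance and exponents\<close>

lemma (in prob_space) variance_le_range:
  fixes X :: "'a \<Rightarrow> real"
  assumes [measurable]: "X \<in> borel_measurable M" and bounds: "AE x in M. lo \<le> X x \<and> X x \<le> hi"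
  shows "variance X \<le> (hi - lo)\<^sup>2"
proof -
  have "AE x in M. norm (X x) \<le> max \<bar>lo\<bar> \<bar>hi\<bar>" using bounds by eventually_elim auto
  then have int: "integrable M X" by (rule integrable_const_bound) simp
  have "AE x in M. lo \<le> X x" "AE x in M. X x \<le> hi" using bounds by auto
  then have E: "lo \<le> expectation X" "expectation X \<le> hi"
    using int by (auto intro: integral_ge_const integral_le_const)
  have sq: "AE x in M. (X x - expectation X)\<^sup>2 \<le> (hi - lo)\<^sup>2"
    using bounds
  proof eventually_elim
    case (elim x)
    then show ?case using E by (intro abs_le_square_iff[THEN iffD1]) auto
  qed
  then have "integrable M (\<lambda>x. (X x - expectation X)\<^sup>2)"
    by (intro integrable_const_bound[of _ "(hi - lo)\<^sup>2"]) auto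
  then show ?thesis using sq by (rule integral_le_const)
qed

lemma (in prob_space) integrable_square_of_range:
  fixes X :: "'a \<Rightarrow> real"
  assumes [measurable]: "X \<in> borel_measurable M" and bounds: "AE x in M. lo \<le> X x \<and> X x \<le> hi"
  shows "integrable M (\<lambda>x. (X x - m)\<^sup>2)"
proof (rule integrable_const_bound[of _ "(max \<bar>lo - m\<bar> \<bar>hi - m\<bar>)\<^sup>2"])
  show "AE x in M. norm ((X x - m)\<^sup>2) \<le> (max \<bar>lo - m\<bar> \<bar>hi - m\<bar>)\<^sup>2"
    using bounds
  proof eventually_elim
    case (elim x)
    then have "\<bar>X x - m\<bar> \<le> max \<bar>lo - m\<bar> \<bar>hi - m\<bar>" by (auto simp: abs_if max_def)
    then have "\<bar>X x - m\<bar>\<^sup>2 \<le> (max \<bar>lo - m\<bar> \<bar>hi - m\<bar>)\<^sup>2" by (intro power_mono) auto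
    then show ?case by simp
  qed
qed simp

text \<open>On whichever side of the midpoint of \<open>u\<close> and \<open>v\<close> the mean
  lies, one of the two events keeps \<open>X\<close> at distance at least \<open>(v - u) / 2\<close>
  from it.\<close>

lemma (in prob_space) variance_ge_separated:
  fixes X :: "'a \<Rightarrow> real"
  assumes [measurable]: "X \<in> borel_measurable M" and bounds: "AE x in M. lo \<le> X x \<and> X x \<le> hi"
    and A [measurable]: "A \<in> events" "AE x in M. x \<in> A \<longrightarrow> X x \<le> u" "q \<le> prob A"
    and B [measurable]: "B \<in> events" "AE x in M. x \<in> B \<longrightarrow> v \<le> X x" "q \<le> prob B"
    and "u \<le> v"
  shows "q * ((v - u) / 2)\<^sup>2 \<le> variance X"
proof -
  define m where "m = expectation X"
  have tail: "prob S * c\<^sup>2 \<le> variance X"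
    if [measurable]: "S \<in> events" and S: "AE x in M. x \<in> S \<longrightarrow> c \<le> \<bar>X x - m\<bar>" and c: "0 \<le> c" for S c
  proof -
    have "prob S * c\<^sup>2 = (LINT x|M. indicator S x * c\<^sup>2)" by simp
    also have "\<dots> \<le> (LINT x|M. (X x - m)\<^sup>2)"
    proof (rule integral_mono_AE)
      show "AE x in M. indicator S x * c\<^sup>2 \<le> (X x - m)\<^sup>2"
        using S
      proof eventually_elim
        case (elim x)
        then show ?case using c power_mono[of c "\<bar>X x - m\<bar>" 2] by (cases "x \<in> S") auto
      qed
      have "integrable M (indicator S :: 'a \<Rightarrow> real)"
        by (rule integrable_real_indicator) (auto simp: emeasure_eq_measure)
      then show "integrable M (\<lambda>x. indicator S x * c\<^sup>2)" by simp
    qed (rule integrable_square_of_range[OF assms(1) bounds])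
    finally show ?thesis by (simp add: m_def)
  qed
  show ?thesis
  proof (cases "m \<ge> (u + v) / 2")
    case True
    have "AE x in M. x \<in> A \<longrightarrow> (v - u) / 2 \<le> \<bar>X x - m\<bar>"
      using A(2)
    proof eventually_elim
      case (elim x)
      then show ?case using True abs_ge_minus_self[of "X x - m"] by (auto simp: field_simps)
    qed
    then have "prob A * ((v - u) / 2)\<^sup>2 \<le> variance X" using \<open>u \<le> v\<close> by (intro tail) auto
    moreover have "q * ((v - u) / 2)\<^sup>2 \<le> prob A * ((v - u) / 2)\<^sup>2" using A(3) by (intro mult_right_mono) auto
    ultimately show ?thesis by linarith
  next
    case False
    have "AE x in M. x \<in> B \<longrightarrow> (v - u) / 2 \<le> \<bar>X x - m\<bar>"
      using B(2)
    proof eventually_elim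
      case (elim x)
      then show ?case using False abs_ge_self[of "X x - m"] by (auto simp: field_simps)
    qed
    then have "prob B * ((v - u) / 2)\<^sup>2 \<le> variance X" using \<open>u \<le> v\<close> by (intro tail) auto
    moreover have "q * ((v - u) / 2)\<^sup>2 \<le> prob B * ((v - u) / 2)\<^sup>2" using B(3) by (intro mult_right_mono) auto
    ultimately show ?thesis by linarith
  qed
qed

text \<open>Constant factors change the exponent by order \<open>1 / ln n\<close>. For uniqueness,
  the error terms of two exponents eventually differ by the constant \<open>2 * c' - 2 * c\<close>,
  which must tend to 0; this makes the definite description \<open>variance_exponent\<close>
  meaningful.\<close>

lemma has_variance_exponent_iff:
  assumes c1: "0 < c1"
    and lower: "\<forall>\<^sub>F n in sequentially. c1 * real n powr (2 * c) \<le> variance_T \<alpha> s n"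
    and upper: "\<forall>\<^sub>F n in sequentially. variance_T \<alpha> s n \<le> c2 * real n powr (2 * c)"
  shows "has_variance_exponent \<alpha> s c' \<longleftrightarrow> c' = c"
proof -
  define \<epsilon> where "\<epsilon> = (\<lambda>n. ln (variance_T \<alpha> s n) / ln (real n) - 2 * c)"
  define K where "K = max \<bar>ln c1\<bar> \<bar>ln c2\<bar>"
  have ev: "\<forall>\<^sub>F n in sequentially. variance_T \<alpha> s n = real n powr (2 * c + \<epsilon> n) \<and> \<bar>\<epsilon> n\<bar> \<le> K / ln (real n)"
    using lower upper eventually_gt_at_top[of 1]
  proof eventually_elim
    case (elim n)
    have ln: "0 < ln (real n)" using elim by simp
    have "0 < c1 * real n powr (2 * c)" using c1 elim by simp
    then have V: "0 < variance_T \<alpha> s n" using elim by linarith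
    then have "0 < c2 * real n powr (2 * c)" using elim by linarith
    then have c2: "0 < c2" using elim by (simp add: zero_less_mult_iff)
    have "ln (c1 * real n powr (2 * c)) \<le> ln (variance_T \<alpha> s n)"
      using \<open>0 < c1 * real n powr (2 * c)\<close> elim V by (subst ln_le_cancel_iff) auto
    then have 1: "ln c1 \<le> ln (variance_T \<alpha> s n) - 2 * c * ln (real n)"
      using c1 elim by (simp add: ln_mult ln_powr)
    have "ln (variance_T \<alpha> s n) \<le> ln (c2 * real n powr (2 * c))"
      using elim V by (subst ln_le_cancel_iff) auto
    then have 2: "ln (variance_T \<alpha> s n) - 2 * c * ln (real n) \<le> ln c2"
      using c2 elim by (simp add: ln_mult ln_powr)
    have "\<epsilon> n = (ln (variance_T \<alpha> s n) - 2 * c * ln (real n)) / ln (real n)"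
      using ln by (simp add: \<epsilon>_def field_simps)
    moreover have "\<bar>ln (variance_T \<alpha> s n) - 2 * c * ln (real n)\<bar> \<le> K" using 1 2 by (auto simp: K_def)
    ultimately have "\<bar>\<epsilon> n\<bar> \<le> K / ln (real n)" using ln by (simp add: divide_right_mono)
    moreover have "real n powr (2 * c + \<epsilon> n) = variance_T \<alpha> s n"
      using elim V ln by (simp add: \<epsilon>_def powr_def)
    ultimately show ?case by simp
  qed
  have ln_lim: "filterlim (\<lambda>n. ln (real n)) at_top sequentially"
    by (rule filterlim_compose[OF ln_at_top filterlim_real_sequentially])
  have "(\<lambda>n. K / ln (real n)) \<longlonglongrightarrow> 0"
    by (rule tendsto_divide_0[OF tendsto_const filterlim_at_top_imp_at_infinity[OF ln_lim]])
  then have \<epsilon>: "\<epsilon> \<longlonglongrightarrow> 0"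
    using eventually_mono[OF ev] by (intro Lim_null_comparison[of \<epsilon> "\<lambda>n. K / ln (real n)"]) auto
  show ?thesis
  proof
    assume "has_variance_exponent \<alpha> s c'"
    then obtain \<epsilon>' where \<epsilon>': "\<epsilon>' \<longlonglongrightarrow> 0"
      and ev': "\<forall>\<^sub>F n in sequentially. variance_T \<alpha> s n = real n powr (2 * c' + \<epsilon>' n)"
      by (auto simp: has_variance_exponent_def)
    have "\<forall>\<^sub>F n in sequentially. \<epsilon> n - \<epsilon>' n = 2 * c' - 2 * c"
      using ev ev' eventually_gt_at_top[of 1]
    proof eventually_elim
      case (elim n)
      then have "real n powr (2 * c + \<epsilon> n) = real n powr (2 * c' + \<epsilon>' n)" by simp
      then have "2 * c + \<epsilon> n = 2 * c' + \<epsilon>' n" using elim by (subst (asm) powr_inj) auto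
      then show ?case by simp
    qed
    moreover have "(\<lambda>n. \<epsilon> n - \<epsilon>' n) \<longlonglongrightarrow> 0" using tendsto_diff[OF \<epsilon> \<epsilon>'] by simp
    ultimately have "(\<lambda>n. 2 * c' - 2 * c) \<longlonglongrightarrow> 0" by (rule Lim_transform_eventually[rotated])
    then show "c' = c" by (simp add: LIMSEQ_const_iff)
  next
    assume "c' = c"
    then show "has_variance_exponent \<alpha> s c'"
      unfolding has_variance_exponent_def using \<epsilon> eventually_mono[OF ev] by (intro exI[of _ \<epsilon>]) auto
  qed
qed

text \<open>The behaviour at \<open>a = \<xi>\<close> may be left open, since the infimum does not
  see it.\<close>

lemma wandering_exponentI:
  assumes "0 < \<xi>"
    and above: "\<And>a. \<xi> < a \<Longrightarrow> 0 < liminf (\<lambda>n. ereal (prob_geodesic_in_cyl \<alpha> s a n))"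
    and below: "\<And>a. 0 < a \<Longrightarrow> a < \<xi> \<Longrightarrow> liminf (\<lambda>n. ereal (prob_geodesic_in_cyl \<alpha> s a n)) \<le> 0"
  shows "wandering_exponent \<alpha> s = \<xi>"
proof -
  let ?S = "{a. 0 < a \<and> 0 < liminf (\<lambda>n. ereal (prob_geodesic_in_cyl \<alpha> s a n))}"
  have "\<xi> \<le> a" if "a \<in> ?S" for a using that below[of a] by (auto simp: not_le[symmetric])
  moreover have mem: "a \<in> ?S" if "\<xi> < a" for a using that above assms(1) by auto
  ultimately show ?thesis
    unfolding wandering_exponent_def
  proof (intro cInf_eq_non_empty)
    show "?S \<noteq> {}" using mem[of "\<xi> + 1"] by auto
    fix y assume y: "\<And>x. x \<in> ?S \<Longrightarrow> y \<le> x"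
    show "y \<le> \<xi>"
    proof (rule dense_ge)
      fix a assume "\<xi> < a"
      then show "y \<le> a" using mem y by blast
    qed
  qed
qed

subsection \<open>Reflecting the noise at the origin\<close>

lemma lborel_distr_reflect: "distr lborel borel (\<lambda>x. w - x) = (lborel :: real measure)"
proof -
  have "distr lborel borel (\<lambda>x. w - x) = distr (distr lborel borel uminus) borel ((+) w)"
    by (subst distr_distr) (auto simp: comp_def)
  then show ?thesis by (simp add: lborel_distr_uminus lborel_distr_plus)
qed

context fpp
begin

text \<open>A measure-preserving change of the noise on \<open>J\<close>, so that a sample and its
  image can be compared under one law.\<close>

definition reflect :: "(nat \<times> edge) set \<Rightarrow> (nat \<times> edge \<Rightarrow> real) \<Rightarrow> nat \<times> edge \<Rightarrow> real" where
  "reflect J X = (\<lambda>p. if p \<in> J then noise_width (fst p) - X p else X p)"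

lemma emeasure_noise_law_reflect:
  assumes [measurable]: "B \<in> sets borel"
  shows "emeasure (noise_law p) ((\<lambda>x. noise_width (fst p) - x) -` B) = emeasure (noise_law p) B"
proof -
  define w where "w = noise_width (fst p)"
  have vim: "(\<lambda>x. w - x) -` S \<in> sets borel" if "S \<in> sets borel" for S
    using measurable_sets[of "\<lambda>x. w - x" borel borel S] that by simp
  have eq: "{0..w} \<inter> (\<lambda>x. w - x) -` B = (\<lambda>x. w - x) -` ({0..w} \<inter> B)" by auto
  have "emeasure lborel ((\<lambda>x. w - x) -` ({0..w} \<inter> B)) = emeasure (distr lborel borel (\<lambda>x. w - x)) ({0..w} \<inter> B)"
    by (subst emeasure_distr) auto
  also have "\<dots> = emeasure lborel ({0..w} \<inter> B)" by (simp add: lborel_distr_reflect)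
  finally show ?thesis
    unfolding noise_law_def w_def[symmetric] using vim[of B] by (simp add: eq)
qed

lemma measurable_reflect [measurable]: "reflect J \<in> measurable (noise_measure \<alpha>) (noise_measure \<alpha>)"
proof -
  have "(\<lambda>X. reflect J X p) \<in> measurable (noise_measure \<alpha>) (noise_law p)" for p
    unfolding measurable_cong_sets[OF refl sets_noise_law] reflect_def by (cases "p \<in> J") auto
  from measurable_abs_UNIV[of "\<lambda>p X. reflect J X p", OF this]
  show ?thesis unfolding noise_measure_eq by simp
qed

lemma distr_reflect: "distr (noise_measure \<alpha>) (noise_measure \<alpha>) (reflect J) = noise_measure \<alpha>"
  unfolding noise_measure_eq
proof (rule noise.PiM_eq)
  fix K and F :: "nat \<times> edge \<Rightarrow> real set"
  assume K: "finite K" "K \<subseteq> UNIV" and F: "\<And>p. p \<in> K \<Longrightarrow> F p \<in> sets (noise_law p)"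
  \<comment> \<open>The preimage of a box is a box with its sides in \<open>J\<close> reflected, so
    it suffices to compare measures side by side.\<close>
  define G where "G = (\<lambda>p. if p \<in> J then (\<lambda>x. noise_width (fst p) - x) -` F p else F p)"
  have F': "F p \<in> sets borel" if "p \<in> K" for p using F[OF that] by (simp add: sets_noise_law)
  have G: "G p \<in> sets (noise_law p)" if "p \<in> K" for p
    using measurable_sets[of "\<lambda>x. noise_width (fst p) - x" borel borel "F p"] F'[OF that]
    by (simp add: G_def sets_noise_law)
  have space: "space (noise_law p) = UNIV" for p by (simp add: noise_law_def)
  have "emeasure (distr (PiM UNIV noise_law) (PiM UNIV noise_law) (reflect J)) (noise.emb UNIV K (PiE K F)) =
      emeasure (PiM UNIV noise_law) (reflect J -` noise.emb UNIV K (PiE K F) \<inter> space (PiM UNIV noise_law))"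
    using measurable_reflect[of J] K F unfolding noise_measure_eq
    by (intro emeasure_distr) (auto intro!: sets_PiM_I)
  also have "reflect J -` noise.emb UNIV K (PiE K F) \<inter> space (PiM UNIV noise_law) = noise.emb UNIV K (PiE K G)"
    by (auto simp: prod_emb_def space_PiM space reflect_def G_def PiE_iff restrict_def extensional_def split: if_splits)
  also have "emeasure (PiM UNIV noise_law) (noise.emb UNIV K (PiE K G)) = (\<Prod>p\<in>K. emeasure (noise_law p) (G p))"
    using K G by (intro noise.emeasure_PiM_emb) auto
  also have "\<dots> = (\<Prod>p\<in>K. emeasure (noise_law p) (F p))"
    using emeasure_noise_law_reflect F' by (intro prod.cong) (auto simp: G_def)
  finally show "emeasure (distr (PiM UNIV noise_law) (PiM UNIV noise_law) (reflect J)) (noise.emb UNIV K (PiE K F)) =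
      (\<Prod>p\<in>K. emeasure (noise_law p) (F p))" .
qed simp

definition reflect_source ::
    "(nat \<times> edge) set \<Rightarrow> (nat \<Rightarrow> nat) \<times> (nat \<Rightarrow> nat) \<times> (nat \<times> edge \<Rightarrow> real) \<Rightarrow>
     (nat \<Rightarrow> nat) \<times> (nat \<Rightarrow> nat) \<times> (nat \<times> edge \<Rightarrow> real)" where
  "reflect_source J = (\<lambda>(\<omega>1, \<omega>2, X). (\<omega>1, \<omega>2, reflect J X))"

lemma measurable_reflect_source [measurable]: "reflect_source J \<in> measurable source source"
  unfolding reflect_source_def source_def by measurable

lemma distr_reflect_source: "distr source source (reflect_source J) = source"
proof -
  note sigma_finite = prob_space_imp_sigma_finite[OF prob_space_noise_measure]
    prob_space_imp_sigma_finite[OF digit_noise.prob_space_axioms]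
  have 1: "distr (digit_measure \<Otimes>\<^sub>M noise_measure \<alpha>) (digit_measure \<Otimes>\<^sub>M noise_measure \<alpha>) (\<lambda>(\<omega>, X). (\<omega>, reflect J X))
      = digit_measure \<Otimes>\<^sub>M noise_measure \<alpha>"
    using pair_measure_distr[of "\<lambda>\<omega>. \<omega>" digit_measure digit_measure "reflect J" "noise_measure \<alpha>" "noise_measure \<alpha>"]
    by (simp add: distr_reflect sigma_finite)
  show ?thesis
    using pair_measure_distr[of "\<lambda>\<omega>. \<omega>" digit_measure digit_measure "\<lambda>(\<omega>, X). (\<omega>, reflect J X)"
        "digit_measure \<Otimes>\<^sub>M noise_measure \<alpha>" "digit_measure \<Otimes>\<^sub>M noise_measure \<alpha>"]
    by (simp add: 1[unfolded case_prod_beta'] sigma_finite source_def reflect_source_def case_prod_beta')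
qed

text \<open>Every path from the origin starts with one of these four edges.\<close>

definition origin_noise :: "(nat \<times> edge) set" where
  "origin_noise = {0} \<times> {Hor (0, 0), Hor (-1, 0), Ver (0, 0), Ver (0, -1)}"

text \<open>First digits 1 give row 0 and column 0 level 0, so the four edges at the origin read
  exactly \<open>origin_noise\<close>. Noise below a third of the width rises by more than a third
  of it when reflected.\<close>

definition low_event :: "((nat \<Rightarrow> nat) \<times> (nat \<Rightarrow> nat) \<times> (nat \<times> edge \<Rightarrow> real)) set" where
  "low_event = {z \<in> space source. fst z 0 = 1 \<and> fst (snd z) 0 = 1 \<and>
     (\<forall>p\<in>origin_noise. snd (snd z) p \<in> {..<noise_width 0 / 3})}"

lemma row_level_0: "\<omega> 0 > 0 \<Longrightarrow> row_level \<omega> 0 = 0"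
  by (simp add: row_level_def adding_machine_pow_def first_nonzero_def)

text \<open>No weight decreases and the first edge of every path gains a third of the width,
  whichever path is optimal before or after.\<close>

lemma reflect_distance_ge:
  assumes "regular z" and "z \<in> low_event" and "v \<noteq> (0, 0)"
  shows "distance (passage_time \<alpha> z) (0, 0) v + noise_width 0 / 3 \<le>
    distance (passage_time \<alpha> (reflect_source origin_noise z)) (0, 0) v"
proof (rule distance_greatest)
  obtain \<omega>1 \<omega>2 X where z: "z = (\<omega>1, \<omega>2, X)" by (metis prod.collapse)
  define t where "t = passage_time \<alpha> z"
  define t' where "t' = passage_time \<alpha> (reflect_source origin_noise z)"
  interpret environment \<alpha> t "row_level \<omega>1" "row_level \<omega>2" "\<lambda>k. digit_val k \<omega>1" "\<lambda>k. digit_val k \<omega>2"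
    using assms(1) by (simp add: regular_def z t_def)
  have low: "\<omega>1 0 = 1" "\<omega>2 0 = 1" and X: "\<And>p. p \<in> origin_noise \<Longrightarrow> X p < noise_width 0 / 3"
    using assms(2) by (auto simp: low_event_def z)
  have mono: "t e \<le> t' e" for e
    using X[of "(level \<omega>1 \<omega>2 e, e)"] noise_width_pos[of 0]
    by (auto simp: t_def t'_def z passage_time_def reflect_source_def reflect_def) (auto simp: origin_noise_def)
  have first: "t e + noise_width 0 / 3 \<le> t' e" if "(0, e) \<in> origin_noise" for e
  proof -
    have "level \<omega>1 \<omega>2 e = 0"
      using that low row_level_0 by (auto simp: origin_noise_def row_level_def)
    then show ?thesis
      using X[OF that] that by (simp add: t_def t'_def z passage_time_def reflect_source_def reflect_def)
  qed
  have le: "path_length t p \<le> path_length t' p" for p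
    unfolding path_length_def using mono by (intro sum_list_mono)
  fix p assume p: "is_path (0, 0) v p"
  then obtain w q where pq: "p = (0, 0) # w # q"
    using assms(3) by (auto simp: is_path_def neq_Nil_conv split: if_splits)
  have "(0, edge_between (0, 0) w) \<in> origin_noise"
    using p edge_between_simps[of 0 0] by (auto simp: pq is_path_def adjacent_iff origin_noise_def)
  then have "path_length t p + noise_width 0 / 3 \<le> path_length t' p"
    using first[of "edge_between (0, 0) w"] le[of "w # q"] by (simp add: pq)
  then show "distance t (0, 0) v + noise_width 0 / 3 \<le> path_length t' p"
    using distance_le[OF p] by linarith
qed

lemma low_event_sets [measurable]: "low_event \<in> sets source"
proof -
  have [measurable]: "(\<lambda>z. fst z 0) \<in> measurable source (count_space UNIV)"
    "(\<lambda>z. fst (snd z) 0) \<in> measurable source (count_space UNIV)"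
    "(\<lambda>z. snd (snd z) p) \<in> borel_measurable source" for p
    unfolding source_def by measurable
  have "finite origin_noise" by (simp add: origin_noise_def)
  then show ?thesis unfolding low_event_def by measurable
qed

lemma prob_low_event: "0 < measure source low_event"
proof -
  let ?A = "{\<omega> \<in> space digit_measure. \<forall>i\<in>{0}. \<omega> i = 1}"
  let ?B = "{X \<in> space (PiM UNIV noise_law). \<forall>p\<in>origin_noise. X p \<in> {..<noise_width 0 / 3}}"
  have fin: "finite origin_noise" by (simp add: origin_noise_def)
  have A: "?A \<in> sets digit_measure" by measurable
  have B: "?B \<in> sets (noise_measure \<alpha>)"
    using fin unfolding noise_measure_eq[symmetric] by measurable
  have eq: "low_event = ?A \<times> ?A \<times> ?B"
    by (auto simp: low_event_def source_def space_pair_measure noise_measure_eq)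
  have "emeasure source low_event = emeasure digit_measure ?A * (emeasure digit_measure ?A * emeasure (noise_measure \<alpha>) ?B)"
    unfolding eq source_def using A B
    by (simp add: sigma_finite_measure.emeasure_pair_measure_Times prob_space_imp_sigma_finite
        prob_space_noise_measure digit_noise.prob_space_axioms)
  moreover have "emeasure digit_measure ?A \<noteq> 0"
    using emeasure_digit_cylinder[of "{0}" "\<lambda>_. 1"] by simp
  moreover have "emeasure (noise_measure \<alpha>) ?B \<noteq> 0"
  proof -
    have "emeasure (noise_measure \<alpha>) ?B = (\<Prod>p\<in>origin_noise. emeasure (noise_law p) {..<noise_width 0 / 3})"
      unfolding noise_measure_eq using fin
      by (intro noise.emeasure_PiM_Collect) (auto simp: sets_noise_law)
    moreover have "emeasure (noise_law p) {..<noise_width 0 / 3} \<noteq> 0" if "p \<in> origin_noise" for p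
    proof -
      have "fst p = 0" using that by (auto simp: origin_noise_def)
      have "{0..<noise_width 0 / 3} \<subseteq> {0..noise_width 0} \<inter> {..<noise_width 0 / 3}"
        using noise_width_pos[of 0] by auto
      then have "emeasure lborel {0..<noise_width 0 / 3} \<le> emeasure lborel ({0..noise_width 0} \<inter> {..<noise_width 0 / 3})"
        by (intro emeasure_mono) auto
      then have "emeasure lborel ({0..noise_width 0} \<inter> {..<noise_width 0 / 3}) \<noteq> 0"
        using noise_width_pos[of 0] by (auto simp: ennreal_eq_0_iff)
      then show ?thesis using \<open>fst p = 0\<close> noise_width_pos[of 0] by (simp add: noise_law_def ennreal_divide_eq_0_iff)
    qed
    ultimately show ?thesis using fin by simp
  qed
  ultimately have "emeasure source low_event \<noteq> 0" by simp
  then show ?thesis using source.emeasure_eq_measure[of low_event] by (simp add: zero_less_measure_iff)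
qed

lemma measurable_distance_source [measurable]:
  "(\<lambda>z. distance (passage_time \<alpha> z) u v) \<in> borel_measurable source"
  by (rule measurable_compose[OF measurable_passage_time measurable_distance])

text \<open>With \<open>w\<close> a third of the width, \<open>T z\<close> and
  \<open>T (\<Psi> z)\<close> differ by at least \<open>w\<close> on \<open>low_event\<close>.
  Invariance of the law bounds twice the variance below by half of \<open>w\<close> squared times
  its probability, whence 36.\<close>

lemma variance_distance_ge:
  assumes "v \<noteq> (0, 0)" and bounds: "AE z in source. lo \<le> distance (passage_time \<alpha> z) (0, 0) v \<and>
      distance (passage_time \<alpha> z) (0, 0) v \<le> hi"
  shows "measure source low_event * (noise_width 0)\<^sup>2 / 36 \<le>
    source.variance (\<lambda>z. distance (passage_time \<alpha> z) (0, 0) v)"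
proof -
  define T where "T = (\<lambda>z. distance (passage_time \<alpha> z) (0, 0) v)"
  define \<Psi> where "\<Psi> = reflect_source origin_noise"
  define m where "m = source.expectation T"
  define w where "w = noise_width 0 / 3"
  have [measurable]: "T \<in> borel_measurable source" unfolding T_def by measurable
  have [measurable]: "\<Psi> \<in> measurable source source" unfolding \<Psi>_def by measurable
  have int: "integrable source (\<lambda>z. (T z - m)\<^sup>2)"
    using bounds unfolding T_def[symmetric] by (intro source.integrable_square_of_range) (auto simp: T_def)
  have distr: "distr source source \<Psi> = source" unfolding \<Psi>_def by (rule distr_reflect_source)
  have int': "integrable source (\<lambda>z. (T (\<Psi> z) - m)\<^sup>2)"
    using int integrable_distr_eq[of \<Psi> source source "\<lambda>z. (T z - m)\<^sup>2"] by (simp add: distr)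
  have eq: "(LINT z|source. (T (\<Psi> z) - m)\<^sup>2) = (LINT z|source. (T z - m)\<^sup>2)"
    using integral_distr[of \<Psi> source source "\<lambda>z. (T z - m)\<^sup>2"] by (simp add: distr)
  have w: "0 \<le> w" using noise_width_pos[of 0] by (simp add: w_def)
  have "measure source low_event * (w\<^sup>2 / 2) = (LINT z|source. indicator low_event z * (w\<^sup>2 / 2))" by simp
  also have "\<dots> \<le> (LINT z|source. (T z - m)\<^sup>2 + (T (\<Psi> z) - m)\<^sup>2)"
  proof (rule integral_mono_AE)
    have "integrable source (indicator low_event :: _ \<Rightarrow> real)"
      by (rule integrable_real_indicator) (auto simp: source.emeasure_eq_measure)
    then show "integrable source (\<lambda>z. indicator low_event z * (w\<^sup>2 / 2))" by simp
    show "integrable source (\<lambda>z. (T z - m)\<^sup>2 + (T (\<Psi> z) - m)\<^sup>2)" using int int' by simp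
    show "AE z in source. indicator low_event z * (w\<^sup>2 / 2) \<le> (T z - m)\<^sup>2 + (T (\<Psi> z) - m)\<^sup>2"
      using AE_regular
    proof eventually_elim
      case (elim z)
      show ?case
      proof (cases "z \<in> low_event")
        case True
        then have "w \<le> T (\<Psi> z) - T z"
          using reflect_distance_ge[OF elim True assms(1)] by (simp add: T_def \<Psi>_def w_def)
        then have "w\<^sup>2 \<le> ((T (\<Psi> z) - m) - (T z - m))\<^sup>2" using w by (intro power_mono) auto
        also have "\<dots> \<le> 2 * ((T z - m)\<^sup>2 + (T (\<Psi> z) - m)\<^sup>2)"
          using zero_le_power2[of "(T (\<Psi> z) - m) + (T z - m)"] by (simp add: power2_eq_square algebra_simps)
        finally show ?thesis using True by simp
      qed simp
    qed
  qed
  also have "\<dots> = 2 * (LINT z|source. (T z - m)\<^sup>2)"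
    using int int' by (simp add: eq)
  finally show ?thesis by (simp add: w_def m_def T_def power_divide)
qed

end

subsection \<open>Directions off the axes\<close>

lemma floor_point_target: "floor_point (target s n) = (int n, \<lfloor>s * real n\<rfloor>)"
  by (simp add: target_def)

lemma floor_point_0: "floor_point 0 = (0, 0)"
  by (simp add: zero_prod_def)

lemma affine_hull_target:
  assumes "w \<in> affine hull {0, target s n}"
  shows "snd w = s * fst w"
proof -
  obtain u v where "w = u *\<^sub>R 0 + v *\<^sub>R target s n" using assms by (auto simp: affine_hull_2)
  then show ?thesis by (simp add: target_def)
qed

text \<open>Both coordinates are within \<open>N\<close> of those of a point on the line, whose
  slope is at most 1; hence the factor 2, which also appears in the strip estimate.\<close>

lemma cyl_strip:
  assumes "0 \<le> s" "s \<le> 1" and "(x, y) \<in> cyl (target s n) N"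
  shows "\<bar>y - s * x\<bar> \<le> 2 * N"
proof -
  let ?L = "affine hull {0, target s n}"
  obtain w where w: "w \<in> ?L" "infdist (x, y) ?L = dist (x, y) w"
    using infdist_attains_inf[of ?L "(x, y)"] by (auto simp: closed_affine_hull)
  obtain a b where ab: "w = (a, b)" by (cases w)
  have d: "dist (x, y) w \<le> N" using assms(3) w(2) by (simp add: cyl_def)
  have 1: "\<bar>x - a\<bar> \<le> N" "\<bar>y - b\<bar> \<le> N"
    using d dist_fst_le[of "(x, y)" w] dist_snd_le[of "(x, y)" w] by (simp_all add: ab dist_real_def)
  have "b = s * a" using affine_hull_target[OF w(1)] by (simp add: ab)
  then have "\<bar>y - s * x\<bar> = \<bar>(y - b) - s * (x - a)\<bar>" by (simp add: algebra_simps)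
  also have "\<dots> \<le> \<bar>y - b\<bar> + \<bar>s * (x - a)\<bar>" by (rule abs_triangle_ineq4)
  also have "\<dots> \<le> N + N"
  proof (rule add_mono[OF 1(2)])
    have "\<bar>s * (x - a)\<bar> \<le> 1 * \<bar>x - a\<bar>" using assms(1,2) unfolding abs_mult by (intro mult_right_mono) auto
    then show "\<bar>s * (x - a)\<bar> \<le> N" using 1(1) by simp
  qed
  finally show ?thesis by simp
qed

lemma cyl_axis:
  assumes "\<bar>y\<bar> \<le> N" and "0 < n"
  shows "(x, y) \<in> cyl (target 0 n) N"
proof -
  have "(x, 0) = (1 - x / n) *\<^sub>R 0 + (x / n) *\<^sub>R target 0 n" using assms(2) by (simp add: target_def)
  then have "(x, 0) \<in> affine hull {0, target 0 n}" unfolding affine_hull_2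
    by (intro CollectI exI[of _ "1 - x / n"] exI[of _ "x / n"]) simp
  then have "infdist (x, y) (affine hull {0, target 0 n}) \<le> dist (x, y) (x, 0)" by (rule infdist_le)
  also have "\<dots> = \<bar>y\<bar>" by (simp add: dist_Pair_Pair dist_real_def)
  finally show ?thesis using assms(1) by (simp add: cyl_def)
qed

lemma cyl_ball:
  assumes "\<bar>x\<bar> + \<bar>y\<bar> \<le> N"
  shows "(x, y) \<in> cyl (target s n) N"
proof -
  have "infdist (x, y) (affine hull {0, target s n}) \<le> dist (x, y) 0"
    by (intro infdist_le hull_inc) simp
  also have "\<dots> \<le> \<bar>x\<bar> + \<bar>y\<bar>" using norm_Pair_le[of x y] by (simp add: dist_norm)
  finally show ?thesis using assms by (simp add: cyl_def)
qed

lemma ex_power_between: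
  fixes b x :: real
  assumes "1 < b" and "1 \<le> x"
  shows "\<exists>k. b ^ k \<le> x \<and> x < b ^ Suc k"
proof -
  define k where "k = (LEAST k. x < b ^ Suc k)"
  obtain m where m: "x < b ^ m" using real_arch_pow[OF assms(1)] by blast
  have "b ^ m \<le> b ^ Suc m" using assms(1) by (intro power_increasing) auto
  then have "x < b ^ Suc m" using m by linarith
  then have upper: "x < b ^ Suc k" unfolding k_def by (rule LeastI)
  have "b ^ k \<le> x"
  proof (cases k)
    case (Suc k')
    then have "k' < k" by simp
    then have "\<not> x < b ^ Suc k'" unfolding k_def by (rule not_less_Least)
    then show ?thesis by (simp add: Suc)
  qed (use assms(2) in simp)
  then show ?thesis using upper by blast
qed

lemma is_geodesic_geodesic:
  assumes "\<exists>!p. is_geodesic t u v p"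
  shows "is_geodesic t u v (geodesic t u v)"
  unfolding geodesic_def using assms theI'[OF assms] by simp

lemma geodesic_or_empty: "geodesic t u v = [] \<or> is_geodesic t u v (geodesic t u v)"
  unfolding geodesic_def by (simp add: theI')

context fpp
begin

abbreviation T :: "real \<Rightarrow> nat \<Rightarrow> (nat \<Rightarrow> nat) \<times> (nat \<Rightarrow> nat) \<times> (nat \<times> edge \<Rightarrow> real) \<Rightarrow> real" where
  "T s n z \<equiv> distance (passage_time \<alpha> z) (0, 0) (int n, \<lfloor>s * real n\<rfloor>)"

abbreviation geo :: "real \<Rightarrow> nat \<Rightarrow> (nat \<Rightarrow> nat) \<times> (nat \<Rightarrow> nat) \<times> (nat \<times> edge \<Rightarrow> real) \<Rightarrow> vertex list" where
  "geo s n z \<equiv> geodesic (passage_time \<alpha> z) (0, 0) (int n, \<lfloor>s * real n\<rfloor>)"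

lemma variance_T_eq: "variance_T \<alpha> s n = source.variance (T s n)"
proof -
  have [measurable]: "(\<lambda>t. distance t (floor_point 0) (floor_point (target s n))) \<in> borel_measurable edge_weights"
    by (rule measurable_distance)
  show ?thesis
    unfolding variance_T_def \<nu>_eq
    by (subst (1 2) integral_distr) (simp_all add: floor_point_target floor_point_0)
qed

lemma prob_geodesic_in_cyl_eq:
  "prob_geodesic_in_cyl \<alpha> s a n =
    measure source {z \<in> space source. plane_point ` set (geo s n z) \<subseteq> cyl (target s n) (real n powr a)}"
  (is "_ = measure source {z \<in> _. ?P (geo s n z)}")
proof -
  have "Measurable.pred edge_weights (\<lambda>t. ?P (geodesic t (0, 0) (int n, \<lfloor>s * real n\<rfloor>)))"
    by (rule measurable_geodesic_pred)
  then have sets: "{t \<in> space edge_weights. ?P (geodesic t (0, 0) (int n, \<lfloor>s * real n\<rfloor>))} \<in> sets edge_weights"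
    by measurable
  show ?thesis
    unfolding prob_geodesic_in_cyl_def \<nu>_eq floor_point_target floor_point_0 space_distr
    by (subst measure_distr[OF measurable_passage_time sets])
      (auto intro!: arg_cong[where f = "measure source"] simp: space_PiM)
qed

lemma geodesic_in_cyl_sets [measurable]:
  "{z \<in> space source. plane_point ` set (geo s n z) \<subseteq> C} \<in> sets source"
proof -
  have "Measurable.pred edge_weights (\<lambda>t. plane_point ` set (geodesic t (0, 0) (int n, \<lfloor>s * real n\<rfloor>)) \<subseteq> C)"
    by (rule measurable_geodesic_pred)
  from measurable_compose[OF measurable_passage_time this] show ?thesis by measurable
qed

text \<open>The default geodesic \<open>[]\<close> lies in every cylinder, so only genuine geodesics
  have to be examined.\<close>

lemma prob_geodesic_in_cyl_eq_1:
  assumes "\<And>z x y. regular z \<Longrightarrow> is_geodesic (passage_time \<alpha> z) (0, 0) (int n, \<lfloor>s * real n\<rfloor>) (geo s n z) \<Longrightarrow>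
    (x, y) \<in> set (geo s n z) \<Longrightarrow> (real_of_int x, real_of_int y) \<in> cyl (target s n) (real n powr a)"
  shows "prob_geodesic_in_cyl \<alpha> s a n = 1"
proof -
  have "AE z in source. plane_point ` set (geo s n z) \<subseteq> cyl (target s n) (real n powr a)"
    using AE_regular
  proof eventually_elim
    case (elim z)
    show ?case
      using geodesic_or_empty[of "passage_time \<alpha> z" "(0, 0)" "(int n, \<lfloor>s * real n\<rfloor>)"] assms[OF elim] by auto
  qed
  then show ?thesis unfolding prob_geodesic_in_cyl_eq by (subst source.prob_Collect_eq_1) measurable
qed

text \<open>For upper bounds the default \<open>[]\<close> would count as confined, so the absence
  of ties is invoked to make the geodesic genuine almost surely.\<close>

lemma prob_geodesic_in_cyl_le:
  assumes S: "S \<in> sets source"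
    and "\<And>z. regular z \<Longrightarrow> is_geodesic (passage_time \<alpha> z) (0, 0) (int n, \<lfloor>s * real n\<rfloor>) (geo s n z) \<Longrightarrow>
    (\<And>x y. (x, y) \<in> set (geo s n z) \<Longrightarrow> (real_of_int x, real_of_int y) \<in> cyl (target s n) (real n powr a)) \<Longrightarrow>
    z \<in> space source \<Longrightarrow> z \<in> S"
  shows "prob_geodesic_in_cyl \<alpha> s a n \<le> measure source S"
  unfolding prob_geodesic_in_cyl_eq
proof (rule source.finite_measure_mono_AE[OF _ S])
  show "AE z in source. z \<in> {z \<in> space source. plane_point ` set (geo s n z) \<subseteq> cyl (target s n) (real n powr a)} \<longrightarrow> z \<in> S"
    using AE_regular AE_no_ties
  proof eventually_elim
    case (elim z)
    interpret environment \<alpha> "passage_time \<alpha> z" "row_level (fst z)" "row_level (fst (snd z))"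
      "\<lambda>k. digit_val k (fst z)" "\<lambda>k. digit_val k (fst (snd z))" using elim(1) by (simp add: regular_def)
    have "is_geodesic (passage_time \<alpha> z) (0, 0) (int n, \<lfloor>s * real n\<rfloor>) (geo s n z)"
      using elim(2) by (intro is_geodesic_geodesic ex1_geodesic) blast
    then show ?case using assms(2)[OF elim(1)] by force
  qed
qed

lemma distance_le_double:
  assumes "regular z" and "0 \<le> s"
  shows "T s n z \<le> 2.001 * (n + s * n)"
proof -
  interpret environment \<alpha> "passage_time \<alpha> z" "row_level (fst z)" "row_level (fst (snd z))"
    "\<lambda>k. digit_val k (fst z)" "\<lambda>k. digit_val k (fst (snd z))" using assms by (simp add: regular_def)
  have row: "distance (passage_time \<alpha> z) (0, 0) (int n, 0) \<le> 2.001 * n"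
    using distance_row[of 0 0 0 "int n"] by simp
  have "distance (passage_time \<alpha> z) (int n, 0) (int n, \<lfloor>s * real n\<rfloor>) \<le> 2.001 * \<lfloor>s * real n\<rfloor>"
    using distance_col[of 0 "int n" 0 "\<lfloor>s * real n\<rfloor>"] assms(2) by simp
  also have "\<dots> \<le> 2.001 * (s * n)" by (intro mult_left_mono) auto
  finally show ?thesis
    unfolding distrib_left by (rule order_trans[OF distance_triangle add_mono[OF row]])
qed

lemma geodesic_in_wide_cyl:
  assumes "0 \<le> s" "s \<le> 1" "1 < a"
  shows "\<forall>\<^sub>F n in sequentially. prob_geodesic_in_cyl \<alpha> s a n = 1"
proof -
  \<comment> \<open>The l1 norm of every vertex on the geodesic is at most the distance, hence at
    most \<open>4.002 * n\<close>.\<close>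
  have "\<forall>\<^sub>F n in sequentially. 5 * real n \<le> real n powr a" using \<open>1 < a\<close> by real_asymp
  then show ?thesis
  proof eventually_elim
    case (elim n)
    show ?case
    proof (rule prob_geodesic_in_cyl_eq_1)
      fix z x y
      assume z: "regular z" "is_geodesic (passage_time \<alpha> z) (0, 0) (int n, \<lfloor>s * real n\<rfloor>) (geo s n z)"
        "(x, y) \<in> set (geo s n z)"
      interpret environment \<alpha> "passage_time \<alpha> z" "row_level (fst z)" "row_level (fst (snd z))"
        "\<lambda>k. digit_val k (fst z)" "\<lambda>k. digit_val k (fst (snd z))" using z(1) by (simp add: regular_def)
      have "\<bar>real_of_int x\<bar> + \<bar>real_of_int y\<bar> \<le> T s n z"
        using path_length_through_ge_l1[of 0 0 "int n" "\<lfloor>s * real n\<rfloor>" "geo s n z" x y] z(2,3)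
        by (simp add: is_geodesic_def)
      also have "\<dots> \<le> 2.001 * (n + s * n)" by (rule distance_le_double[OF z(1) assms(1)])
      finally have "\<bar>real_of_int x\<bar> + \<bar>real_of_int y\<bar> \<le> 2.001 * (n + s * n)" .
      moreover have "s * real n \<le> 1 * real n" using assms(2) by (intro mult_right_mono) auto
      ultimately have "\<bar>real_of_int x\<bar> + \<bar>real_of_int y\<bar> \<le> real n powr a" using elim by (simp add: distrib_left)
      then show "(real_of_int x, real_of_int y) \<in> cyl (target s n) (real n powr a)" by (rule cyl_ball)
    qed
  qed
qed

lemma geodesic_leaves_narrow_cyl:
  assumes s: "0 < s" "s \<le> 1" and a: "0 < a" "a < 1"
  shows "\<forall>\<^sub>F n in sequentially. prob_geodesic_in_cyl \<alpha> s a n = 0"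
proof -
  \<comment> \<open>Here 375 is \<open>3 * 5 * 25\<close>: the chosen \<open>k\<close> has
    \<open>5 ^ k \<le> 25 * (N + 1)\<close>, and the strip estimate asks that
    \<open>3 * 5 ^ Suc k\<close> be at most the height of the target.\<close>
  have "\<forall>\<^sub>F n in sequentially. 375 * (real n powr a + 1) + 1 \<le> s * real n" using s a by real_asymp
  then show ?thesis
  proof eventually_elim
    case (elim n)
    define N where "N = real n powr a"
    have N: "0 \<le> N" by (simp add: N_def)
    obtain k where k: "5 ^ k \<le> 25 * N + 25" "25 * N + 25 < 5 ^ Suc k"
      using ex_power_between[of 5 "25 * N + 25"] N by auto
    have m: "3 * 5 ^ Suc k \<le> \<lfloor>s * real n\<rfloor>"
    proof -
      have "real_of_int (3 * 5 ^ Suc k) \<le> s * real n" using k(1) elim by (simp add: N_def)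
      then show ?thesis by (simp only: le_floor_iff)
    qed
    have "prob_geodesic_in_cyl \<alpha> s a n \<le> measure source {}"
    proof (rule prob_geodesic_in_cyl_le)
      fix z
      assume z: "regular z" "is_geodesic (passage_time \<alpha> z) (0, 0) (int n, \<lfloor>s * real n\<rfloor>) (geo s n z)"
        and cyl: "\<And>x y. (x, y) \<in> set (geo s n z) \<Longrightarrow> (real_of_int x, real_of_int y) \<in> cyl (target s n) (real n powr a)"
      interpret environment \<alpha> "passage_time \<alpha> z" "row_level (fst z)" "row_level (fst (snd z))"
        "\<lambda>k. digit_val k (fst z)" "\<lambda>k. digit_val k (fst (snd z))" using z(1) by (simp add: regular_def)
      obtain x y where xy: "(x, y) \<in> set (geo s n z)" "\<bar>y - s * x\<bar> > 2 * N"
        using geodesic_leaves_strip[OF s N less_imp_le[OF k(2)] m z(2)] by blast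
      then show "z \<in> {}" using cyl_strip[OF less_imp_le[OF s(1)] s(2) cyl[OF xy(1)]] by (simp add: N_def)
    qed simp
    then show ?case by (simp add: prob_geodesic_in_cyl_def measure_le_0_iff)
  qed
qed

lemma wandering_exponent_diagonal:
  assumes "0 < s" "s \<le> 1"
  shows "wandering_exponent \<alpha> s = 1"
proof (rule wandering_exponentI)
  fix a :: real assume "1 < a"
  then have "\<forall>\<^sub>F n in sequentially. ereal (prob_geodesic_in_cyl \<alpha> s a n) = 1"
    using geodesic_in_wide_cyl[of s a] assms by (simp add: one_ereal_def)
  then have "liminf (\<lambda>n. ereal (prob_geodesic_in_cyl \<alpha> s a n)) = liminf (\<lambda>n. 1)" by (rule Liminf_eq)
  then show "0 < liminf (\<lambda>n. ereal (prob_geodesic_in_cyl \<alpha> s a n))" by (simp add: Liminf_const)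
next
  fix a :: real assume "0 < a" "a < 1"
  then have "\<forall>\<^sub>F n in sequentially. ereal (prob_geodesic_in_cyl \<alpha> s a n) = 0"
    using geodesic_leaves_narrow_cyl[of s a] assms by (simp add: zero_ereal_def)
  then have "liminf (\<lambda>n. ereal (prob_geodesic_in_cyl \<alpha> s a n)) = liminf (\<lambda>n. 0)" by (rule Liminf_eq)
  then show "liminf (\<lambda>n. ereal (prob_geodesic_in_cyl \<alpha> s a n)) \<le> 0" by (simp add: Liminf_const)
qed simp

lemma diagonal_distance_bounds:
  assumes s: "0 < s" "s \<le> 1" and z: "regular z" and n: "4 \<le> s * real n"
  shows "n + \<lfloor>s * real n\<rfloor> \<le> T s n z"
    and "T s n z \<le> n + \<lfloor>s * real n\<rfloor> + (2 * (5.005 / (1 - 5 * \<alpha>)) + 1.001 * (20 * (2 / s + 1)))"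
proof -
  interpret environment \<alpha> "passage_time \<alpha> z" "row_level (fst z)" "row_level (fst (snd z))"
    "\<lambda>k. digit_val k (fst z)" "\<lambda>k. digit_val k (fst (snd z))" using z by (simp add: regular_def)
  define m where "m = \<lfloor>s * real n\<rfloor>"
  have m: "4 \<le> m" using n by (simp add: m_def le_floor_iff)
  show "n + \<lfloor>s * real n\<rfloor> \<le> T s n z"
    using distance_ge_l1[of "int n" 0 m 0] m by (simp add: m_def)
  have "s * real n \<le> 1 * real n" using s by (intro mult_right_mono) auto
  then have "m \<le> int n" unfolding m_def by linarith
  \<comment> \<open>The highest level for which both climbs fit; then \<open>m < 20 * 5 ^ k\<close>,
    so the remaining excess is of order \<open>(5 * \<alpha>) ^ k\<close> and hence bounded.\<close>
  obtain k where k: "5 ^ k \<le> real_of_int m / 4" "real_of_int m / 4 < 5 ^ Suc k"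
    using ex_power_between[of 5 "real_of_int m / 4"] m by auto
  have "real_of_int (4 * 5 ^ k) \<le> m" using k(1) by simp
  then have "4 * 5 ^ k \<le> m" by (simp only: of_int_le_iff)
  then have "T s n z \<le> n + m + 2 * (5.005 / (1 - 5 * \<alpha>)) + 1.001 * \<alpha> ^ k * (n + m)"
    using diagonal_distance_le[of k m "int n"] \<open>m \<le> int n\<close> by (simp add: m_def)
  also have "1.001 * \<alpha> ^ k * (n + m) \<le> 1.001 * (20 * (2 / s + 1))"
  proof -
    have "s * n \<le> 2 * m" using m unfolding m_def by linarith
    then have "n + m \<le> (2 / s + 1) * m" using s by (simp add: field_simps)
    also have "\<dots> \<le> (2 / s + 1) * (20 * 5 ^ k)" using k(2) s by (intro mult_left_mono) auto
    finally have "\<alpha> ^ k * (n + m) \<le> \<alpha> ^ k * ((2 / s + 1) * (20 * 5 ^ k))"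
      using alpha_power_pos[of k] by (intro mult_left_mono) auto
    also have "\<dots> = (5 * \<alpha>) ^ k * (20 * (2 / s + 1))" by (simp add: power_mult_distrib)
    also have "\<dots> \<le> 1 * (20 * (2 / s + 1))"
      using s alpha_less alpha_pos by (intro mult_right_mono power_le_one) auto
    finally show ?thesis by simp
  qed
  finally show "T s n z \<le> n + \<lfloor>s * real n\<rfloor> + (2 * (5.005 / (1 - 5 * \<alpha>)) + 1.001 * (20 * (2 / s + 1)))"
    by (simp add: m_def)
qed

lemma variance_exponent_diagonal:
  assumes s: "0 < s" "s \<le> 1"
  shows "has_variance_exponent \<alpha> s c \<longleftrightarrow> c = 0"
proof -
  define C where "C = 2 * (5.005 / (1 - 5 * \<alpha>)) + 1.001 * (20 * (2 / s + 1))"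
  have large: "\<forall>\<^sub>F n in sequentially. 4 \<le> s * real n" using s by real_asymp
  have range: "AE z in source. real n + \<lfloor>s * real n\<rfloor> \<le> T s n z \<and> T s n z \<le> real n + \<lfloor>s * real n\<rfloor> + C"
    if "4 \<le> s * real n" for n
    using AE_regular
    by eventually_elim (use diagonal_distance_bounds[OF s _ that] in \<open>auto simp: C_def\<close>)
  show ?thesis
  proof (rule has_variance_exponent_iff)
    show "0 < measure source low_event * (noise_width 0)\<^sup>2 / 36"
      using prob_low_event noise_width_pos[of 0] by simp
    show "\<forall>\<^sub>F n in sequentially. measure source low_event * (noise_width 0)\<^sup>2 / 36 * real n powr (2 * 0) \<le> variance_T \<alpha> s n"
      using large
    proof eventually_elim
      case (elim n)
      then have "0 < n" by (cases n) auto
      then show ?case using variance_distance_ge[OF _ range[OF elim]] by (simp add: variance_T_eq)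
    qed
    show "\<forall>\<^sub>F n in sequentially. variance_T \<alpha> s n \<le> C\<^sup>2 * real n powr (2 * 0)"
      using large
    proof eventually_elim
      case (elim n)
      then have "0 < n" by (cases n) auto
      then show ?case using source.variance_le_range[OF _ range[OF elim]] by (simp add: variance_T_eq)
    qed
  qed
qed

end

subsection \<open>The axis direction\<close>

lemma digit_val_add:
  "digit_val (l + j) \<omega> = digit_val l \<omega> + 5 ^ l * digit_val j (\<lambda>i. \<omega> (l + i))"
  by (induction j) (auto simp: digit_val_Suc power_add algebra_simps)

lemma digit_val_complement:
  assumes "\<omega> \<in> digit_seqs"
  shows "digit_val j \<omega> = 5 ^ j - 1 - digit_val j (\<lambda>i. 4 - \<omega> i)"
proof (induction j)
  case (Suc j)
  have "\<omega> j < 5" using assms by (simp add: digit_seqs_iff)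
  then have "int (4 - \<omega> j) = 4 - int (\<omega> j)" by linarith
  then show ?case using Suc by (simp add: digit_val_Suc algebra_simps)
qed simp

text \<open>Rows of level at least \<open>l + j\<close> have heights congruent to minus this value
  mod \<open>5 ^ (l + j)\<close>, so a block of fours puts one at height at most
  \<open>5 ^ l\<close> above 0.\<close>

lemma digit_val_block_eq_4:
  assumes "\<omega> \<in> digit_seqs" and "\<And>i. l \<le> i \<Longrightarrow> i < l + j \<Longrightarrow> \<omega> i = 4"
  shows "5 ^ (l + j) - 5 ^ l \<le> digit_val (l + j) \<omega>"
proof -
  define \<eta> where "\<eta> = (\<lambda>i. \<omega> (l + i))"
  have \<eta>: "\<eta> \<in> digit_seqs" using assms(1) by (simp add: \<eta>_def digit_seqs_iff)
  have "digit_val j (\<lambda>i. 4 - \<eta> i) = 0"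
    unfolding digit_val_eq_0_iff using assms(2) by (simp add: \<eta>_def)
  then have "digit_val j \<eta> = 5 ^ j - 1" using digit_val_complement[OF \<eta>, of j] by simp
  then show ?thesis
    using digit_val_bounds(1)[OF assms(1), of l]
    by (simp add: digit_val_add[of l j \<omega>, folded \<eta>_def] power_add right_diff_distrib)
qed

text \<open>A block neither all 0 nor all 4 keeps the value away from both ends of its range, so no
  row of level \<open>l + j\<close> comes closer than \<open>5 ^ l\<close> to the axis on either
  side.\<close>

lemma digit_val_block_bounds:
  assumes \<omega>: "\<omega> \<in> digit_seqs"
    and "\<exists>i. l \<le> i \<and> i < l + j \<and> \<omega> i \<noteq> 0" and "\<exists>i. l \<le> i \<and> i < l + j \<and> \<omega> i \<noteq> 4"
  shows "5 ^ l \<le> digit_val (l + j) \<omega>" and "digit_val (l + j) \<omega> < 5 ^ (l + j) - 5 ^ l"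
proof -
  define \<eta> where "\<eta> = (\<lambda>i. \<omega> (l + i))"
  have \<eta>: "\<eta> \<in> digit_seqs" using \<omega> by (simp add: \<eta>_def digit_seqs_iff)
  note add = digit_val_add[of l j \<omega>, folded \<eta>_def]
  obtain i i' where i: "i < j" "\<eta> i \<noteq> 0" and i': "i' < j" "\<eta> i' \<noteq> 4"
    using assms(2,3) unfolding \<eta>_def by (metis add_less_cancel_left le_iff_add)
  have "digit_val j \<eta> \<noteq> 0" unfolding digit_val_eq_0_iff using i by auto
  then have "1 \<le> digit_val j \<eta>" using digit_val_bounds(1)[OF \<eta>, of j] by linarith
  then have "5 ^ l * 1 \<le> 5 ^ l * digit_val j \<eta>" by (intro mult_left_mono) auto
  then show "5 ^ l \<le> digit_val (l + j) \<omega>"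
    using digit_val_bounds(1)[OF \<omega>, of l] unfolding add by linarith
  have "\<eta> i' < 5" using \<eta> by (simp add: digit_seqs_iff)
  then have "4 - \<eta> i' \<noteq> 0" using i'(2) by linarith
  then have "digit_val j (\<lambda>i. 4 - \<eta> i) \<noteq> 0" unfolding digit_val_eq_0_iff using i'(1) by (metis (no_types))
  moreover have "0 \<le> digit_val j (\<lambda>i. 4 - \<eta> i)" by (simp add: digit_val_def sum_nonneg)
  ultimately have "digit_val j \<eta> \<le> 5 ^ j - 2" using digit_val_complement[OF \<eta>, of j] by linarith
  then have "5 ^ l * digit_val j \<eta> \<le> 5 ^ l * (5 ^ j - 2)" by (intro mult_left_mono) auto
  then show "digit_val (l + j) \<omega> < 5 ^ (l + j) - 5 ^ l"
    using digit_val_bounds(2)[OF \<omega>, of l] unfolding add power_add right_diff_distrib by linarith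
qed

context environment
begin

lemma slow_rows:
  assumes "H \<le> a (Suc k)" and "a (Suc k) + H \<le> 5 ^ Suc k" and "\<bar>y\<bar> < H"
  shows "r y \<le> k"
proof (rule ccontr)
  assume "\<not> r y \<le> k"
  then have "5 ^ Suc k dvd y + a (Suc k)" using row_ge_iff[of "Suc k" y] by simp
  moreover have "0 < y + a (Suc k)" "y + a (Suc k) < 5 ^ Suc k" using assms by auto
  ultimately show False by (meson not_le zdvd_imp_le)
qed

end

context fpp
begin

definition digit_block :: "nat \<Rightarrow> nat \<Rightarrow> nat \<Rightarrow> ((nat \<Rightarrow> nat) \<times> (nat \<Rightarrow> nat) \<times> (nat \<times> edge \<Rightarrow> real)) set" where
  "digit_block l j d = {z \<in> space source. \<forall>i\<in>{l..<l + j}. fst z i = d}"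

lemma digit_block_sets [measurable]: "digit_block l j d \<in> sets source"
proof -
  have [measurable]: "(\<lambda>z. fst z i) \<in> measurable source (count_space UNIV)" for i
    unfolding source_def by measurable
  show ?thesis unfolding digit_block_def by measurable
qed

lemma prob_digit_block:
  assumes "d < 5"
  shows "measure source (digit_block l j d) = (1 / 5) ^ j"
proof -
  let ?A = "{\<omega> \<in> space digit_measure. \<forall>i\<in>{l..<l + j}. \<omega> i = d}"
  have A: "?A \<in> sets digit_measure" by measurable
  have fst: "fst \<in> measurable source digit_measure" unfolding source_def by (rule measurable_fst)
  have "distr source digit_measure fst = digit_measure"
    unfolding source_def by (rule digit_noise.distr_pair_fst)
  then have "measure digit_measure ?A = measure source (fst -` ?A \<inter> space source)"
    using measure_distr[OF fst A] by simp
  moreover have "fst -` ?A \<inter> space source = digit_block l j d"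
    using measurable_space[OF fst] by (auto simp: digit_block_def)
  ultimately show ?thesis
    using measure_digit_cylinder[of "{l..<l + j}" "\<lambda>_. d"] assms by simp
qed

text \<open>The solution of \<open>(5 / \<alpha>) powr axis_exponent = 5\<close>.\<close>

definition axis_exponent :: real where
  "axis_exponent = ln 5 / (ln 5 - ln \<alpha>)"

lemma ln_alpha: "ln \<alpha> < - ln 5"
proof -
  have "ln \<alpha> < ln (1 / 5)" using alpha_pos alpha_less by (subst ln_less_cancel_iff) auto
  then show ?thesis by (simp add: ln_div)
qed

lemma ln_gap: "0 < ln 5 - ln \<alpha>" "2 * ln 5 < ln 5 - ln \<alpha>" "0 < - ln \<alpha>"
proof -
  have "0 < ln (5::real)" by simp
  then show "0 < ln 5 - ln \<alpha>" "2 * ln 5 < ln 5 - ln \<alpha>" "0 < - ln \<alpha>" using ln_alpha by linarith+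
qed

lemma axis_exponent_pos: "0 < axis_exponent" and axis_exponent_less: "axis_exponent < 1 / 2"
proof -
  show "0 < axis_exponent" unfolding axis_exponent_def using ln_gap by (intro divide_pos_pos) auto
  show "axis_exponent < 1 / 2"
    using ln_gap(1,2) by (simp add: axis_exponent_def pos_divide_less_eq)
qed

text \<open>All four bounds restate
  \<open>(5 / \<alpha>) ^ k \<le> n < (5 / \<alpha>) ^ Suc k\<close>: the first two by raising it to
  the power \<open>axis_exponent\<close>, the last two by clearing denominators.\<close>

lemma axis_scale:
  assumes "1 \<le> n"
  obtains k where "5 ^ k \<le> real n powr axis_exponent" and "real n powr axis_exponent < 5 * 5 ^ k"
    and "5 ^ k \<le> real n * \<alpha> ^ k" and "real n * \<alpha> ^ Suc k < 5 ^ Suc k"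
proof -
  have b: "1 < 5 / \<alpha>" using alpha_pos alpha_less by (simp add: field_simps)
  obtain k where k: "(5 / \<alpha>) ^ k \<le> real n" "real n < (5 / \<alpha>) ^ Suc k"
    using ex_power_between[OF b, of n] assms by auto
  have "ln (5 / \<alpha>) = ln 5 - ln \<alpha>" using alpha_pos by (simp add: ln_div)
  then have "axis_exponent * ln (5 / \<alpha>) = ln 5" using ln_alpha axis_exponent_pos by (auto simp: axis_exponent_def)
  then have base: "(5 / \<alpha>) powr axis_exponent = 5" using alpha_pos by (simp add: powr_def)
  have pow: "((5 / \<alpha>) ^ j) powr axis_exponent = 5 ^ j" for j
  proof -
    have "((5 / \<alpha>) ^ j) powr axis_exponent = ((5 / \<alpha>) powr axis_exponent) ^ j"
    proof -
      define B where "B = 5 / \<alpha>"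
      have "0 < B" using alpha_pos by (simp add: B_def)
      then have "(B ^ j) powr axis_exponent = (B powr axis_exponent) ^ j"
        by (simp add: powr_realpow[symmetric] powr_powr mult.commute)
      then show ?thesis by (simp only: B_def)
    qed
    then show ?thesis by (simp add: base)
  qed
  have "((5 / \<alpha>) ^ k) powr axis_exponent \<le> real n powr axis_exponent" using k(1) alpha_pos axis_exponent_pos by (intro powr_mono2) auto
  moreover have "real n powr axis_exponent < ((5 / \<alpha>) ^ Suc k) powr axis_exponent" using k(2) axis_exponent_pos by (intro powr_less_mono2) auto
  moreover have "5 ^ k \<le> real n * \<alpha> ^ k" using k(1) alpha_pos by (simp add: power_divide field_simps)
  moreover have "real n * \<alpha> ^ Suc k < 5 ^ Suc k"
    using k(2) alpha_pos unfolding power_divide by (simp add: field_simps del: power_Suc)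
  ultimately show ?thesis using that[of k] pow[of k] pow[of "Suc k"] by simp
qed

text \<open>In units of \<open>5 ^ k\<close>, with \<open>k\<close> the balancing level:
  \<open>n * \<alpha> ^ k\<close> is below \<open>5 / \<alpha>\<close>, and 4.002 pays for going up
  and down.\<close>

definition axis_const :: real where
  "axis_const = 1.001 * (5 / \<alpha>) + 4.002"

lemma axis_distance_range:
  assumes z: "regular z" and n: "1 \<le> n"
  shows "real n \<le> T 0 n z" and "T 0 n z \<le> real n + axis_const * real n powr axis_exponent"
proof -
  interpret environment \<alpha> "passage_time \<alpha> z" "row_level (fst z)" "row_level (fst (snd z))"
    "\<lambda>k. digit_val k (fst z)" "\<lambda>k. digit_val k (fst (snd z))" using z by (simp add: regular_def)
  show "real n \<le> T 0 n z" using distance_ge_l1[of "int n" 0 0 0] by simp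
  obtain k where k: "5 ^ k \<le> real n powr axis_exponent" "real n * \<alpha> ^ Suc k < 5 ^ Suc k"
    using axis_scale[OF n] by metis
  obtain h where h: "0 \<le> h" "h < 5 ^ k" "k \<le> row_level (fst z) h"
    using next_fast_row[of 1 k 0] by auto
  have "T 0 n z \<le> n * (1 + 1.001 * \<alpha> ^ k) + 4.002 * h"
    using axis_distance_le[OF h(3,1), of "int n"] by simp
  also have "\<dots> = n + 1.001 * (real n * \<alpha> ^ k) + 4.002 * h" by (simp add: algebra_simps)
  also have "\<dots> \<le> n + 1.001 * (5 / \<alpha> * 5 ^ k) + 4.002 * 5 ^ k"
  proof (intro add_mono mult_left_mono)
    show "real n * \<alpha> ^ k \<le> 5 / \<alpha> * 5 ^ k" using k(2) alpha_pos by (simp add: field_simps)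
    have "real_of_int h < real_of_int (5 ^ k)" using h(2) by (simp only: of_int_less_iff)
    then show "real_of_int h \<le> 5 ^ k" by simp
  qed auto
  also have "\<dots> = n + axis_const * 5 ^ k" by (simp add: axis_const_def algebra_simps)
  also have "\<dots> \<le> n + axis_const * real n powr axis_exponent"
    using k(1) alpha_pos by (intro add_left_mono mult_left_mono) (auto simp: axis_const_def)
  finally show "T 0 n z \<le> real n + axis_const * real n powr axis_exponent" .
qed

text \<open>The balancing level will be \<open>k + 2\<close>. Six fours put a row of level
  \<open>k + 6\<close> at height at most \<open>5 ^ k\<close>. Three further powers of
  \<open>\<alpha>\<close> reduce the horizontal excess to \<open>1.001 * 5 ^ k\<close>; adding the
  climb \<open>4.002 * 5 ^ k\<close> stays below \<open>25 / 4 * 5 ^ k\<close>.\<close>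

lemma axis_short_event:
  assumes z: "regular z" "z \<in> digit_block k 6 4"
    and n: "real n * \<alpha> ^ (k + 3) < 5 ^ (k + 3)"
  shows "T 0 n z \<le> n + 5 ^ (k + 2) / 4"
proof -
  interpret environment \<alpha> "passage_time \<alpha> z" "row_level (fst z)" "row_level (fst (snd z))"
    "\<lambda>k. digit_val k (fst z)" "\<lambda>k. digit_val k (fst (snd z))" using z(1) by (simp add: regular_def)
  have D: "fst z \<in> digit_seqs"
    using z(2) by (auto simp: digit_block_def source_def space_pair_measure space_digit_measure)
  define h where "h = 5 ^ (k + 6) - digit_val (k + 6) (fst z)"
  have h: "0 \<le> h" "h \<le> 5 ^ k"
    using digit_val_block_eq_4[OF D, of k 6] digit_val_bounds[OF D, of "k + 6"] z(2)
    by (auto simp: h_def digit_block_def)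
  have "k + 6 \<le> row_level (fst z) h" unfolding row_ge_iff by (simp add: h_def)
  then have "T 0 n z \<le> n * (1 + 1.001 * \<alpha> ^ (k + 6)) + 4.002 * h"
    using axis_distance_le[of "k + 6" h "int n"] h(1) by simp
  also have "\<dots> = n + 1.001 * (real n * \<alpha> ^ (k + 3) * \<alpha> ^ 3) + 4.002 * h"
    by (simp add: algebra_simps power_add[symmetric])
  also have "\<dots> \<le> n + 1.001 * (5 ^ (k + 3) * (1 / 5) ^ 3) + 4.002 * 5 ^ k"
  proof (intro add_mono mult_left_mono mult_mono)
    show "\<alpha> ^ 3 \<le> (1 / 5) ^ 3" using alpha_pos alpha_less by (intro power_mono) auto
    show "real_of_int h \<le> 5 ^ k" using h(2) by (metis of_int_le_iff of_int_numeral of_int_power)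
  qed (use n alpha_pos in auto)
  also have "\<dots> \<le> n + 5 ^ (k + 2) / 4" by (simp add: power_add power_one_over)
  finally show ?thesis .
qed

text \<open>The middle digit 2 keeps rows of level \<open>k + 2\<close> at distance at least
  \<open>2 * 5 ^ (k + 1)\<close> on both sides. A path either goes that far and pays for it twice,
  or stays in slow rows with excess at least \<open>n * \<alpha> ^ (k + 1)\<close>.\<close>

lemma axis_long_event:
  assumes z: "regular z" "z \<in> digit_block (k + 1) 1 2"
    and n: "5 ^ (k + 2) \<le> real n * \<alpha> ^ (k + 2)"
  shows "n + 5 ^ (k + 2) / 2 \<le> T 0 n z"
proof (rule distance_greatest)
  interpret environment \<alpha> "passage_time \<alpha> z" "row_level (fst z)" "row_level (fst (snd z))"
    "\<lambda>k. digit_val k (fst z)" "\<lambda>k. digit_val k (fst (snd z))" using z(1) by (simp add: regular_def)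
  have D: "fst z \<in> digit_seqs"
    using z(2) by (auto simp: digit_block_def source_def space_pair_measure space_digit_measure)
  have "digit_val (Suc (Suc k)) (fst z) = digit_val (Suc k) (fst z) + 2 * 5 ^ Suc k"
    using z(2) by (simp add: digit_block_def digit_val_Suc[of "Suc k"])
  then have val: "2 * 5 ^ Suc k \<le> digit_val (Suc (Suc k)) (fst z)"
    "digit_val (Suc (Suc k)) (fst z) + 2 * 5 ^ Suc k \<le> 5 ^ Suc (Suc k)"
    using digit_val_bounds[OF D, of "Suc k"] by auto
  fix p assume p: "is_path (0, 0) (int n, \<lfloor>0 * real n\<rfloor>) p"
  show "n + 5 ^ (k + 2) / 2 \<le> path_length (passage_time \<alpha> z) p"
  proof (cases "\<exists>x y. (x, y) \<in> set p \<and> 2 * 5 ^ Suc k \<le> \<bar>y\<bar>")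
    case True
    then obtain x y where xy: "(x, y) \<in> set p" "2 * 5 ^ Suc k \<le> \<bar>y\<bar>" by blast
    have "real_of_int (2 * 5 ^ Suc k) \<le> real_of_int \<bar>y\<bar>" using xy(2) by (simp only: of_int_le_iff)
    then show ?thesis
      using path_length_through_ge_l1[of 0 0 "int n" 0 p x y] p xy(1) by simp
  next
    case False
    then have "row_level (fst z) y \<le> Suc k" if "(x, y) \<in> set p" for x y
      using slow_rows[OF val, of y] that by (meson not_le)
    then have "n * (1 + \<alpha> ^ Suc k) \<le> path_length (passage_time \<alpha> z) p"
      using axis_path_slow[of "int n" p "Suc k"] p by simp
    then have "real n + real n * \<alpha> ^ Suc k \<le> path_length (passage_time \<alpha> z) p"
      by (simp add: distrib_left)
    moreover have "real n * \<alpha> ^ (k + 2) \<le> real n * \<alpha> ^ Suc k"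
      by (intro mult_left_mono alpha_power_mono) auto
    moreover have "(5::real) ^ (k + 2) / 2 \<le> 5 ^ (k + 2)" by simp
    ultimately show ?thesis using n by linarith
  qed
qed

lemma variance_exponent_axis: "has_variance_exponent \<alpha> 0 c \<longleftrightarrow> c = axis_exponent"
proof (rule has_variance_exponent_iff)
  have range: "AE z in source. real n \<le> T 0 n z \<and> T 0 n z \<le> real n + axis_const * real n powr axis_exponent"
    if "1 \<le> n" for n
    using AE_regular by eventually_elim (use axis_distance_range[OF _ that] in auto)
  have sq: "(real n powr axis_exponent)\<^sup>2 = real n powr (2 * axis_exponent)" if "1 \<le> n" for n
    using that by (simp add: powr_add[symmetric] power2_eq_square)
  show "\<forall>\<^sub>F n in sequentially. variance_T \<alpha> 0 n \<le> axis_const\<^sup>2 * real n powr (2 * axis_exponent)"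
    using eventually_ge_at_top[of 1]
  proof eventually_elim
    case (elim n)
    then show ?case
      using source.variance_le_range[OF _ range[OF elim]]
      by (simp add: variance_T_eq power_mult_distrib sq)
  qed
  \<comment> \<open>At most six digits are prescribed, which gives \<open>(1 / 5) ^ 6\<close>; half
    the gap is \<open>5 ^ (k + 2) / 8\<close>, and \<open>5 ^ (k + 2)\<close> exceeds a fifth of the
    scale, which gives 1/40.\<close>
  show "(0::real) < (1 / 5) ^ 6 * (1 / 40)\<^sup>2" by simp
  \<comment> \<open>Forces \<open>k' \<ge> 2\<close>, so that \<open>k' - 2\<close> below is a true
    subtraction.\<close>
  have large: "\<forall>\<^sub>F n in sequentially. 25 \<le> real n powr axis_exponent" using axis_exponent_pos by real_asymp
  show "\<forall>\<^sub>F n in sequentially. (1 / 5) ^ 6 * (1 / 40)\<^sup>2 * real n powr (2 * axis_exponent) \<le> variance_T \<alpha> 0 n"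
    using eventually_ge_at_top[of 1] large
  proof eventually_elim
    case (elim n)
    obtain k' where k': "5 ^ k' \<le> real n powr axis_exponent" "real n powr axis_exponent < 5 * 5 ^ k'"
      "5 ^ k' \<le> real n * \<alpha> ^ k'" "real n * \<alpha> ^ Suc k' < 5 ^ Suc k'" using axis_scale[OF elim(1)] by metis
    have "(5::real) ^ 1 < 5 ^ k'" using k'(2) elim(2) by simp
    then have "1 < k'" by (subst (asm) power_strict_increasing_iff) auto
    define k where "k = k' - 2"
    have k: "k' = k + 2" using \<open>1 < k'\<close> by (simp add: k_def)
    have "(1 / 5) ^ 6 * (((n + 5 ^ (k + 2) / 2) - (n + 5 ^ (k + 2) / 4)) / 2)\<^sup>2 \<le> source.variance (T 0 n)"
    proof (rule source.variance_ge_separated[OF _ range[OF elim(1)]])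
      show "AE z in source. z \<in> digit_block k 6 4 \<longrightarrow> T 0 n z \<le> n + 5 ^ (k + 2) / 4"
        using AE_regular
        by eventually_elim (use axis_short_event k'(4) in \<open>auto simp: k numeral_3_eq_3\<close>)
      show "AE z in source. z \<in> digit_block (k + 1) 1 2 \<longrightarrow> n + 5 ^ (k + 2) / 2 \<le> T 0 n z"
        using AE_regular by eventually_elim (use axis_long_event k'(3) in \<open>auto simp: k\<close>)
    qed (auto simp: prob_digit_block power_one_over)
    moreover have "real n powr (2 * axis_exponent) / 40\<^sup>2 \<le> (5 ^ (k + 2) / 8)\<^sup>2"
    proof -
      have "(real n powr axis_exponent / 40)\<^sup>2 \<le> (5 ^ (k + 2) / 8)\<^sup>2" using k'(2) by (intro power_mono) (auto simp: k)
      then show ?thesis by (simp add: power_divide sq[OF elim(1)])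
    qed
    ultimately show ?case by (simp add: variance_T_eq power_divide)
  qed
qed

lemma geodesic_in_axis_cyl:
  assumes "axis_exponent < a"
  shows "\<forall>\<^sub>F n in sequentially. prob_geodesic_in_cyl \<alpha> 0 a n = 1"
proof -
  have "\<forall>\<^sub>F n in sequentially. axis_const * real n powr axis_exponent \<le> real n powr a" using assms axis_exponent_pos by real_asymp
  then show ?thesis using eventually_ge_at_top[of 1]
  proof eventually_elim
    case (elim n)
    show ?case
    proof (rule prob_geodesic_in_cyl_eq_1)
      fix z x y
      assume z: "regular z" "is_geodesic (passage_time \<alpha> z) (0, 0) (int n, \<lfloor>0 * real n\<rfloor>) (geo 0 n z)"
        "(x, y) \<in> set (geo 0 n z)"
      interpret environment \<alpha> "passage_time \<alpha> z" "row_level (fst z)" "row_level (fst (snd z))"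
        "\<lambda>k. digit_val k (fst z)" "\<lambda>k. digit_val k (fst (snd z))" using z(1) by (simp add: regular_def)
      have "real n + 2 * \<bar>real_of_int y\<bar> \<le> T 0 n z"
        using path_length_through_ge_l1[of 0 0 "int n" 0 "geo 0 n z" x y] z(2,3)
        by (simp add: is_geodesic_def)
      then have "\<bar>real_of_int y\<bar> \<le> real n powr a"
        using axis_distance_range(2)[OF z(1) elim(2)] elim(1) by linarith
      then show "(real_of_int x, real_of_int y) \<in> cyl (target 0 n) (real n powr a)"
        using elim(2) by (intro cyl_axis) auto
    qed
  qed
qed

text \<open>Let \<open>5 ^ i\<close> be of the order of the strip height. Unless a block of
  \<open>j\<close> digits is constantly 0 or constantly 4, a confined path meets only levels up to
  \<open>i + j\<close>, and its horizontal excess contradicts the upper bound for the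
  distance.\<close>

lemma geodesic_leaves_axis_cyl:
  assumes a: "0 < a" "a < axis_exponent"
  shows "\<forall>\<^sub>F n in sequentially. prob_geodesic_in_cyl \<alpha> 0 a n \<le> 2 * (1 / 5) ^ j"
proof -
  \<comment> \<open>Thus \<open>\<alpha>\<close> is \<open>5 powr (- \<beta>)\<close>, and the
    exponent is the fixed point of \<open>e = 1 - e * \<beta>\<close>; for smaller \<open>a\<close>
    the excess exponent \<open>1 - a * \<beta>\<close> is strictly larger than it.\<close>
  define \<beta> where "\<beta> = - ln \<alpha> / ln 5"
  have \<beta>: "0 < \<beta>" unfolding \<beta>_def using ln_gap by (intro divide_pos_pos) auto
  define g where "g = ln 5 - ln \<alpha>"
  have "axis_exponent * \<beta> = - ln \<alpha> / g" by (simp add: axis_exponent_def \<beta>_def g_def)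
  moreover have "axis_exponent = (g + ln \<alpha>) / g" by (simp add: axis_exponent_def g_def)
  moreover have "g \<noteq> 0" using ln_gap(1) by (simp add: g_def)
  ultimately have axis_exponent_eq: "axis_exponent = 1 - axis_exponent * \<beta>" by (simp add: add_divide_distrib)
  have alpha_eq: "\<alpha> ^ i = (5 ^ i) powr (- \<beta>)" for i
    using alpha_pos exp_of_nat_mult[of i "ln \<alpha>"] by (simp add: powr_def \<beta>_def ln_realpow mult.commute)
  have "a * \<beta> < axis_exponent * \<beta>" using a \<beta> by (intro mult_strict_right_mono)
  then have exponent: "axis_exponent < 1 - a * \<beta>" using axis_exponent_eq by linarith
  \<comment> \<open>Since \<open>\<alpha> ^ i\<close> is at least
    \<open>(2 * N) powr (- \<beta>)\<close>, the fixed \<open>j\<close> and the factor 2 cost only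
    this constant.\<close>
  define c where "c = \<alpha> ^ j * 2 powr (- \<beta>)"
  have c: "0 < c" using alpha_pos by (simp add: c_def)
  have "\<forall>\<^sub>F n in sequentially. axis_const * real n powr axis_exponent < c * real n powr (1 - a * \<beta>)"
    using exponent c by real_asymp
  then show ?thesis using eventually_ge_at_top[of 1]
  proof eventually_elim
    case (elim n)
    define N where "N = real n powr a"
    have N: "1 \<le> N" using elim(2) a by (simp add: N_def ge_one_powr_ge_zero)
    obtain i where i: "5 ^ i \<le> 2 * N" "2 * N < 5 ^ Suc i" using ex_power_between[of 5 "2 * N"] N by auto
    define l where "l = Suc i"
    define S where "S = digit_block l j 0 \<union> digit_block l j 4"
    have "prob_geodesic_in_cyl \<alpha> 0 a n \<le> measure source S"
    proof (rule prob_geodesic_in_cyl_le)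
      show "S \<in> sets source" unfolding S_def by measurable
      fix z
      assume z: "regular z" "is_geodesic (passage_time \<alpha> z) (0, 0) (int n, \<lfloor>0 * real n\<rfloor>) (geo 0 n z)"
        and cyl: "\<And>x y. (x, y) \<in> set (geo 0 n z) \<Longrightarrow> (real_of_int x, real_of_int y) \<in> cyl (target 0 n) (real n powr a)"
        and space: "z \<in> space source"
      interpret environment \<alpha> "passage_time \<alpha> z" "row_level (fst z)" "row_level (fst (snd z))"
        "\<lambda>k. digit_val k (fst z)" "\<lambda>k. digit_val k (fst (snd z))" using z(1) by (simp add: regular_def)
      have D: "fst z \<in> digit_seqs"
        using space by (auto simp: source_def space_pair_measure space_digit_measure)
      show "z \<in> S"
      proof (rule ccontr)
        assume "z \<notin> S"
        then have "\<exists>i. l \<le> i \<and> i < l + j \<and> fst z i \<noteq> 0" "\<exists>i. l \<le> i \<and> i < l + j \<and> fst z i \<noteq> 4"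
          using space by (auto simp: S_def digit_block_def)
        note val = digit_val_block_bounds[OF D this]
        have Suc_eq: "l + j = Suc (i + j)" by (simp add: l_def)
        have slow: "row_level (fst z) y \<le> i + j" if "(x, y) \<in> set (geo 0 n z)" for x y
        proof (rule slow_rows[where H = "5 ^ l"])
          show "5 ^ l \<le> digit_val (Suc (i + j)) (fst z)" "digit_val (Suc (i + j)) (fst z) + 5 ^ l \<le> 5 ^ Suc (i + j)"
            using val unfolding Suc_eq by auto
          have "\<bar>real_of_int y\<bar> \<le> 2 * N" using cyl_strip[OF _ _ cyl[OF that]] by (simp add: N_def)
          then have "real_of_int \<bar>y\<bar> < real_of_int (5 ^ l)" using i(2) by (simp add: l_def)
          then show "\<bar>y\<bar> < 5 ^ l" by (simp only: of_int_less_iff)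
        qed
        have "n * (1 + \<alpha> ^ (i + j)) \<le> T 0 n z"
          using axis_path_slow[of "int n" "geo 0 n z" "i + j"] slow z(2) by (auto simp: is_geodesic_def)
        moreover have "c * real n powr (1 - a * \<beta>) \<le> n * \<alpha> ^ (i + j)"
        proof -
          have "(2 * N) powr (- \<beta>) \<le> (5 ^ i) powr (- \<beta>)" using i(1) \<beta> by (intro powr_mono2') auto
          then have "\<alpha> ^ j * (2 * N) powr (- \<beta>) \<le> \<alpha> ^ (i + j)"
            using alpha_power_pos[of j] by (simp add: power_add alpha_eq[of i] mult.commute)
          moreover have "(2 * N) powr (- \<beta>) = 2 powr (- \<beta>) * real n powr (- (a * \<beta>))"
            using N by (simp add: powr_mult N_def powr_powr)
          ultimately have "c * real n powr (- (a * \<beta>)) \<le> \<alpha> ^ (i + j)" by (simp add: c_def mult.assoc)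
          then have "real n * (c * real n powr (- (a * \<beta>))) \<le> real n * \<alpha> ^ (i + j)" by (intro mult_left_mono) auto
          moreover have "real n powr (1 - a * \<beta>) = real n * real n powr (- (a * \<beta>))"
            using elim(2) powr_add[of "real n" 1 "- (a * \<beta>)"] by simp
          ultimately show ?thesis by (simp add: mult.left_commute)
        qed
        moreover have "real n * (1 + \<alpha> ^ (i + j)) = real n + real n * \<alpha> ^ (i + j)" by (simp add: distrib_left)
        ultimately show False using axis_distance_range(2)[OF z(1) elim(2)] elim(1) by linarith
      qed
    qed
    also have "\<dots> \<le> measure source (digit_block l j 0) + measure source (digit_block l j 4)"
      unfolding S_def by (intro measure_Un_le) measurable
    also have "\<dots> = 2 * (1 / 5) ^ j" by (simp add: prob_digit_block)
    finally show ?case .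
  qed
qed

lemma wandering_exponent_axis: "wandering_exponent \<alpha> 0 = axis_exponent"
proof (rule wandering_exponentI[OF axis_exponent_pos])
  fix a :: real assume "axis_exponent < a"
  then have "\<forall>\<^sub>F n in sequentially. ereal (prob_geodesic_in_cyl \<alpha> 0 a n) = 1"
    using geodesic_in_axis_cyl[of a] by (simp add: one_ereal_def)
  then have "liminf (\<lambda>n. ereal (prob_geodesic_in_cyl \<alpha> 0 a n)) = liminf (\<lambda>n. 1)" by (rule Liminf_eq)
  then show "0 < liminf (\<lambda>n. ereal (prob_geodesic_in_cyl \<alpha> 0 a n))" by (simp add: Liminf_const)
next
  fix a :: real assume a: "0 < a" "a < axis_exponent"
  have "liminf (\<lambda>n. ereal (prob_geodesic_in_cyl \<alpha> 0 a n)) \<le> ereal (2 * (1 / 5) ^ j)" for j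
  proof -
    have "liminf (\<lambda>n. ereal (prob_geodesic_in_cyl \<alpha> 0 a n)) \<le> liminf (\<lambda>n::nat. ereal (2 * (1 / 5) ^ j))"
      using geodesic_leaves_axis_cyl[OF a, of j] by (intro Liminf_mono) simp
    then show ?thesis by (simp add: Liminf_const)
  qed
  note bound = this
  have lim: "(\<lambda>j. ereal (2 * (1 / 5) ^ j)) \<longlonglongrightarrow> ereal (2 * 0)"
    by (intro tendsto_ereal tendsto_mult tendsto_const LIMSEQ_power_zero) simp
  have "liminf (\<lambda>n. ereal (prob_geodesic_in_cyl \<alpha> 0 a n)) \<le> ereal (2 * 0)"
    by (rule LIMSEQ_le_const[OF lim]) (use bound in blast)
  then show "liminf (\<lambda>n. ereal (prob_geodesic_in_cyl \<alpha> 0 a n)) \<le> 0" by (simp add: zero_ereal_def)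
qed

end

theorem theorem3:
  fixes \<alpha> :: real
  assumes "0 < \<alpha>" and "\<alpha> < 0.2"
  shows "(\<forall>s\<in>{0..1}. \<exists>!c. has_variance_exponent \<alpha> s c) \<and>
    (\<forall>s\<in>{0<..1}. variance_exponent \<alpha> s = 0 \<and> wandering_exponent \<alpha> s = 1) \<and>
    variance_exponent \<alpha> 0 = ln 5 / (ln 5 - ln \<alpha>) \<and>
    wandering_exponent \<alpha> 0 = ln 5 / (ln 5 - ln \<alpha>) \<and>
    (\<forall>s\<in>{0..1}. variance_exponent \<alpha> s \<noteq> 2 * wandering_exponent \<alpha> s - 1)"
proof -
  interpret fpp \<alpha> using assms by unfold_locales
  have diagonal: "variance_exponent \<alpha> s = 0 \<and> wandering_exponent \<alpha> s = 1" if "0 < s" "s \<le> 1" for s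
    using variance_exponent_diagonal[OF that] wandering_exponent_diagonal[OF that]
    by (simp add: variance_exponent_def)
  have axis: "variance_exponent \<alpha> 0 = axis_exponent" "wandering_exponent \<alpha> 0 = axis_exponent"
    using variance_exponent_axis wandering_exponent_axis by (simp_all add: variance_exponent_def)
  have ex1: "\<exists>!c. has_variance_exponent \<alpha> s c" if "0 \<le> s" "s \<le> 1" for s
    using variance_exponent_axis variance_exponent_diagonal[of s] that by (cases "s = 0") auto
  \<comment> \<open>On the axis the relation would force the common value to be 1, but it is below
    1/2; off the axis it would read 0 = 1.\<close>
  have "variance_exponent \<alpha> s \<noteq> 2 * wandering_exponent \<alpha> s - 1" if "0 \<le> s" "s \<le> 1" for s
    using diagonal[of s] axis axis_exponent_less that by (cases "s = 0") auto
  then show ?thesis using diagonal axis ex1 by (auto simp: axis_exponent_def)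
qed

end
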